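(* Let $\mathcal{Z}$ be an abelian group (written additively, with unit element $0$), and let $\mathcal{A}$ be a complex Lie algebra which as a linear space is a direct sum $\mathcal{A}=\oplus_{n\in\mathcal{Z}}\mathcal{A}_n$ with $0\le\dim(\mathcal{A}_n)<\infty$ for all $n\in\mathcal{Z}$, $\dim(\mathcal{A}_0)\neq 0$, and $[\mathcal{A}_m,\mathcal{A}_n]\subset\mathcal{A}_{m+n}$ for all $m,n\in\mathcal{Z}$. Suppose $\mathcal{A}$ carries a nondegenerate, symmetric, invariant bilinear form $\langle\ ,\ \rangle:\mathcal{A}\times\mathcal{A}\to\mathbb{C}$ such that $\langle X,Y\rangle=0$ for all $X\in\mathcal{A}_m$, $Y\in\mathcal{A}_n$ whenever $m+n\neq 0$. Put $\mathcal{K}:=\mathcal{A}_0$ and suppose that there exists a nonempty open subset $\check{\mathcal{K}}\subset\mathcal{K}$ such that for every $\kappa\in\check{\mathcal{K}}$ $$\sigma^n_\kappa\cap 2\pi i\,\mathbb{Z}=\emptyset\quad\forall n\in\mathcal{Z}\setminus\{0\},\qquad \sigma^0_\kappa\cap 2\pi i\,(\mathbb{Z}\setminus\{0\})=\emptyset ,$$ where $\sigma^n_\kappa$ is the spectrum of $(\mathrm{ad}\,\kappa)_n:=\mathrm{ad}\,\kappa\vert_{\mathcal{A}_n}$. Let $R:\check{\mathcal{K}}\to\mathrm{End}(\mathcal{A})$ be the map such that each $R(\kappa)$ preserves every $\mathcal{A}_n$ and $$R(\kappa)\vert_{\mathcal{A}_0}:=f\big((\mathrm{ad}\,\kappa)_0\big),\qquad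 R(\kappa)\vert_{\mathcal{A}_n}:=F\big((\mathrm{ad}\,\kappa)_n\big)\quad\forall n\in\mathcal{Z}\setminus\{0\},$$ with $f(z)=\frac12\coth\frac z2-\frac1z$ and $F(z)=\frac12\coth\frac z2$. Then $R$ satisfies the (modified) classical dynamical Yang–Baxter equation: for all $X,Y\in\mathcal{A}$ and all $\kappa\in\check{\mathcal{K}}$ (the argument $\kappa$ of $R$ and its derivatives being suppressed), $$[RX,RY]-R\big([X,RY]+[RX,Y]\big)+\langle X,(\nabla R)Y\rangle+(\nabla_{Y_{\mathcal{K}}}R)X-(\nabla_{X_{\mathcal{K}}}R)Y=-\tfrac14[X,Y].$$ Moreover, for every $\kappa\in\check{\mathcal{K}}$ the operator $R(\kappa)$ is antisymmetric, i.e. $\langle R(\kappa)X,Y\rangle=-\langle X,R(\kappa)Y\rangle$ for all $X,Y\in\mathcal{A}$, and $R$ is $\mathcal{K}$-equivariant in the sense that $$(\nabla_{[T,\kappa]}R)(\kappa)=[\mathrm{ad}\,T,R(\kappa)]\qquad\forall T\in\mathcal{K},\ \kappa\in\check{\mathcal{K}}.$$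
   Context: Elements of $\mathcal{A}$ are finite linear combinations of homogeneous elements; $\dim(\mathcal{A}_n)=0$ is allowed for some $n$ (then $\sigma^n_\kappa=\emptyset$ and $R(\kappa)\vert_{\mathcal{A}_n}=0$). Invariance of the form means $\langle[X,Y],Z\rangle+\langle Y,[X,Z]\rangle=0$. Note that $[\mathcal{A}_0,\mathcal{A}_n]\subset\mathcal{A}_n$, so $(\mathrm{ad}\,\kappa)_n$ is a linear operator on the finite-dimensional space $\mathcal{A}_n$. The function $f$ is extended holomorphically to $z=0$ (removable singularity, $f(0)=0$). For a linear operator $A$ on a finite-dimensional complex vector space $V$ and a function $H$ holomorphic on an open set containing the spectrum of $A$, $H(A):=\frac{1}{2\pi i}\oint_\Gamma dz\,H(z)(zI_V-A)^{-1}$ (holomorphic functional calculus), with $\Gamma$ a contour in this open set encircling every eigenvalue of $A$ with the orientation of Cauchy's theorem. For $X\in\mathcal{A}$ write $X=X_{\mathcal{K}}+X_{\mathcal{K}^\perp}$ with $X_{\mathcal{K}}\in\mathcal{K}=\mathcal{A}_0$ and $X_{\mathcal{K}^\perp}\in\mathcal{K}^\perp=\oplus_{n\neq0}\mathcal{A}_n$. For $T\in\mathcal{K}$, $\kappa\in\check{\mathcal{K}}$, $$(\nabla_TR)(\kappa):=\frac{d}{dt}R(\kappa+tT)\Big\vert_{t=0},\qquad \langle X,(\nabla R)(\kappa)Y\rangle:=\sum_iK^i\,\langle X,(\nabla_{K_i}R)(\kappa)Y\rangle\in\mathcal{K},$$ where $K_i$ and $K^i$ are dual bases of $\mathcal{K}$,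 $\langle K_i,K^j\rangle=\delta_i^j$. *)

theory Defs
  imports "HOL-Complex_Analysis.Complex_Analysis"
begin

text \<open>
  A complex Lie algebra with underlying type \<open>'a\<close> and scalar multiplication \<open>smul\<close>, graded by
  the abelian group \<open>'z\<close>, with an invariant bilinear form. \<open>br\<close> is the bracket, so that
  \<open>br x\<close> is \<open>ad x\<close>.
\<close>

locale graded_self_dual_lie_algebra =
  vector_space smul
  for smul :: "complex \<Rightarrow> 'a::ab_group_add \<Rightarrow> 'a" +
  fixes gr :: "'z::ab_group_add \<Rightarrow> 'a set"
    and br :: "'a \<Rightarrow> 'a \<Rightarrow> 'a"
    and form :: "'a \<Rightarrow> 'a \<Rightarrow> complex"
  assumes br_linear_right: "Vector_Spaces.linear smul smul (\<lambda>y. br x y)"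
    and br_linear_left: "Vector_Spaces.linear smul smul (\<lambda>x. br x y)"
    and br_alternating: "br x x = 0"
    and br_jacobi: "br x (br y z) + br y (br z x) + br z (br x y) = 0"
    and gr_subspace: "subspace (gr n)"
    and gr_direct_sum:
      "\<exists>!c. (\<forall>n. c n \<in> gr n) \<and> finite {n. c n \<noteq> 0} \<and> x = (\<Sum>n | c n \<noteq> 0. c n)"
    and gr_finite_dim: "\<exists>B. finite B \<and> span B = gr n"
    and gr_zero_dim: "dim (gr 0) \<noteq> 0"
    and gr_br: "x \<in> gr m \<Longrightarrow> y \<in> gr n \<Longrightarrow> br x y \<in> gr (m + n)"
    and form_linear_right: "Vector_Spaces.linear smul (*) (\<lambda>y. form x y)"
    and form_linear_left: "Vector_Spaces.linear smul (*) (\<lambda>x. form x y)"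
    and form_sym: "form x y = form y x"
    and form_nondegenerate: "(\<And>y. form x y = 0) \<Longrightarrow> x = 0"
    and form_invariant: "form (br x y) z + form y (br x z) = 0"
    and form_gr: "m + n \<noteq> 0 \<Longrightarrow> x \<in> gr m \<Longrightarrow> y \<in> gr n \<Longrightarrow> form x y = 0"

definition homogeneous_part :: "('z \<Rightarrow> 'a::ab_group_add set) \<Rightarrow> 'z \<Rightarrow> 'a \<Rightarrow> 'a" where
  "homogeneous_part gr n x =
     (THE c. (\<forall>m. c m \<in> gr m) \<and> finite {m. c m \<noteq> 0} \<and> x = (\<Sum>m | c m \<noteq> 0. c m)) n"

text \<open>
  Topology, derivatives and integrals in finite-dimensional subspaces of \<open>'a\<close> are taken through
  linear functionals: on a finite-dimensional space, the topology induced by all linear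
  functionals is the usual one, and a curve with values in such a space is differentiable or
  integrable iff its compositions with all linear functionals (equivalently, its coordinates
  in a basis) are.
\<close>

definition functionals :: "(complex \<Rightarrow> 'a::ab_group_add \<Rightarrow> 'a) \<Rightarrow> ('a \<Rightarrow> complex) set" where
  "functionals smul = {\<phi>. Vector_Spaces.linear smul (*) \<phi>}"

definition fd_topology :: "(complex \<Rightarrow> 'a::ab_group_add \<Rightarrow> 'a) \<Rightarrow> 'a set \<Rightarrow> 'a topology" where
  "fd_topology smul V =
     pullback_topology V (\<lambda>x. \<lambda>\<phi>\<in>functionals smul. \<phi> x)
       (product_topology (\<lambda>_. euclidean) (functionals smul))"

definition has_curve_derivative ::
  "(complex \<Rightarrow> 'a::ab_group_add \<Rightarrow> 'a) \<Rightarrow> (complex \<Rightarrow> 'a) \<Rightarrow> 'a \<Rightarrow> complex \<Rightarrow> bool" where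
  "has_curve_derivative smul g D t \<longleftrightarrow>
     (\<forall>\<phi>\<in>functionals smul. ((\<lambda>s. \<phi> (g s)) has_field_derivative \<phi> D) (at t))"

definition curve_contour_integral ::
  "(complex \<Rightarrow> 'a::ab_group_add \<Rightarrow> 'a) \<Rightarrow> (real \<Rightarrow> complex) \<Rightarrow> (complex \<Rightarrow> 'a) \<Rightarrow> 'a" where
  "curve_contour_integral smul \<gamma> g =
     (THE y. \<forall>\<phi>\<in>functionals smul. ((\<lambda>z. \<phi> (g z)) has_contour_integral \<phi> y) \<gamma>)"

definition spectrum_on ::
  "(complex \<Rightarrow> 'a::ab_group_add \<Rightarrow> 'a) \<Rightarrow> 'a set \<Rightarrow> ('a \<Rightarrow> 'a) \<Rightarrow> complex set" where
  "spectrum_on smul V A = {z. \<not> bij_betw (\<lambda>v. smul z v - A v) V V}"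

definition resolvent_on ::
  "(complex \<Rightarrow> 'a::ab_group_add \<Rightarrow> 'a) \<Rightarrow> 'a set \<Rightarrow> ('a \<Rightarrow> 'a) \<Rightarrow> complex \<Rightarrow> 'a \<Rightarrow> 'a" where
  "resolvent_on smul V A z = inv_into V (\<lambda>v. smul z v - A v)"

text \<open>
  A contour is a finite list of closed paths (a cycle), since small circles around the
  individual eigenvalues are to be allowed.
\<close>

definition encircling_contour ::
  "complex set \<Rightarrow> complex set \<Rightarrow> (real \<Rightarrow> complex) list \<Rightarrow> bool" where
  "encircling_contour U S \<Gamma> \<longleftrightarrow>
     (\<forall>\<gamma>\<in>set \<Gamma>. valid_path \<gamma> \<and> pathfinish \<gamma> = pathstart \<gamma> \<and> path_image \<gamma> \<subseteq> U - S) \<and>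
     (\<forall>z\<in>S. (\<Sum>\<gamma>\<leftarrow>\<Gamma>. winding_number \<gamma> z) = 1) \<and>
     (\<forall>z. z \<notin> U \<longrightarrow> (\<Sum>\<gamma>\<leftarrow>\<Gamma>. winding_number \<gamma> z) = 0)"

text \<open>
  \<open>holomorphic_calculus smul U H V A\<close> is the operator \<open>H(A)\<close> on \<open>V\<close>, for \<open>H\<close> holomorphic on the
  open set \<open>U\<close> containing the spectrum of \<open>A\<close> on \<open>V\<close>. By Cauchy's theorem it does not depend on
  the contour chosen.
\<close>

definition holomorphic_calculus ::
  "(complex \<Rightarrow> 'a::ab_group_add \<Rightarrow> 'a) \<Rightarrow> complex set \<Rightarrow> (complex \<Rightarrow> complex) \<Rightarrow>
    'a set \<Rightarrow> ('a \<Rightarrow> 'a) \<Rightarrow> 'a \<Rightarrow> 'a" where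
  "holomorphic_calculus smul U H V A x =
     (let \<Gamma> = (SOME \<Gamma>. encircling_contour U (spectrum_on smul V A) \<Gamma>)
      in smul (1 / (2 * of_real pi * \<i>))
           (\<Sum>\<gamma>\<leftarrow>\<Gamma>. curve_contour_integral smul \<gamma>
                       (\<lambda>z. smul (H z) (resolvent_on smul V A z x))))"

definition F_fun :: "complex \<Rightarrow> complex" where
  "F_fun z = 1/2 * (cosh (z/2) / sinh (z/2))"

definition f_fun :: "complex \<Rightarrow> complex" where
  "f_fun z = (if z = 0 then 0 else 1/2 * (cosh (z/2) / sinh (z/2)) - 1 / z)"

definition two_pi_i_Ints :: "complex set" where
  "two_pi_i_Ints = {2 * of_real pi * \<i> * of_int k | k. True}"

text \<open>
  \<open>dir_deriv smul R T \<kappa>\<close> is the operator \<open>(\<nabla>\<^sub>T R)(\<kappa>)\<close>, computed on each vector. The parameter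
  \<open>t\<close> is complex.
\<close>

definition dir_deriv ::
  "(complex \<Rightarrow> 'a::ab_group_add \<Rightarrow> 'a) \<Rightarrow> ('a \<Rightarrow> 'a \<Rightarrow> 'a) \<Rightarrow> 'a \<Rightarrow> 'a \<Rightarrow> 'a \<Rightarrow> 'a" where
  "dir_deriv smul R T \<kappa> x =
     (THE D. has_curve_derivative smul (\<lambda>t. R (\<kappa> + smul t T) x) D 0)"

definition indexed_basis ::
  "(complex \<Rightarrow> 'a::ab_group_add \<Rightarrow> 'a) \<Rightarrow> 'a set \<Rightarrow> nat \<Rightarrow> (nat \<Rightarrow> 'a) \<Rightarrow> bool" where
  "indexed_basis smul V d b \<longleftrightarrow>
     inj_on b {..<d} \<and> \<not> module.dependent smul (b ` {..<d}) \<and>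
     module.span smul (b ` {..<d}) = V"

definition dual_bases ::
  "(complex \<Rightarrow> 'a::ab_group_add \<Rightarrow> 'a) \<Rightarrow> ('a \<Rightarrow> 'a \<Rightarrow> complex) \<Rightarrow> 'a set \<Rightarrow>
    nat \<Rightarrow> (nat \<Rightarrow> 'a) \<Rightarrow> (nat \<Rightarrow> 'a) \<Rightarrow> bool" where
  "dual_bases smul form V d b b' \<longleftrightarrow>
     indexed_basis smul V d b \<and> indexed_basis smul V d b' \<and>
     (\<forall>i<d. \<forall>j<d. form (b i) (b' j) = (if i = j then 1 else 0))"

definition form_gradient ::
  "(complex \<Rightarrow> 'a::ab_group_add \<Rightarrow> 'a) \<Rightarrow> ('a \<Rightarrow> 'a \<Rightarrow> complex) \<Rightarrow> nat \<Rightarrow>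
    (nat \<Rightarrow> 'a) \<Rightarrow> (nat \<Rightarrow> 'a) \<Rightarrow> ('a \<Rightarrow> 'a \<Rightarrow> 'a) \<Rightarrow> 'a \<Rightarrow> 'a \<Rightarrow> 'a \<Rightarrow> 'a" where
  "form_gradient smul form d b b' R \<kappa> x y =
     (\<Sum>i<d. smul (form x (dir_deriv smul R (b i) \<kappa> y)) (b' i))"

end

theory Submission
  imports Defs "HOL-Computational_Algebra.Fundamental_Theorem_Algebra"
begin

text \<open>
  Write \<open>a = ad \<kappa>\<close>. On each graded piece \<open>R(\<kappa>) = P(a) Q(a)\<^sup>-\<^sup>1\<close> with entire functions \<open>P\<close>, \<open>Q\<close>,
  so that only power series of operators are needed once the contour integral has been evaluated
  on generalised eigenvectors.

  Since \<open>e\<^sup>a\<close> is an automorphism, its Cayley transform \<open>F(a)\<close> satisfies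
  \<open>[FX, FY] - F([X, FY] + [FX, Y]) = -[X, Y]/4\<close>; more generally \<open>a\<close> may be replaced by
  \<open>a + t\<close> on \<open>X\<close> and on \<open>Y\<close> and by \<open>a + 2t\<close> on the bracket. For small \<open>t \<noteq> 0\<close> the operator
  \<open>a + t\<close> is invertible on \<open>\<K>\<close>, and there \<open>F(a + t) = f(a + t) + (a + t)\<^sup>-\<^sup>1\<close>. Substituting this,
  the contributions of the inverses combine into expressions
  \<open>f(a + 2t)[T', X] - [T', f(a + t)X]\<close> with \<open>T = (a + t)T'\<close>. These are divided differences of
  the function in the direction \<open>ad T\<close>, they depend continuously on \<open>t\<close>, and at \<open>t = 0\<close> they are
  the derivatives \<open>(\<nabla>\<^sub>T R)X\<close>. The limit \<open>t \<rightarrow> 0\<close> gives the equation in all degrees at once, and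
  antisymmetry in the same way.
\<close>

section \<open>Vector series and weak limits in finite-dimensional subspaces\<close>

text \<open>On \<open>gr 0\<close> the operator \<open>ad \<kappa>\<close> always has a kernel: it
  contains \<open>\<kappa>\<close>, and for \<open>\<kappa> = 0\<close> it is everything. So the
  pole \<open>1/z\<close> cannot be split off at \<open>t = 0\<close>, and the shift is forced. The
  weights \<open>t\<close>, \<open>t\<close>, \<open>2t\<close> are those under which the derivation
  rule survives. Under the invariant form the two weights must instead be opposite, and this is
  where \<open>-t\<close> and \<open>-2t\<close> come from: paired with an element of
  \<open>gr 0\<close>, the inverse of \<open>a + 2t\<close> on the bracket moves to that element as
  minus the inverse of \<open>a - 2t\<close>, and this produces the gradient term. The type
  \<open>'a\<close> carries no topology, so limits are tested by linear functionals; inside one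
  graded piece this is ordinary convergence. Operators are functions that need to be linear on one
  finite-dimensional subspace only, because inverses are unspecified elsewhere. The contour integral
  is linear in the vector, so it is enough to evaluate it where the operator is a scalar plus a
  nilpotent; there both the integral and the quotient \<open>P/Q\<close> become the same finite
  Taylor sum.\<close>

definition entire :: "(nat \<Rightarrow> complex) \<Rightarrow> bool" where
  "entire c \<longleftrightarrow> (\<forall>r::real. summable (\<lambda>n. norm (c n) * r ^ n))"

locale complex_vector_space = vector_space smul
  for smul :: "complex \<Rightarrow> 'a::ab_group_add \<Rightarrow> 'a"
begin

lemma functionals_iff:
  "\<phi> \<in> functionals smul \<longleftrightarrow>
     (\<forall>x y. \<phi> (x + y) = \<phi> x + \<phi> y) \<and> (\<forall>c x. \<phi> (smul c x) = c * \<phi> x)"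
proof -
  have "vector_space ((*) :: complex \<Rightarrow> complex \<Rightarrow> complex)"
    by unfold_locales (auto simp: algebra_simps)
  then show ?thesis
    using vector_space_axioms unfolding functionals_def
    by (simp add: Vector_Spaces.linear_iff)
qed

abbreviation dual :: "('a \<Rightarrow> complex) set" where "dual \<equiv> functionals smul"

lemma functional_add: "\<phi> \<in> dual \<Longrightarrow> \<phi> (x + y) = \<phi> x + \<phi> y"
  and functional_smul: "\<phi> \<in> dual \<Longrightarrow> \<phi> (smul c x) = c * \<phi> x"
  by (auto simp: functionals_iff)

lemma functional_zero: "\<phi> \<in> dual \<Longrightarrow> \<phi> 0 = 0"
  using functional_add[of \<phi> 0 0] by simp

lemma functional_minus: "\<phi> \<in> dual \<Longrightarrow> \<phi> (- x) = - \<phi> x"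
  using functional_add[of \<phi> x "- x"] functional_zero[of \<phi>] by (simp add: add_eq_0_iff)

lemma functional_diff: "\<phi> \<in> dual \<Longrightarrow> \<phi> (x - y) = \<phi> x - \<phi> y"
  using functional_add[of \<phi> x "- y"] by (simp add: functional_minus)

lemma functional_sum: "\<phi> \<in> dual \<Longrightarrow> \<phi> (\<Sum>i\<in>I. g i) = (\<Sum>i\<in>I. \<phi> (g i))"
  by (induction I rule: infinite_finite_induct) (auto simp: functional_zero functional_add)

lemmas functional_simps =
  functional_add functional_smul functional_zero functional_minus functional_diff functional_sum

lemma functionals_comb:
  assumes "\<And>b. b \<in> I \<Longrightarrow> \<theta> b \<in> dual"
  shows "(\<lambda>x. \<Sum>b\<in>I. k b * \<theta> b x) \<in> dual"
  using assms unfolding functionals_iff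
  by (auto simp: sum.distrib algebra_simps sum_distrib_left intro!: sum.cong)

text \<open>Functionals are defined on all of \<open>'a\<close>, so the coordinates in a basis of a
  subspace become functionals only after the basis is extended to a Hamel basis of the whole
  space.\<close>

lemma representation_functional:
  assumes "independent B"
  shows "(\<lambda>v. representation (extend_basis B) v b) \<in> dual"
  unfolding functionals_iff
  using independent_extend_basis[OF assms] span_extend_basis[OF assms]
  by (simp add: representation_add representation_scale)

text \<open>The coordinates in a Hamel basis are functionals and determine the vector. This makes
  every object described through functionals unique: weak sums, limits, derivatives and
  integrals.\<close>

lemma functionals_separate:
  assumes "\<And>\<phi>. \<phi> \<in> dual \<Longrightarrow> \<phi> x = \<phi> y"
  shows "x = y"
proof -
  let ?E = "extend_basis {}"
  have ind: "independent ?E" "span ?E = UNIV"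
    using independent_extend_basis[of "{}"] span_extend_basis[of "{}"] independent_empty by auto
  have "representation ?E x b = representation ?E y b" for b
    using assms[OF representation_functional[of "{}" b]] independent_empty by simp
  then have eq: "representation ?E x = representation ?E y" by auto
  have "x = (\<Sum>b | representation ?E x b \<noteq> 0. smul (representation ?E x b) b)"
    using sum_nonzero_representation_eq[OF ind(1), of x] ind(2) by simp
  also have "\<dots> = y"
    unfolding eq using sum_nonzero_representation_eq[OF ind(1), of y] ind(2) by simp
  finally show ?thesis .
qed

definition weak_lim :: "('b \<Rightarrow> 'a) \<Rightarrow> 'a \<Rightarrow> 'b filter \<Rightarrow> bool" where
  "weak_lim g y F \<longleftrightarrow> (\<forall>\<phi>\<in>dual. ((\<lambda>t. \<phi> (g t)) \<longlongrightarrow> \<phi> y) F)"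

text \<open>The weak sum of the vectors \<open>smul (c n) (v n)\<close>. The description is
  meaningful only where such a vector exists, which \<open>psum_sums\<close> supplies for
  \<open>geometric\<close> sequences and \<open>entire\<close> coefficients.\<close>

definition psum :: "(nat \<Rightarrow> complex) \<Rightarrow> (nat \<Rightarrow> 'a) \<Rightarrow> 'a" where
  "psum c v = (THE y. \<forall>\<phi>\<in>dual. (\<lambda>n. c n * \<phi> (v n)) sums \<phi> y)"

lemma psum_eqI:
  assumes "\<And>\<phi>. \<phi> \<in> dual \<Longrightarrow> (\<lambda>n. c n * \<phi> (v n)) sums \<phi> y"
  shows "psum c v = y"
  unfolding psum_def
proof (rule the_equality)
  fix y' assume "\<forall>\<phi>\<in>dual. (\<lambda>n. c n * \<phi> (v n)) sums \<phi> y'"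
  then show "y' = y" using assms by (intro functionals_separate) (blast intro: sums_unique2)
qed (use assms in auto)

lemma weak_lim_unique:
  assumes "weak_lim g x F" "weak_lim g y F" "F \<noteq> bot"
  shows "x = y"
  using assms unfolding weak_lim_def by (intro functionals_separate) (blast intro: tendsto_unique)

lemma weak_lim_const: "weak_lim (\<lambda>t. x) x F"
  by (simp add: weak_lim_def)

lemma weak_lim_add: "weak_lim g x F \<Longrightarrow> weak_lim h y F \<Longrightarrow> weak_lim (\<lambda>t. g t + h t) (x + y) F"
  and weak_lim_diff: "weak_lim g x F \<Longrightarrow> weak_lim h y F \<Longrightarrow> weak_lim (\<lambda>t. g t - h t) (x - y) F"
  by (auto simp: weak_lim_def functional_simps intro!: tendsto_intros)

lemma weak_lim_smul: "weak_lim g x F \<Longrightarrow> (k \<longlongrightarrow> l) F \<Longrightarrow> weak_lim (\<lambda>t. smul (k t) (g t)) (smul l x) F"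
  by (auto simp: weak_lim_def functional_simps intro!: tendsto_intros)

lemma weak_lim_sum:
  "(\<And>i. i \<in> I \<Longrightarrow> weak_lim (g i) (x i) F) \<Longrightarrow> weak_lim (\<lambda>t. \<Sum>i\<in>I. g i t) (\<Sum>i\<in>I. x i) F"
  by (auto simp: weak_lim_def functional_simps intro!: tendsto_intros)

lemma weak_lim_cong:
  assumes "\<forall>\<^sub>F t in F. g t = h t"
  shows "weak_lim g x F \<longleftrightarrow> weak_lim h x F"
  unfolding weak_lim_def
  by (intro ball_cong refl tendsto_cong) (use assms in \<open>auto elim: eventually_mono\<close>)

definition pser :: "(nat \<Rightarrow> complex) \<Rightarrow> ('a \<Rightarrow> 'a) \<Rightarrow> 'a \<Rightarrow> 'a" where
  "pser c A x = psum c (\<lambda>n. (A ^^ n) x)"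

text \<open>
  If \<open>A1 C - C A2 = B\<close>, then \<open>P(A1) C - C P(A2) = dser c A1 B A2\<close> for the power series \<open>P\<close> with
  coefficients \<open>c\<close>, and likewise for quotients \<open>P/Q\<close> and \<open>dquo\<close>. The right-hand sides are continuous
  in \<open>A1\<close>, \<open>A2\<close> and make sense for every \<open>B\<close>, in particular at the derivative (\<open>A1 = A2\<close>).
\<close>

primrec dpow :: "('a \<Rightarrow> 'a) \<Rightarrow> ('a \<Rightarrow> 'a) \<Rightarrow> ('a \<Rightarrow> 'a) \<Rightarrow> nat \<Rightarrow> 'a \<Rightarrow> 'a" where
  "dpow A1 B A2 0 x = 0"
| "dpow A1 B A2 (Suc n) x = A1 (dpow A1 B A2 n x) + B ((A2 ^^ n) x)"

definition dser :: "(nat \<Rightarrow> complex) \<Rightarrow> ('a \<Rightarrow> 'a) \<Rightarrow> ('a \<Rightarrow> 'a) \<Rightarrow> ('a \<Rightarrow> 'a) \<Rightarrow> 'a \<Rightarrow> 'a" where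
  "dser c A1 B A2 x = psum c (\<lambda>n. dpow A1 B A2 n x)"

definition quo :: "(nat \<Rightarrow> complex) \<Rightarrow> (nat \<Rightarrow> complex) \<Rightarrow> 'a set \<Rightarrow> ('a \<Rightarrow> 'a) \<Rightarrow> 'a \<Rightarrow> 'a" where
  "quo c d V A x = pser c A (inv_into V (pser d A) x)"

definition dquo :: "(nat \<Rightarrow> complex) \<Rightarrow> (nat \<Rightarrow> complex) \<Rightarrow> 'a set \<Rightarrow>
    ('a \<Rightarrow> 'a) \<Rightarrow> ('a \<Rightarrow> 'a) \<Rightarrow> ('a \<Rightarrow> 'a) \<Rightarrow> 'a \<Rightarrow> 'a" where
  "dquo c d V A1 B A2 x = (let u = inv_into V (pser d A2) x in
     inv_into V (pser d A1) (dser c A1 B A2 (pser d A2 u) - dser d A1 B A2 (pser c A2 u)))"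

end

section \<open>Coordinates, norms and series in one finite-dimensional subspace\<close>

locale fd_space = complex_vector_space smul
  for smul :: "complex \<Rightarrow> 'a::ab_group_add \<Rightarrow> 'a" +
  fixes V :: "'a set"
  assumes finite_span: "\<exists>B. finite B \<and> span B = V"
begin

definition bas :: "'a set" where
  "bas = (SOME B. finite B \<and> independent B \<and> span B = V)"

lemma bas: "finite bas" "independent bas" "span bas = V"
proof -
  obtain B where B: "finite B" "span B = V" using finite_span by auto
  obtain B' where B': "B' \<subseteq> B" "independent B'" "B \<subseteq> span B'"
    using maximal_independent_subset[of B] by blast
  then have "span B' = span B"
    by (meson span_minimal span_mono subset_antisym subspace_span)
  with B' have "finite B' \<and> independent B' \<and> span B' = V"
    using B finite_subset by auto
  then have "finite bas \<and> independent bas \<and> span bas = V"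
    unfolding bas_def by (rule someI)
  then show "finite bas" "independent bas" "span bas = V" by auto
qed

lemma subspace_V: "subspace V"
  using finite_span subspace_span by blast

lemma V_zero [simp]: "0 \<in> V" and V_add [simp]: "x \<in> V \<Longrightarrow> y \<in> V \<Longrightarrow> x + y \<in> V"
  and V_smul [simp]: "x \<in> V \<Longrightarrow> smul c x \<in> V"
  and V_diff [simp]: "x \<in> V \<Longrightarrow> y \<in> V \<Longrightarrow> x - y \<in> V"
  and V_neg [simp]: "x \<in> V \<Longrightarrow> - x \<in> V"
  and V_sum [simp]: "(\<And>i. i \<in> I \<Longrightarrow> g i \<in> V) \<Longrightarrow> (\<Sum>i\<in>I. g i) \<in> V"
  using subspace_V
  by (auto intro: subspace_0 subspace_add subspace_scale subspace_diff subspace_neg subspace_sum)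

lemma bas_in [simp]: "b \<in> bas \<Longrightarrow> b \<in> V"
  using bas(3) span_base by blast

definition coord :: "'a \<Rightarrow> 'a \<Rightarrow> complex" where
  "coord b v = representation (extend_basis bas) v b"

lemma coord_functional: "coord b \<in> dual"
  using representation_functional[OF bas(2), of b] unfolding coord_def by simp

lemmas coord_simps = functional_simps[OF coord_functional]

lemma coord_expand:
  assumes "x \<in> V" shows "(\<Sum>b\<in>bas. smul (coord b x) b) = x"
proof -
  have "x \<in> span bas" using assms bas by simp
  then have "representation (extend_basis bas) x = representation bas x"
    using representation_extend[OF independent_extend_basis[OF bas(2)] _ extend_basis_superset[OF bas(2)]]
    by blast
  then show ?thesis
    unfolding coord_def using sum_representation_eq[OF bas(2) \<open>x \<in> span bas\<close> bas(1) order_refl] by simp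
qed

lemma functional_expand:
  assumes "\<phi> \<in> dual" "x \<in> V"
  shows "\<phi> x = (\<Sum>b\<in>bas. coord b x * \<phi> b)"
proof -
  have "\<phi> x = \<phi> (\<Sum>b\<in>bas. smul (coord b x) b)" by (simp add: coord_expand assms)
  then show ?thesis by (simp add: functional_simps[OF assms(1)])
qed

definition linform :: "('a \<Rightarrow> complex) \<Rightarrow> bool" where
  "linform \<theta> \<longleftrightarrow> (\<forall>x\<in>V. \<forall>y\<in>V. \<theta> (x + y) = \<theta> x + \<theta> y) \<and> (\<forall>c. \<forall>x\<in>V. \<theta> (smul c x) = c * \<theta> x)"

lemma linform_add: "linform \<theta> \<Longrightarrow> x \<in> V \<Longrightarrow> y \<in> V \<Longrightarrow> \<theta> (x + y) = \<theta> x + \<theta> y"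
  and linform_smul: "linform \<theta> \<Longrightarrow> x \<in> V \<Longrightarrow> \<theta> (smul c x) = c * \<theta> x"
  by (auto simp: linform_def)

lemma linform_zero: "linform \<theta> \<Longrightarrow> \<theta> 0 = 0"
  using linform_smul[of \<theta> 0 0] by simp

lemma linform_sum: "linform \<theta> \<Longrightarrow> (\<And>i. i \<in> I \<Longrightarrow> g i \<in> V) \<Longrightarrow> \<theta> (\<Sum>i\<in>I. g i) = (\<Sum>i\<in>I. \<theta> (g i))"
  by (induction I rule: infinite_finite_induct) (auto simp: linform_zero linform_add)

lemma linform_expand:
  assumes "linform \<theta>" "x \<in> V"
  shows "\<theta> x = (\<Sum>b\<in>bas. coord b x * \<theta> b)"
proof -
  have "\<theta> x = \<theta> (\<Sum>b\<in>bas. smul (coord b x) b)" by (simp add: coord_expand assms)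
  also have "\<dots> = (\<Sum>b\<in>bas. coord b x * \<theta> b)"
    using assms(1) by (subst linform_sum) (auto simp: linform_smul)
  finally show ?thesis .
qed

text \<open>If \<open>C\<close> is linear on \<open>V\<close> only, then composing a functional with
  \<open>C\<close> need not give a functional on \<open>'a\<close>; a combination of coordinates
  agrees with it on \<open>V\<close> and takes its place.\<close>

lemma linform_functional:
  assumes "linform \<theta>"
  obtains \<phi> where "\<phi> \<in> dual" "\<And>x. x \<in> V \<Longrightarrow> \<theta> x = \<phi> x"
proof
  show "(\<lambda>x. \<Sum>b\<in>bas. \<theta> b * coord b x) \<in> dual"
    by (rule functionals_comb) (rule coord_functional)
qed (simp add: linform_expand[OF assms] mult.commute)

text \<open>Linearity is asked on \<open>V\<close> alone because \<open>inv_into V Q\<close> is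
  unspecified outside \<open>V\<close>.\<close>

definition lin :: "('a \<Rightarrow> 'a) \<Rightarrow> bool" where
  "lin C \<longleftrightarrow> (\<forall>x\<in>V. \<forall>y\<in>V. C (x + y) = C x + C y) \<and> (\<forall>c. \<forall>x\<in>V. C (smul c x) = smul c (C x))"

definition endo :: "('a \<Rightarrow> 'a) \<Rightarrow> bool" where
  "endo A \<longleftrightarrow> lin A \<and> (\<forall>x\<in>V. A x \<in> V)"

lemma linform_comp: "lin C \<Longrightarrow> \<phi> \<in> dual \<Longrightarrow> linform (\<lambda>x. \<phi> (C x))"
  by (simp add: lin_def linform_def functional_simps)

lemma endo_in [simp]: "endo A \<Longrightarrow> x \<in> V \<Longrightarrow> A x \<in> V"
  by (simp add: endo_def)

lemma endo_add: "endo A \<Longrightarrow> x \<in> V \<Longrightarrow> y \<in> V \<Longrightarrow> A (x + y) = A x + A y"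
  and endo_smul: "endo A \<Longrightarrow> x \<in> V \<Longrightarrow> A (smul c x) = smul c (A x)"
  by (auto simp: endo_def lin_def)

lemma endo_zero: "endo A \<Longrightarrow> A 0 = 0"
  using endo_smul[of A 0 0] by simp

lemma endo_neg: "endo A \<Longrightarrow> x \<in> V \<Longrightarrow> A (- x) = - A x"
  using endo_add[of A x "-x"] by (simp add: endo_zero eq_neg_iff_add_eq_0 add.commute)

lemma endo_diff: "endo A \<Longrightarrow> x \<in> V \<Longrightarrow> y \<in> V \<Longrightarrow> A (x - y) = A x - A y"
  using endo_add[of A x "-y"] by (simp add: endo_neg)

lemma endo_sum: "endo A \<Longrightarrow> (\<And>i. i \<in> I \<Longrightarrow> g i \<in> V) \<Longrightarrow> A (\<Sum>i\<in>I. g i) = (\<Sum>i\<in>I. A (g i))"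
  by (induction I rule: infinite_finite_induct) (auto simp: endo_zero endo_add)

lemma endo_id: "endo (\<lambda>x. x)" and endo_const_smul: "endo (smul c)"
  by (auto simp: endo_def lin_def scale_right_distrib mult.commute)

lemma endo_comp: "endo A \<Longrightarrow> endo B \<Longrightarrow> endo (\<lambda>x. A (B x))"
  and endo_plus: "endo A \<Longrightarrow> endo B \<Longrightarrow> endo (\<lambda>x. A x + B x)"
  and endo_minus: "endo A \<Longrightarrow> endo B \<Longrightarrow> endo (\<lambda>x. A x - B x)"
  and endo_times: "endo A \<Longrightarrow> endo (\<lambda>x. smul c (A x))"
  by (auto simp: endo_def lin_def scale_right_distrib scale_right_diff_distrib mult.commute)

lemma endo_pow: "endo A \<Longrightarrow> endo (A ^^ n)"
  by (induction n) (auto simp: endo_id[unfolded id_def[symmetric]] endo_comp comp_def intro: endo_comp)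

lemma endo_expand: "endo A \<Longrightarrow> x \<in> V \<Longrightarrow> A x = (\<Sum>b\<in>bas. smul (coord b x) (A b))"
  using endo_sum[of A bas "\<lambda>b. smul (coord b x) b"] coord_expand[of x] by (simp add: endo_smul)

lemma functional_endo_expand:
  "endo A \<Longrightarrow> x \<in> V \<Longrightarrow> \<phi> \<in> dual \<Longrightarrow> \<phi> (A x) = (\<Sum>b\<in>bas. coord b x * \<phi> (A b))"
  by (simp add: endo_expand[of A x] functional_simps)

text \<open>The l1 norm of the coordinates: a norm on \<open>V\<close>, in general only a seminorm
  on \<open>'a\<close>.\<close>

definition cnorm :: "'a \<Rightarrow> real" where
  "cnorm x = (\<Sum>b\<in>bas. norm (coord b x))"

lemma cnorm_nonneg [simp]: "0 \<le> cnorm x"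
  by (simp add: cnorm_def sum_nonneg)

lemma cnorm_add: "cnorm (x + y) \<le> cnorm x + cnorm y"
  unfolding cnorm_def coord_simps sum.distrib[symmetric] by (intro sum_mono norm_triangle_ineq)

lemma cnorm_coord: "b \<in> bas \<Longrightarrow> norm (coord b x) \<le> cnorm x"
  unfolding cnorm_def using bas(1) by (intro member_le_sum) auto

lemma cnorm_eq_0: "x \<in> V \<Longrightarrow> cnorm x = 0 \<Longrightarrow> x = 0"
  using coord_expand[of x] bas(1) by (simp add: cnorm_def sum_nonneg_eq_0_iff)

lemma functional_bound:
  assumes "\<phi> \<in> dual" "x \<in> V"
  shows "norm (\<phi> x) \<le> (\<Sum>b\<in>bas. norm (\<phi> b)) * cnorm x"
proof -
  have "norm (\<phi> x) \<le> (\<Sum>b\<in>bas. norm (coord b x * \<phi> b))"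
    unfolding functional_expand[OF assms] by (rule norm_sum)
  also have "\<dots> \<le> (\<Sum>b\<in>bas. norm (\<phi> b) * cnorm x)"
    by (intro sum_mono) (simp add: norm_mult mult.commute mult_left_mono cnorm_coord)
  finally show ?thesis by (simp add: sum_distrib_right)
qed

lemma cnorm_endo:
  assumes "endo A" "x \<in> V"
  shows "cnorm (A x) \<le> (\<Sum>b\<in>bas. cnorm (A b)) * cnorm x"
proof -
  have "cnorm (A x) \<le> (\<Sum>b'\<in>bas. \<Sum>b\<in>bas. norm (coord b x * coord b' (A b)))"
    unfolding cnorm_def functional_endo_expand[OF assms coord_functional] by (intro sum_mono norm_sum)
  also have "\<dots> = (\<Sum>b\<in>bas. norm (coord b x) * cnorm (A b))"
    by (subst sum.swap) (simp add: cnorm_def norm_mult sum_distrib_left)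
  also have "\<dots> \<le> (\<Sum>b\<in>bas. cnorm x * cnorm (A b))"
    by (intro sum_mono mult_right_mono cnorm_coord) auto
  finally show ?thesis by (simp add: sum_distrib_left mult.commute)
qed

text \<open>No sign is imposed on \<open>K\<close> and \<open>\<rho>\<close>; this is harmless since
  \<open>entire\<close> gives summability for every real radius.\<close>

definition geometric :: "(nat \<Rightarrow> 'a) \<Rightarrow> bool" where
  "geometric v \<longleftrightarrow> (\<forall>n. v n \<in> V) \<and> (\<exists>K \<rho>. \<forall>n. cnorm (v n) \<le> K * \<rho> ^ n)"

lemma geometric_functional:
  assumes "geometric v" "\<phi> \<in> dual"
  obtains K \<rho> where "\<And>n. norm (\<phi> (v n)) \<le> K * \<rho> ^ n"
proof -
  obtain K \<rho> where K: "\<And>n. cnorm (v n) \<le> K * \<rho> ^ n" using assms(1) by (auto simp: geometric_def)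
  let ?C = "\<Sum>b\<in>bas. norm (\<phi> b)"
  have "norm (\<phi> (v n)) \<le> ?C * K * \<rho> ^ n" for n
  proof -
    have "norm (\<phi> (v n)) \<le> ?C * cnorm (v n)"
      using assms by (intro functional_bound) (auto simp: geometric_def)
    also have "\<dots> \<le> ?C * (K * \<rho> ^ n)"
      by (intro mult_left_mono K sum_nonneg) auto
    finally show ?thesis by (simp add: mult.assoc)
  qed
  then show ?thesis by (rule that)
qed

lemma geometric_summable:
  assumes "geometric v" "entire c" "\<phi> \<in> dual"
  shows "summable (\<lambda>n. norm (c n * \<phi> (v n)))"
proof -
  obtain K \<rho> where K: "\<And>n. norm (\<phi> (v n)) \<le> K * \<rho> ^ n"
    using geometric_functional[OF assms(1,3)] by metis
  have "summable (\<lambda>n. K * (norm (c n) * \<rho> ^ n))"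
    using assms(2) by (intro summable_mult) (simp add: entire_def)
  then show ?thesis
  proof (rule summable_comparison_test'[where N = 0])
    fix n
    have "norm (c n) * norm (\<phi> (v n)) \<le> norm (c n) * (K * \<rho> ^ n)"
      by (intro mult_left_mono K) auto
    then show "norm (norm (c n * \<phi> (v n))) \<le> K * (norm (c n) * \<rho> ^ n)"
      by (simp add: norm_mult algebra_simps)
  qed
qed

text \<open>The sum is built coordinate by coordinate. Every functional is then covered, because on
  \<open>V\<close> it is a finite combination of coordinates.\<close>

lemma
  assumes "geometric v" "entire c"
  shows psum_in: "psum c v \<in> V"
    and psum_sums: "\<phi> \<in> dual \<Longrightarrow> (\<lambda>n. c n * \<phi> (v n)) sums \<phi> (psum c v)"
proof -
  define y where "y = (\<Sum>b\<in>bas. smul (\<Sum>n. c n * coord b (v n)) b)"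
  have vV: "v n \<in> V" for n using assms(1) unfolding geometric_def by blast
  have sm: "(\<lambda>n. c n * \<phi> (v n)) sums \<phi> y" if \<phi>: "\<phi> \<in> dual" for \<phi>
  proof -
    have "(\<lambda>n. c n * coord b (v n)) sums (\<Sum>n. c n * coord b (v n))" for b
      using geometric_summable[OF assms coord_functional] by (rule summable_sums[OF summable_norm_cancel])
    then have "(\<lambda>n. \<Sum>b\<in>bas. c n * coord b (v n) * \<phi> b) sums (\<Sum>b\<in>bas. (\<Sum>n. c n * coord b (v n)) * \<phi> b)"
      by (intro sums_sum sums_mult2) auto
    moreover have "c n * \<phi> (v n) = (\<Sum>b\<in>bas. c n * coord b (v n) * \<phi> b)" for n
      by (simp add: functional_expand[OF \<phi> vV] sum_distrib_left mult.assoc)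
    ultimately show ?thesis by (simp add: y_def functional_simps[OF \<phi>])
  qed
  then have y: "psum c v = y" by (rule psum_eqI)
  then show "psum c v \<in> V" by (simp add: y_def)
  show "\<phi> \<in> dual \<Longrightarrow> (\<lambda>n. c n * \<phi> (v n)) sums \<phi> (psum c v)"
    using sm y by simp
qed

text \<open>Tannery's theorem, applied to each functional: a geometric bound that is uniform in
  \<open>t\<close> gives the summable majorant \<open>norm (c k) * \<rho> ^ k\<close> up to a
  constant.\<close>

lemma psum_tendsto:
  assumes v: "\<forall>\<^sub>F t in F. (\<forall>n. v t n \<in> V \<and> cnorm (v t n) \<le> K * \<rho> ^ n)"
    and w: "geometric w" and lim: "\<And>n. weak_lim (\<lambda>t. v t n) (w n) F"
    and c: "entire c"
  shows "weak_lim (\<lambda>t. psum c (v t)) (psum c w) F"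
proof (cases "F = bot")
  case False
  show ?thesis
    unfolding weak_lim_def
  proof
    fix \<phi> assume \<phi>: "\<phi> \<in> dual"
    let ?C = "\<Sum>b\<in>bas. norm (\<phi> b)"
    have "\<forall>\<^sub>F t in F. \<forall>k. norm (c k * \<phi> (v t k)) \<le> ?C * K * (norm (c k) * \<rho> ^ k)"
      using v
    proof eventually_elim
      case (elim t)
      show ?case
      proof
        fix k
        have "norm (\<phi> (v t k)) \<le> ?C * cnorm (v t k)"
          using elim \<phi> by (intro functional_bound) auto
        also have "\<dots> \<le> ?C * (K * \<rho> ^ k)"
          using elim by (intro mult_left_mono sum_nonneg) auto
        finally have "norm (c k) * norm (\<phi> (v t k)) \<le> norm (c k) * (?C * (K * \<rho> ^ k))"
          by (intro mult_left_mono) auto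
        then show "norm (c k * \<phi> (v t k)) \<le> ?C * K * (norm (c k) * \<rho> ^ k)"
          by (simp add: norm_mult algebra_simps)
      qed
    qed
    then have "\<forall>\<^sub>F (k, t) in at_top \<times>\<^sub>F F. norm (c k * \<phi> (v t k)) \<le> ?C * K * (norm (c k) * \<rho> ^ k)"
      unfolding eventually_prod_filter
      by (intro exI[of _ "\<lambda>_. True"] exI[of _ "\<lambda>t. \<forall>k. norm (c k * \<phi> (v t k)) \<le> ?C * K * (norm (c k) * \<rho> ^ k)"]) auto
    moreover have "summable (\<lambda>k. ?C * K * (norm (c k) * \<rho> ^ k))"
      using c by (intro summable_mult) (simp add: entire_def)
    moreover have "((\<lambda>t. c k * \<phi> (v t k)) \<longlongrightarrow> c k * \<phi> (w k)) F" for k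
      using lim[of k] \<phi> by (auto simp: weak_lim_def intro!: tendsto_intros)
    ultimately have "((\<lambda>t. \<Sum>k. c k * \<phi> (v t k)) \<longlongrightarrow> (\<Sum>k. c k * \<phi> (w k))) F"
      using tannerys_theorem[of "\<lambda>k t. c k * \<phi> (v t k)" "\<lambda>k. c k * \<phi> (w k)" F
        "\<lambda>k. ?C * K * (norm (c k) * \<rho> ^ k)"] False by simp
    moreover have "(\<Sum>k. c k * \<phi> (w k)) = \<phi> (psum c w)"
      using psum_sums[OF w c \<phi>] sums_unique by metis
    moreover have "\<forall>\<^sub>F t in F. (\<Sum>k. c k * \<phi> (v t k)) = \<phi> (psum c (v t))"
      using v
    proof eventually_elim
      case (elim t)
      then have "geometric (v t)" by (auto simp: geometric_def)
      from psum_sums[OF this c \<phi>] show ?case using sums_unique by metis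
    qed
    ultimately show "((\<lambda>t. \<phi> (psum c (v t))) \<longlongrightarrow> \<phi> (psum c w)) F"
      using Lim_transform_eventually by fastforce
  qed
qed (simp add: weak_lim_def)

end

section \<open>Limits of families of operators\<close>

context fd_space begin

lemma psum_endo:
  assumes "geometric v" "entire c" "endo C"
  shows "psum c (\<lambda>n. C (v n)) = C (psum c v)"
proof (rule psum_eqI)
  fix \<phi> assume \<phi>: "\<phi> \<in> dual"
  have "linform (\<lambda>x. \<phi> (C x))" using assms(3) \<phi> by (intro linform_comp) (auto simp: endo_def)
  then obtain \<theta> where \<theta>: "\<theta> \<in> dual" "\<And>x. x \<in> V \<Longrightarrow> \<phi> (C x) = \<theta> x"
    by (rule linform_functional) blast
  have "v n \<in> V" for n using assms(1) unfolding geometric_def by blast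
  then show "(\<lambda>n. c n * \<phi> (C (v n))) sums \<phi> (C (psum c v))"
    using psum_sums[OF assms(1,2) \<theta>(1)] psum_in[OF assms(1,2)] by (simp add: \<theta>(2))
qed

lemma psum_add:
  assumes "geometric v" "geometric w" "entire c"
  shows "psum c (\<lambda>n. v n + w n) = psum c v + psum c w"
proof (rule psum_eqI)
  fix \<phi> assume \<phi>: "\<phi> \<in> dual"
  show "(\<lambda>n. c n * \<phi> (v n + w n)) sums \<phi> (psum c v + psum c w)"
    using sums_add[OF psum_sums[OF assms(1,3) \<phi>] psum_sums[OF assms(2,3) \<phi>]]
    by (simp add: functional_simps[OF \<phi>] algebra_simps)
qed

lemma psum_diff:
  assumes "geometric v" "geometric w" "entire c"
  shows "psum c (\<lambda>n. v n - w n) = psum c v - psum c w"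
proof (rule psum_eqI)
  fix \<phi> assume \<phi>: "\<phi> \<in> dual"
  show "(\<lambda>n. c n * \<phi> (v n - w n)) sums \<phi> (psum c v - psum c w)"
    using sums_diff[OF psum_sums[OF assms(1,3) \<phi>] psum_sums[OF assms(2,3) \<phi>]]
    by (simp add: functional_simps[OF \<phi>] algebra_simps)
qed

lemma endo_psum:
  assumes "\<And>n. endo (C n)" "\<And>x. x \<in> V \<Longrightarrow> geometric (\<lambda>n. C n x)" "entire c"
  shows "endo (\<lambda>x. psum c (\<lambda>n. C n x))"
  unfolding endo_def lin_def
proof (intro conjI ballI allI)
  fix x y assume "x \<in> V" "y \<in> V"
  then show "psum c (\<lambda>n. C n (x + y)) = psum c (\<lambda>n. C n x) + psum c (\<lambda>n. C n y)"
    using psum_add[OF assms(2) assms(2) assms(3)] by (simp add: endo_add[OF assms(1)])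
next
  fix k x assume "x \<in> V"
  then show "psum c (\<lambda>n. C n (smul k x)) = smul k (psum c (\<lambda>n. C n x))"
    using psum_endo[OF assms(2) assms(3) endo_const_smul] by (simp add: endo_smul[OF assms(1)])
qed (use psum_in[OF assms(2) assms(3)] in auto)

section \<open>Bounds and identities for operator powers and their divided differences\<close>

lemma endo_dpow:
  assumes "endo A1" "endo B" "endo A2" shows "endo (dpow A1 B A2 n)"
proof (induction n)
  case 0
  show ?case by (simp add: endo_def lin_def)
next
  case (Suc n)
  have "endo (\<lambda>x. A1 (dpow A1 B A2 n x) + B ((A2 ^^ n) x))"
    by (rule endo_plus[OF endo_comp[OF assms(1) Suc] endo_comp[OF assms(2) endo_pow[OF assms(3)]]])
  then show ?case by (simp add: endo_def lin_def)
qed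

lemma pow_bound:
  assumes "endo A" "\<And>x. x \<in> V \<Longrightarrow> cnorm (A x) \<le> M * cnorm x" "0 \<le> M" "x \<in> V"
  shows "cnorm ((A ^^ n) x) \<le> cnorm x * M ^ n"
proof (induction n)
  case (Suc n)
  have "cnorm ((A ^^ Suc n) x) \<le> M * cnorm ((A ^^ n) x)"
    using assms endo_pow[of A n] by simp
  also have "\<dots> \<le> M * (cnorm x * M ^ n)"
    using Suc assms by (intro mult_left_mono) auto
  finally show ?case by (simp add: algebra_simps)
qed simp

text \<open>\<open>dpow\<close> of order \<open>n\<close> is a sum of \<open>n\<close> words of
  \<open>n\<close> letters, each letter bounded by \<open>M\<close>; the factor \<open>2 ^ n\<close>
  absorbs the number of words and keeps the bound geometric.\<close>

lemma dpow_bound: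
  assumes "endo A1" "endo B" "endo A2"
    and "\<And>x. x \<in> V \<Longrightarrow> cnorm (A1 x) \<le> M * cnorm x" "\<And>x. x \<in> V \<Longrightarrow> cnorm (B x) \<le> M * cnorm x"
    and "\<And>x. x \<in> V \<Longrightarrow> cnorm (A2 x) \<le> M * cnorm x" "0 \<le> M" "x \<in> V"
  shows "cnorm (dpow A1 B A2 n x) \<le> cnorm x * (2 * M) ^ n"
proof (induction n)
  case 0
  show ?case using cnorm_nonneg[of x] by (simp add: cnorm_def coord_simps)
next
  case (Suc n)
  have "cnorm (dpow A1 B A2 (Suc n) x) \<le> cnorm (A1 (dpow A1 B A2 n x)) + cnorm (B ((A2 ^^ n) x))"
    by (simp add: cnorm_add)
  also have "\<dots> \<le> M * cnorm (dpow A1 B A2 n x) + M * cnorm ((A2 ^^ n) x)"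
    using assms endo_dpow[of A1 B A2 n] endo_pow[of A2 n] by (intro add_mono) auto
  also have "\<dots> \<le> M * (cnorm x * (2 * M) ^ n) + M * (cnorm x * (2 * M) ^ n)"
  proof (intro add_mono mult_left_mono Suc)
    have "cnorm ((A2 ^^ n) x) \<le> cnorm x * M ^ n"
      using assms by (intro pow_bound) auto
    also have "\<dots> \<le> cnorm x * (2 * M) ^ n"
      using assms by (intro mult_left_mono power_mono) auto
    finally show "cnorm ((A2 ^^ n) x) \<le> cnorm x * (2 * M) ^ n" .
  qed (use assms in auto)
  finally show ?case by (simp add: algebra_simps)
qed

lemma endo_bound:
  assumes "endo A"
  obtains M where "0 \<le> M" "\<And>x. x \<in> V \<Longrightarrow> cnorm (A x) \<le> M * cnorm x"
  using cnorm_endo[OF assms] by (meson cnorm_nonneg sum_nonneg)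

lemma geometric_pow:
  assumes "endo A" "x \<in> V" shows "geometric (\<lambda>n. (A ^^ n) x)"
proof -
  obtain M where "0 \<le> M" "\<And>x. x \<in> V \<Longrightarrow> cnorm (A x) \<le> M * cnorm x"
    using endo_bound[OF assms(1)] by metis
  then have "cnorm ((A ^^ n) x) \<le> cnorm x * M ^ n" for n
    using assms by (intro pow_bound) auto
  then show ?thesis
    using assms endo_pow[of A] unfolding geometric_def by auto
qed

lemma geometric_dpow:
  assumes "endo A1" "endo B" "endo A2" "x \<in> V" shows "geometric (\<lambda>n. dpow A1 B A2 n x)"
proof -
  obtain M1 M2 M3 where M: "0 \<le> M1" "\<And>x. x \<in> V \<Longrightarrow> cnorm (A1 x) \<le> M1 * cnorm x"
      "0 \<le> M2" "\<And>x. x \<in> V \<Longrightarrow> cnorm (B x) \<le> M2 * cnorm x"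
      "0 \<le> M3" "\<And>x. x \<in> V \<Longrightarrow> cnorm (A2 x) \<le> M3 * cnorm x"
    using endo_bound assms(1-3) by metis
  let ?M = "M1 + M2 + M3"
  have le: "a * cnorm x \<le> ?M * cnorm x" if "a \<le> ?M" for a x
    using that by (intro mult_right_mono) auto
  have b: "cnorm (A1 y) \<le> ?M * cnorm y" "cnorm (B y) \<le> ?M * cnorm y" "cnorm (A2 y) \<le> ?M * cnorm y"
    if "y \<in> V" for y
    using order.trans[OF M(2)[OF that] le] order.trans[OF M(4)[OF that] le]
      order.trans[OF M(6)[OF that] le] M(1,3,5) by auto
  have "cnorm (dpow A1 B A2 n x) \<le> cnorm x * (2 * ?M) ^ n" for n
    by (rule dpow_bound[OF assms(1-3) b _ assms(4)]) (use M(1,3,5) in auto)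
  then show ?thesis
    using assms endo_dpow[of A1 B A2] unfolding geometric_def by auto
qed

lemma endo_pser: "endo A \<Longrightarrow> entire c \<Longrightarrow> endo (pser c A)"
  unfolding pser_def[abs_def] by (rule endo_psum[OF endo_pow geometric_pow])

lemma endo_dser: "endo A1 \<Longrightarrow> endo B \<Longrightarrow> endo A2 \<Longrightarrow> entire c \<Longrightarrow> endo (dser c A1 B A2)"
  unfolding dser_def[abs_def] by (rule endo_psum[OF endo_dpow geometric_dpow])

lemma pser_sums:
  "endo A \<Longrightarrow> entire c \<Longrightarrow> x \<in> V \<Longrightarrow> \<phi> \<in> dual \<Longrightarrow>
    (\<lambda>n. c n * \<phi> ((A ^^ n) x)) sums \<phi> (pser c A x)"
  unfolding pser_def by (intro psum_sums geometric_pow)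

text \<open>Telescoping: \<open>A1^(n+1) C - C A2^(n+1) = A1 (A1^n C - C A2^n) + (A1 C - C A2)
  A2^n\<close>.\<close>

lemma dpow_eq:
  assumes "endo A1" "endo A2" "endo C" "\<And>x. x \<in> V \<Longrightarrow> A1 (C x) - C (A2 x) = B x" "x \<in> V"
  shows "dpow A1 B A2 n x = (A1 ^^ n) (C x) - C ((A2 ^^ n) x)"
proof (induction n)
  case (Suc n)
  have *: "(A2 ^^ n) x \<in> V" "(A1 ^^ n) (C x) \<in> V" using assms endo_pow by auto
  have B: "B ((A2 ^^ n) x) = A1 (C ((A2 ^^ n) x)) - C (A2 ((A2 ^^ n) x))"
    using assms(4)[OF *(1)] by simp
  show ?case using * assms(1,3) by (simp add: Suc endo_diff B)
qed simp

lemma dser_eq: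
  assumes "endo A1" "endo A2" "endo C" "\<And>x. x \<in> V \<Longrightarrow> A1 (C x) - C (A2 x) = B x" "x \<in> V"
    and c: "entire c"
  shows "dser c A1 B A2 x = pser c A1 (C x) - C (pser c A2 x)"
proof -
  have g1: "geometric (\<lambda>n. (A2 ^^ n) x)" "geometric (\<lambda>n. (A1 ^^ n) (C x))"
    using assms by (auto intro: geometric_pow)
  have "geometric (\<lambda>n. C ((A2 ^^ n) x))"
  proof -
    obtain M K \<rho> where M: "0 \<le> M" "\<And>x. x \<in> V \<Longrightarrow> cnorm (C x) \<le> M * cnorm x"
      and K: "\<And>n. cnorm ((A2 ^^ n) x) \<le> K * \<rho> ^ n" "\<And>n. (A2 ^^ n) x \<in> V"
      using endo_bound[OF assms(3)] g1(1) unfolding geometric_def by metis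
    have "cnorm (C ((A2 ^^ n) x)) \<le> (M * K) * \<rho> ^ n" for n
    proof -
      have "cnorm (C ((A2 ^^ n) x)) \<le> M * cnorm ((A2 ^^ n) x)" by (rule M(2)[OF K(2)])
      also have "\<dots> \<le> M * (K * \<rho> ^ n)" by (rule mult_left_mono[OF K(1) M(1)])
      finally show ?thesis by (simp add: mult.assoc)
    qed
    then show ?thesis using K(2) assms(3) unfolding geometric_def by auto
  qed
  then have "psum c (\<lambda>n. (A1 ^^ n) (C x) - C ((A2 ^^ n) x)) = pser c A1 (C x) - C (pser c A2 x)"
    using g1 psum_endo[OF g1(1) c assms(3)] by (simp add: pser_def psum_diff c)
  then show ?thesis using dpow_eq[OF assms(1-5)] by (simp add: dser_def)
qed

text \<open>The case \<open>B = 0\<close> of \<open>dser_eq\<close>: an intertwiner of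
  \<open>A1\<close> and \<open>A2\<close> intertwines their power series.\<close>

lemma pser_commute:
  assumes "endo A1" "endo A2" "endo C" "\<And>x. x \<in> V \<Longrightarrow> A1 (C x) = C (A2 x)" "x \<in> V" "entire c"
  shows "pser c A1 (C x) = C (pser c A2 x)"
proof -
  have "dpow A1 (\<lambda>x. 0) A2 n x = 0" for n
    by (induction n) (auto simp: endo_zero assms)
  then have "dser c A1 (\<lambda>x. 0) A2 x = 0"
    unfolding dser_def by (intro psum_eqI) (simp add: functional_zero)
  then show ?thesis using dser_eq[of A1 A2 C "\<lambda>x. 0" x c] assms by simp
qed

lemma pser_pser_commute:
  assumes "endo A" "entire c" "entire d" "x \<in> V"
  shows "pser c A (pser d A x) = pser d A (pser c A x)"
proof (rule pser_commute)
  fix y assume "y \<in> V"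
  show "A (pser d A y) = pser d A (A y)"
    by (rule pser_commute[symmetric]) (use assms \<open>y \<in> V\<close> in auto)
qed (use assms endo_pser in auto)

text \<open>Dimension count: the image of a basis is independent and has as many elements as the
  basis, so it spans \<open>V\<close>.\<close>

lemma inj_bij:
  assumes A: "endo A" and inj: "\<And>x. x \<in> V \<Longrightarrow> A x = 0 \<Longrightarrow> x = 0"
  shows "bij_betw A V V"
proof -
  interpret vv: vector_space_pair smul smul by unfold_locales
  \<comment> \<open>\<open>A'\<close> is linear on all of \<open>'a\<close> and agrees with
    \<open>A\<close> on \<open>V\<close>, so that the library facts on linear maps apply to
    it.\<close>
  define A' where "A' x = (\<Sum>b\<in>bas. smul (coord b x) (A b))" for x
  have eq: "A' x = A x" if "x \<in> V" for x using that A by (simp add: A'_def endo_expand)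
  have lin: "Vector_Spaces.linear smul smul A'"
    unfolding Vector_Spaces.linear_iff using vector_space_axioms
    by (auto simp: A'_def coord_simps scale_left_distrib sum.distrib scale_sum_right)
  have injA: "inj_on A V"
  proof (rule inj_onI)
    fix x y assume "x \<in> V" "y \<in> V" "A x = A y"
    then have "x - y \<in> V" "A (x - y) = 0" using A by (auto simp: endo_diff)
    then show "x = y" using inj[of "x - y"] by simp
  qed
  then have injA': "inj_on A' V" using eq inj_on_cong[of V A' A] by blast
  have sp: "span (A' ` bas) = A' ` V"
    using vv.linear_span_image[OF lin, of bas] bas(3) by simp
  have ind: "independent (A' ` bas)"
    using vv.linear_independent_injective_image[OF lin bas(2)] bas(3) injA' by simp
  have "V \<subseteq> A' ` V"
  proof (rule ccontr)
    assume "\<not> V \<subseteq> A' ` V"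
    then obtain y where y: "y \<in> V" "y \<notin> span (A' ` bas)" using sp by auto
    have "independent (insert y (A' ` bas))"
      by (rule independent_insertI[OF y(2) ind])
    moreover have "A' b \<in> V" if "b \<in> bas" for b
      using endo_in[OF A bas_in[OF that]] eq[OF bas_in[OF that]] by metis
    then have "insert y (A' ` bas) \<subseteq> span bas"
      using y(1) unfolding bas(3) by blast
    ultimately have "card (insert y (A' ` bas)) \<le> card bas"
      by (rule independent_span_bound[OF bas(1), THEN conjunct2])
    moreover have "card (A' ` bas) = card bas"
      by (intro card_image inj_on_subset[OF injA'] subsetI bas_in)
    moreover have "y \<notin> A' ` bas" using y(2) span_base by blast
    ultimately show False using bas(1) by simp
  qed
  then have "V \<subseteq> A ` V" using eq by (metis image_cong)
  then have "A ` V = V" using endo_in[OF A] by blast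
  then show ?thesis using injA by (simp add: bij_betw_def)
qed

lemma
  assumes "endo Q" "bij_betw Q V V"
  shows endo_inv: "endo (inv_into V Q)"
    and inv_left: "x \<in> V \<Longrightarrow> inv_into V Q (Q x) = x"
    and inv_right: "x \<in> V \<Longrightarrow> Q (inv_into V Q x) = x"
    and inv_in: "x \<in> V \<Longrightarrow> inv_into V Q x \<in> V"
proof -
  show l: "inv_into V Q (Q x) = x" if "x \<in> V" for x
    using assms that by (simp add: bij_betw_inv_into_left)
  show r: "Q (inv_into V Q x) = x" if "x \<in> V" for x
    using assms that by (simp add: bij_betw_inv_into_right)
  show i: "inv_into V Q x \<in> V" if "x \<in> V" for x
    using assms that by (metis bij_betw_def inv_into_into)
  show "endo (inv_into V Q)"
    unfolding endo_def lin_def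
  proof (intro conjI ballI allI i)
    fix x y assume xy: "x \<in> V" "y \<in> V"
    show "inv_into V Q (x + y) = inv_into V Q x + inv_into V Q y"
      using l[of "inv_into V Q x + inv_into V Q y"] xy assms by (simp add: endo_add i r)
  next
    fix k x assume x: "x \<in> V"
    show "inv_into V Q (smul k x) = smul k (inv_into V Q x)"
      using l[of "smul k (inv_into V Q x)"] x assms by (simp add: endo_smul i r)
  qed
qed

text \<open>Pointwise convergence is enough in finite dimension: it gives uniform bounds
  (\<open>oplim_bound\<close>) and joint continuity (\<open>oplim_app\<close>). Linearity is asked
  only eventually, since inverses exist only close to the limit.\<close>

definition oplim :: "('b \<Rightarrow> 'a \<Rightarrow> 'a) \<Rightarrow> ('a \<Rightarrow> 'a) \<Rightarrow> 'b filter \<Rightarrow> bool" where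
  "oplim At A F \<longleftrightarrow> (\<forall>\<^sub>F t in F. endo (At t)) \<and> endo A \<and> (\<forall>x\<in>V. weak_lim (\<lambda>t. At t x) (A x) F)"

lemma oplD:
  assumes "oplim At A F"
  shows "\<forall>\<^sub>F t in F. endo (At t)" "endo A" "x \<in> V \<Longrightarrow> weak_lim (\<lambda>t. At t x) (A x) F"
  using assms by (auto simp: oplim_def)

lemma oplim_const: "endo A \<Longrightarrow> oplim (\<lambda>t. A) A F"
  by (simp add: oplim_def weak_lim_const)

lemma weak_lim_cnorm: "weak_lim g y F \<Longrightarrow> ((\<lambda>t. cnorm (g t)) \<longlongrightarrow> cnorm y) F"
  unfolding cnorm_def weak_lim_def using coord_functional by (auto intro!: tendsto_intros)

lemma oplim_bound:
  assumes "oplim At A F"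
  obtains M where "0 \<le> M" "\<forall>\<^sub>F t in F. \<forall>x\<in>V. cnorm (At t x) \<le> M * cnorm x"
    "\<And>x. x \<in> V \<Longrightarrow> cnorm (A x) \<le> M * cnorm x"
proof -
  \<comment> \<open>On each of the finitely many basis vectors the norm eventually exceeds that of
    the limit by less than 1; this is the summand \<open>1\<close>.\<close>
  let ?M = "\<Sum>b\<in>bas. cnorm (A b) + 1"
  have "\<forall>\<^sub>F t in F. \<forall>b\<in>bas. cnorm (At t b) < cnorm (A b) + 1"
  proof (intro eventually_ball_finite bas ballI)
    fix b assume "b \<in> bas"
    then have "((\<lambda>t. cnorm (At t b)) \<longlongrightarrow> cnorm (A b)) F"
      using assms by (intro weak_lim_cnorm oplD) auto
    then show "\<forall>\<^sub>F t in F. cnorm (At t b) < cnorm (A b) + 1"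
      by (rule order_tendstoD) simp
  qed
  then have "\<forall>\<^sub>F t in F. \<forall>x\<in>V. cnorm (At t x) \<le> ?M * cnorm x"
    using oplD(1)[OF assms]
  proof eventually_elim
    case (elim t)
    show ?case
    proof
      fix x assume "x \<in> V"
      then have "cnorm (At t x) \<le> (\<Sum>b\<in>bas. cnorm (At t b)) * cnorm x"
        using elim by (intro cnorm_endo) auto
      also have "\<dots> \<le> ?M * cnorm x"
        using elim by (intro mult_right_mono sum_mono) (auto intro: less_imp_le)
      finally show "cnorm (At t x) \<le> ?M * cnorm x" .
    qed
  qed
  moreover have "cnorm (A x) \<le> ?M * cnorm x" if "x \<in> V" for x
  proof -
    have "cnorm (A x) \<le> (\<Sum>b\<in>bas. cnorm (A b)) * cnorm x"
      using assms that by (intro cnorm_endo oplD)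
    also have "\<dots> \<le> ?M * cnorm x"
      by (intro mult_right_mono sum_mono) auto
    finally show ?thesis .
  qed
  moreover have "0 \<le> ?M" by (intro sum_nonneg) (simp add: add_nonneg_nonneg)
  ultimately show ?thesis using that by blast
qed

text \<open>In the basis both factors converge separately: the coordinates of \<open>g t\<close> and
  the images \<open>At t b\<close> of the finitely many basis vectors.\<close>

lemma oplim_app:
  assumes "oplim At A F" "weak_lim g x F" "\<forall>\<^sub>F t in F. g t \<in> V" "x \<in> V"
  shows "weak_lim (\<lambda>t. At t (g t)) (A x) F"
  unfolding weak_lim_def
proof
  fix \<phi> assume \<phi>: "\<phi> \<in> dual"
  have "((\<lambda>t. \<Sum>b\<in>bas. coord b (g t) * \<phi> (At t b)) \<longlongrightarrow> (\<Sum>b\<in>bas. coord b x * \<phi> (A b))) F"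
    using assms(2) oplD(3)[OF assms(1) bas_in] coord_functional \<phi>
    by (auto simp: weak_lim_def intro!: tendsto_intros)
  moreover have "(\<Sum>b\<in>bas. coord b x * \<phi> (A b)) = \<phi> (A x)"
    using functional_endo_expand[OF oplD(2)[OF assms(1)] assms(4) \<phi>] by simp
  moreover have "\<forall>\<^sub>F t in F. (\<Sum>b\<in>bas. coord b (g t) * \<phi> (At t b)) = \<phi> (At t (g t))"
    using oplD(1)[OF assms(1)] assms(3)
    by eventually_elim (simp add: functional_endo_expand[OF _ _ \<phi>])
  ultimately show "((\<lambda>t. \<phi> (At t (g t))) \<longlongrightarrow> \<phi> (A x)) F"
    using Lim_transform_eventually by fastforce
qed

lemma oplim_comp:
  assumes "oplim At A F" "oplim Bt B F"
  shows "oplim (\<lambda>t x. At t (Bt t x)) (\<lambda>x. A (B x)) F"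
  unfolding oplim_def
proof (intro conjI ballI)
  show "\<forall>\<^sub>F t in F. endo (\<lambda>x. At t (Bt t x))"
    using oplD(1)[OF assms(1)] oplD(1)[OF assms(2)] 
  proof eventually_elim
    case (elim t)
    then show ?case by (rule endo_comp[of "At t" "Bt t"])
  qed
  show "endo (\<lambda>x. A (B x))"
    by (rule endo_comp[of A B, OF oplD(2)[OF assms(1)] oplD(2)[OF assms(2)]])
  fix x assume "x \<in> V"
  moreover have "\<forall>\<^sub>F t in F. Bt t x \<in> V"
    using oplD(1)[OF assms(2)] \<open>x \<in> V\<close> by (auto elim: eventually_mono)
  ultimately show "weak_lim (\<lambda>t. At t (Bt t x)) (A (B x)) F"
    using oplim_app[OF assms(1) oplD(3)[OF assms(2)]] oplD(2)[OF assms(2)] by simp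
qed

lemma oplim_plus:
  assumes "oplim At A F" "oplim Bt B F"
  shows "oplim (\<lambda>t x. At t x + Bt t x) (\<lambda>x. A x + B x) F"
  unfolding oplim_def
proof (intro conjI ballI)
  show "\<forall>\<^sub>F t in F. endo (\<lambda>x. At t x + Bt t x)"
    using oplD(1)[OF assms(1)] oplD(1)[OF assms(2)]
  proof eventually_elim
    case (elim t)
    then show ?case by (rule endo_plus[of "At t" "Bt t"])
  qed
  show "endo (\<lambda>x. A x + B x)"
    by (rule endo_plus[of A B, OF oplD(2)[OF assms(1)] oplD(2)[OF assms(2)]])
  fix x assume "x \<in> V"
  then show "weak_lim (\<lambda>t. At t x + Bt t x) (A x + B x) F"
    using oplD(3)[OF assms(1)] oplD(3)[OF assms(2)] by (intro weak_lim_add) auto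
qed

lemma oplim_smul:
  assumes "oplim At A F" "(k \<longlongrightarrow> l) F"
  shows "oplim (\<lambda>t x. smul (k t) (At t x)) (\<lambda>x. smul l (A x)) F"
  unfolding oplim_def
proof (intro conjI ballI)
  show "\<forall>\<^sub>F t in F. endo (\<lambda>x. smul (k t) (At t x))"
    using oplD(1)[OF assms(1)]
  proof eventually_elim
    case (elim t)
    then show ?case by (rule endo_times[of "At t"])
  qed
  show "endo (\<lambda>x. smul l (A x))"
    by (rule endo_times[of A, OF oplD(2)[OF assms(1)]])
  fix x assume "x \<in> V"
  then show "weak_lim (\<lambda>t. smul (k t) (At t x)) (smul l (A x)) F"
    using oplD(3)[OF assms(1)] assms(2) by (intro weak_lim_smul) auto
qed

lemma oplim_minus:
  assumes "oplim At A F" "oplim Bt B F"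
  shows "oplim (\<lambda>t x. At t x - Bt t x) (\<lambda>x. A x - B x) F"
  using oplim_plus[OF assms(1) oplim_smul[OF assms(2) tendsto_const[of "- 1"]]] by simp

lemma oplim_pow: "oplim At A F \<Longrightarrow> oplim (\<lambda>t. At t ^^ n) (A ^^ n) F"
proof (induction n)
  case (Suc n)
  then have "oplim (\<lambda>t x. At t ((At t ^^ n) x)) (\<lambda>x. A ((A ^^ n) x)) F"
    by (intro oplim_comp[of At A F "\<lambda>t. At t ^^ n" "A ^^ n"])
  then show ?case by (simp add: comp_def)
next
  case 0
  show ?case using oplim_const[OF endo_id] by (simp add: id_def)
qed

lemma oplim_pser:
  assumes "oplim At A F" "entire c"
  shows "oplim (\<lambda>t. pser c (At t)) (pser c A) F"
  unfolding oplim_def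
proof (intro conjI ballI)
  show "\<forall>\<^sub>F t in F. endo (pser c (At t))"
    using oplD(1)[OF assms(1)] by eventually_elim (simp add: endo_pser assms)
  show "endo (pser c A)" using assms by (intro endo_pser oplD)
  fix x assume x: "x \<in> V"
  obtain M where M: "0 \<le> M" "\<forall>\<^sub>F t in F. \<forall>x\<in>V. cnorm (At t x) \<le> M * cnorm x"
    by (rule oplim_bound[OF assms(1)])
  have "\<forall>\<^sub>F t in F. \<forall>n. (At t ^^ n) x \<in> V \<and> cnorm ((At t ^^ n) x) \<le> cnorm x * M ^ n"
    using M(2) oplD(1)[OF assms(1)]
  proof eventually_elim
    case (elim t)
    show ?case
      using pow_bound[OF elim(2) bspec[OF elim(1)] M(1) x] endo_in[OF endo_pow[OF elim(2)] x] by blast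
  qed
  then show "weak_lim (\<lambda>t. pser c (At t) x) (pser c A x) F"
    unfolding pser_def
    by (rule psum_tendsto[OF _ geometric_pow[OF oplD(2)[OF assms(1)] x] oplD(3)[OF oplim_pow[OF assms(1)] x] assms(2)])
qed

lemma oplim_dpow:
  assumes "oplim A1 A1' F" "oplim B B' F" "oplim A2 A2' F"
  shows "oplim (\<lambda>t. dpow (A1 t) (B t) (A2 t) n) (dpow A1' B' A2' n) F"
proof (induction n)
  case 0
  show ?case by (simp add: oplim_def endo_def lin_def weak_lim_const)
next
  case (Suc n)
  have "oplim (\<lambda>t x. A1 t (dpow (A1 t) (B t) (A2 t) n x) + B t ((A2 t ^^ n) x))
      (\<lambda>x. A1' (dpow A1' B' A2' n x) + B' ((A2' ^^ n) x)) F"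
    by (rule oplim_plus[OF oplim_comp[OF assms(1) Suc] oplim_comp[OF assms(2) oplim_pow[OF assms(3)]]])
  then show ?case unfolding dpow.simps[abs_def] .
qed

lemma oplim_dser:
  assumes "oplim A1 A1' F" "oplim B B' F" "oplim A2 A2' F" "entire c"
  shows "oplim (\<lambda>t. dser c (A1 t) (B t) (A2 t)) (dser c A1' B' A2') F"
  unfolding oplim_def
proof (intro conjI ballI)
  show "\<forall>\<^sub>F t in F. endo (dser c (A1 t) (B t) (A2 t))"
    using oplD(1)[OF assms(1)] oplD(1)[OF assms(2)] oplD(1)[OF assms(3)]
    by eventually_elim (simp add: endo_dser assms)
  show "endo (dser c A1' B' A2')" using assms by (intro endo_dser oplD)
  fix x assume x: "x \<in> V"
  obtain M1 where M1: "0 \<le> M1" "\<forall>\<^sub>F t in F. \<forall>x\<in>V. cnorm (A1 t x) \<le> M1 * cnorm x"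
    by (rule oplim_bound[OF assms(1)])
  obtain M2 where M2: "0 \<le> M2" "\<forall>\<^sub>F t in F. \<forall>x\<in>V. cnorm (B t x) \<le> M2 * cnorm x"
    by (rule oplim_bound[OF assms(2)])
  obtain M3 where M3: "0 \<le> M3" "\<forall>\<^sub>F t in F. \<forall>x\<in>V. cnorm (A2 t x) \<le> M3 * cnorm x"
    by (rule oplim_bound[OF assms(3)])
  note M = M1 M2 M3
  let ?M = "M1 + M2 + M3"
  have le: "a * cnorm x \<le> ?M * cnorm x" if "a \<le> ?M" for a x
    using that by (intro mult_right_mono) auto
  have "\<forall>\<^sub>F t in F. \<forall>n. dpow (A1 t) (B t) (A2 t) n x \<in> V \<and>
      cnorm (dpow (A1 t) (B t) (A2 t) n x) \<le> cnorm x * (2 * ?M) ^ n"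
    using M(2,4,6) oplD(1)[OF assms(1)] oplD(1)[OF assms(2)] oplD(1)[OF assms(3)]
  proof eventually_elim
    case (elim t)
    have b: "cnorm (A1 t y) \<le> ?M * cnorm y" "cnorm (B t y) \<le> ?M * cnorm y" "cnorm (A2 t y) \<le> ?M * cnorm y"
      if "y \<in> V" for y
      using order.trans[OF bspec[OF elim(1) that] le] order.trans[OF bspec[OF elim(2) that] le]
        order.trans[OF bspec[OF elim(3) that] le] M(1,3,5) by auto
    have "cnorm (dpow (A1 t) (B t) (A2 t) n x) \<le> cnorm x * (2 * ?M) ^ n" for n
      by (rule dpow_bound[OF elim(4-6) b _ x]) (use M(1,3,5) in auto)
    then show ?case using elim x endo_dpow by auto
  qed
  then show "weak_lim (\<lambda>t. dser c (A1 t) (B t) (A2 t) x) (dser c A1' B' A2' x) F"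
    unfolding dser_def
    by (rule psum_tendsto[OF _ geometric_dpow[OF assms(1-3)[THEN oplD(2)] x]
          oplD(3)[OF oplim_dpow[OF assms(1-3)] x] assms(4)])
qed

text \<open>With \<open>C\<close> the inverse of \<open>Q\<close> and \<open>E = C (Q - Qt)\<close>,
  the operator \<open>C Qt = 1 - E\<close> is bounded below by 1/2 once \<open>E\<close> is small.
  So \<open>Qt\<close> is injective, hence bijective, and its inverses stay bounded.\<close>

lemma oplim_inv:
  assumes Qt: "oplim Qt Q F" and bij: "bij_betw Q V V"
  shows "\<forall>\<^sub>F t in F. bij_betw (Qt t) V V" "oplim (\<lambda>t. inv_into V (Qt t)) (inv_into V Q) F"
proof -
  have Q: "endo Q" using Qt by (rule oplD)
  let ?C = "inv_into V Q"
  have C: "endo ?C" using endo_inv[OF Q bij] .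
  define E where "E t x = ?C (Q x - Qt t x)" for t x
  have "oplim E (\<lambda>x. ?C (Q x - Q x)) F"
    unfolding E_def[abs_def] by (rule oplim_comp[OF oplim_const[OF C] oplim_minus[OF oplim_const[OF Q] Qt]])
  then have E: "oplim E (\<lambda>x. 0) F" by (simp add: endo_zero[OF C])
  have "((\<lambda>t. cnorm (E t b)) \<longlongrightarrow> cnorm 0) F" if "b \<in> bas" for b
    using that E by (intro weak_lim_cnorm oplD(3)) auto
  then have "((\<lambda>t. \<Sum>b\<in>bas. cnorm (E t b)) \<longlongrightarrow> (\<Sum>b\<in>bas. cnorm 0)) F"
    by (rule tendsto_sum)
  moreover have "(\<Sum>b\<in>bas. cnorm 0) < 1/2" by (simp add: cnorm_def coord_simps)
  ultimately have small: "\<forall>\<^sub>F t in F. (\<Sum>b\<in>bas. cnorm (E t b)) < 1/2"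
    by (rule order_tendstoD)
  have main: "\<forall>\<^sub>F t in F. endo (Qt t) \<and> endo (E t) \<and> (\<forall>x\<in>V. cnorm x \<le> 2 * cnorm (?C (Qt t x)))"
    using small oplD(1)[OF E] oplD(1)[OF Qt]
  proof eventually_elim
    case (elim t)
    have "cnorm x \<le> 2 * cnorm (?C (Qt t x))" if x: "x \<in> V" for x
    proof -
      have "x = ?C (Qt t x) + E t x"
        using x elim Q C by (simp add: E_def endo_diff inv_left[OF Q bij])
      then have "cnorm x \<le> cnorm (?C (Qt t x)) + cnorm (E t x)" using cnorm_add by metis
      also have "cnorm (E t x) \<le> (\<Sum>b\<in>bas. cnorm (E t b)) * cnorm x"
        using elim x by (intro cnorm_endo) auto
      also have "\<dots> \<le> 1/2 * cnorm x" using elim by (intro mult_right_mono) auto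
      finally show ?thesis by simp
    qed
    then show ?case using elim by auto
  qed
  then show b: "\<forall>\<^sub>F t in F. bij_betw (Qt t) V V"
  proof eventually_elim
    case (elim t)
    show ?case
    proof (rule inj_bij)
      fix x assume x: "x \<in> V" "Qt t x = 0"
      then have "cnorm x \<le> 2 * cnorm 0" using elim endo_zero[OF C] by (metis)
      then have "cnorm x = 0" using cnorm_nonneg[of x] by (simp add: cnorm_def coord_simps)
      then show "x = 0" using x cnorm_eq_0 by simp
    qed (use elim in simp)
  qed
  show "oplim (\<lambda>t. inv_into V (Qt t)) (inv_into V Q) F"
    unfolding oplim_def
  proof (intro conjI ballI C)
    show "\<forall>\<^sub>F t in F. endo (inv_into V (Qt t))"
      using oplD(1)[OF Qt] b by eventually_elim (rule endo_inv)
    fix x assume x: "x \<in> V"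
    let ?y = "\<lambda>t. inv_into V (Qt t) x"
    \<comment> \<open>\<open>y - C x = E y\<close> for the preimage \<open>y\<close> of
      \<open>x\<close> under \<open>Qt\<close>: boundedness of \<open>y\<close> together with
      \<open>E\<close> tending to zero gives convergence of the inverses.\<close>
    have bd: "\<forall>\<^sub>F t in F. cnorm (?y t) \<le> 2 * cnorm (?C x) \<and> ?y t \<in> V \<and> ?y t - ?C x = E t (?y t) \<and> endo (E t)"
      using main b
    proof eventually_elim
      case (elim t)
      have y: "?y t \<in> V" "Qt t (?y t) = x" using elim x by (auto intro: inv_in inv_right)
      moreover have "cnorm (?y t) \<le> 2 * cnorm (?C (Qt t (?y t)))" using elim y(1) by blast
      moreover have "?y t - ?C x = E t (?y t)"
        using y x Q C by (simp add: E_def endo_diff inv_left[OF Q bij])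
      ultimately show ?case using elim by simp
    qed
    show "weak_lim ?y (?C x) F"
      unfolding weak_lim_def
    proof
      fix \<phi> assume \<phi>: "\<phi> \<in> dual"
      have "((\<lambda>t. \<Sum>b\<in>bas. 2 * cnorm (?C x) * norm (\<phi> (E t b))) \<longlongrightarrow> (\<Sum>b\<in>bas. 2 * cnorm (?C x) * norm (\<phi> 0))) F"
        using oplD(3)[OF E bas_in] \<phi> unfolding weak_lim_def
        by (intro tendsto_sum tendsto_mult tendsto_const tendsto_norm) blast
      then have z: "((\<lambda>t. \<Sum>b\<in>bas. 2 * cnorm (?C x) * norm (\<phi> (E t b))) \<longlongrightarrow> 0) F"
        by (simp add: functional_zero[OF \<phi>])
      have "((\<lambda>t. \<phi> (?y t) - \<phi> (?C x)) \<longlongrightarrow> 0) F"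
      proof (rule tendsto_0_le[OF z, of _ 1])
        show "\<forall>\<^sub>F t in F. norm (\<phi> (?y t) - \<phi> (?C x)) \<le> norm (\<Sum>b\<in>bas. 2 * cnorm (?C x) * norm (\<phi> (E t b))) * 1"
          using bd
        proof eventually_elim
          case (elim t)
          have "\<phi> (?y t) - \<phi> (?C x) = \<phi> (E t (?y t))"
            using elim functional_diff[OF \<phi>, of "?y t" "?C x"] by simp
          also have "\<dots> = (\<Sum>b\<in>bas. coord b (?y t) * \<phi> (E t b))"
            using elim by (intro functional_endo_expand \<phi>) auto
          also have "norm \<dots> \<le> (\<Sum>b\<in>bas. 2 * cnorm (?C x) * norm (\<phi> (E t b)))"
          proof (rule sum_norm_le)
            fix b assume "b \<in> bas"
            then have "norm (coord b (?y t)) \<le> 2 * cnorm (?C x)"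
              using elim cnorm_coord[of b "?y t"] by linarith
            then show "norm (coord b (?y t) * \<phi> (E t b)) \<le> 2 * cnorm (?C x) * norm (\<phi> (E t b))"
              by (simp add: norm_mult mult_right_mono)
          qed
          finally show ?case by simp
        qed
      qed
      then show "((\<lambda>t. \<phi> (?y t)) \<longlongrightarrow> \<phi> (?C x)) F" using Lim_null by blast
    qed
  qed
qed

end

section \<open>Quotients of entire functions of an operator\<close>

text \<open>
  Taylor coefficients: \<open>F = F_num / F_den\<close> with \<open>F_num = (e\<^sup>z + 1)/2\<close> and \<open>F_den = e\<^sup>z - 1\<close>; cancelling
  \<open>z\<close> gives \<open>f = f_num / f_den\<close> with \<open>z f_den = F_den\<close> and \<open>z f_num + f_den = F_num\<close>.
\<close>

definition exp_c :: "nat \<Rightarrow> complex" where "exp_c n = 1 / fact n"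
definition F_num :: "nat \<Rightarrow> complex" where "F_num n = (if n = 0 then 1 else 1 / (2 * fact n))"
definition F_den :: "nat \<Rightarrow> complex" where "F_den n = (if n = 0 then 0 else 1 / fact n)"
definition f_num :: "nat \<Rightarrow> complex" where "f_num n = 1 / (2 * fact (Suc n)) - 1 / fact (Suc (Suc n))"
definition f_den :: "nat \<Rightarrow> complex" where "f_den n = 1 / fact (Suc n)"

lemma entireI:
  assumes "\<And>n. norm (c n) \<le> 1 / fact n"
  shows "entire c"
  unfolding entire_def
proof
  fix r :: real
  have "summable (\<lambda>n. inverse (fact n) * \<bar>r\<bar> ^ n)"
    by (rule summable_exp)
  then show "summable (\<lambda>n. norm (c n) * r ^ n)"
  proof (rule summable_comparison_test'[where N = 0])
    fix n
    have "norm (c n) * \<bar>r\<bar> ^ n \<le> 1 / fact n * \<bar>r\<bar> ^ n"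
      by (intro mult_right_mono assms) auto
    then show "norm (norm (c n) * r ^ n) \<le> inverse (fact n) * \<bar>r\<bar> ^ n"
      by (simp add: abs_mult power_abs divide_inverse)
  qed
qed

lemma entire_exp_c: "entire exp_c"
  by (rule entireI) (simp add: exp_c_def norm_divide)

lemma entire_F_num: "entire F_num"
proof (rule entireI)
  fix n :: nat
  have "1 / (2 * fact n) \<le> (1 / fact n :: real)"
    by (intro divide_left_mono) auto
  then show "norm (F_num n) \<le> 1 / fact n" by (simp add: F_num_def norm_divide norm_mult)
qed

lemma entire_F_den: "entire F_den"
  by (rule entireI) (simp add: F_den_def norm_divide)

lemma entire_f_den: "entire f_den"
proof (rule entireI)
  fix n :: nat
  have "fact n \<le> (fact (Suc n) :: real)" by (intro fact_mono) auto
  then have "1 / fact (Suc n) \<le> (1 / fact n :: real)"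
    by (intro divide_left_mono) auto
  then show "norm (f_den n) \<le> 1 / fact n" by (simp add: f_den_def norm_divide del: fact_Suc)
qed

lemma entire_f_num: "entire f_num"
proof (rule entireI)
  fix n :: nat
  have "fact n \<le> (fact (Suc n) :: real)" by (intro fact_mono) auto
  moreover have "2 * fact (Suc n) \<le> (fact (Suc (Suc n)) :: real)"
    unfolding fact_Suc[of "Suc n"] by (intro mult_right_mono) auto
  ultimately have "2 * fact n \<le> (2 * fact (Suc n) :: real)" "2 * fact n \<le> (fact (Suc (Suc n)) :: real)"
    by linarith+
  then have "1 / (2 * fact (Suc n)) \<le> (1 / (2 * fact n) :: real)" "1 / fact (Suc (Suc n)) \<le> (1 / (2 * fact n) :: real)"
    by (auto intro!: divide_left_mono simp del: fact_Suc)
  moreover have "norm (f_num n) \<le> norm (1 / (2 * fact (Suc n)) :: complex) + norm (1 / fact (Suc (Suc n)) :: complex)"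
    unfolding f_num_def by (rule norm_triangle_ineq4)
  ultimately have "norm (f_num n) \<le> 1 / (2 * fact n) + 1 / (2 * fact n)"
    by (simp add: norm_divide norm_mult del: fact_Suc)
  then show "norm (f_num n) \<le> 1 / fact n" by simp
qed

lemmas entire_intros =
  entire_exp_c entire_F_num entire_F_den entire_f_num entire_f_den

lemma entire_Suc: "entire c \<Longrightarrow> entire (\<lambda>n. c (Suc n))"
  unfolding entire_def
proof
  fix r :: real
  assume c: "\<forall>r::real. summable (\<lambda>n. norm (c n) * r ^ n)"
  show "summable (\<lambda>n. norm (c (Suc n)) * r ^ n)"
  proof (cases "r = 0")
    case True
    then show ?thesis by (intro summable_finite[of "{0}"]) auto
  next
    case False
    have "summable (\<lambda>n. norm (c (Suc n)) * r ^ Suc n)"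
      using c summable_Suc_iff[of "\<lambda>n. norm (c n) * r ^ n"] by blast
    then have "summable (\<lambda>n. norm (c (Suc n)) * r ^ Suc n * (1 / r))" by (rule summable_mult2)
    then show ?thesis using False by (simp add: field_simps)
  qed
qed

context fd_space begin

text \<open>Splitting off the constant term replaces multiplication of power series: the identities
  between the five series follow from this and from linear combinations.\<close>

lemma pser_shift:
  assumes "endo A" "entire c" "x \<in> V"
  shows "pser c A x = smul (c 0) x + A (pser (\<lambda>n. c (Suc n)) A x)"
  unfolding pser_def[of c]
proof (rule psum_eqI)
  fix \<phi> assume \<phi>: "\<phi> \<in> dual"
  have "linform (\<lambda>x. \<phi> (A x))" using assms(1) \<phi> by (intro linform_comp) (auto simp: endo_def)
  then obtain \<theta> where \<theta>: "\<theta> \<in> dual" "\<And>x. x \<in> V \<Longrightarrow> \<phi> (A x) = \<theta> x"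
    by (rule linform_functional) blast
  note c' = entire_Suc[OF assms(2)]
  have "(\<lambda>n. c (Suc n) * \<theta> ((A ^^ n) x)) sums \<theta> (pser (\<lambda>n. c (Suc n)) A x)"
    by (rule pser_sums[OF assms(1) c' assms(3) \<theta>(1)])
  then have "(\<lambda>n. c (Suc n) * \<phi> ((A ^^ Suc n) x)) sums \<phi> (A (pser (\<lambda>n. c (Suc n)) A x))"
    using endo_in[OF endo_pow[OF assms(1)] assms(3)] endo_in[OF endo_pser[OF assms(1) c'] assms(3)]
    by (simp add: \<theta>(2))
  from sums_Suc[OF this]
  show "(\<lambda>n. c n * \<phi> ((A ^^ n) x)) sums \<phi> (smul (c 0) x + A (pser (\<lambda>n. c (Suc n)) A x))"
    by (simp add: functional_simps[OF \<phi>] add.commute)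
qed

lemma pser_comb:
  assumes "endo A" "entire c" "entire d" "x \<in> V"
  shows "pser (\<lambda>n. k * c n + l * d n) A x = smul k (pser c A x) + smul l (pser d A x)"
  unfolding pser_def[of "\<lambda>n. k * c n + l * d n"]
proof (rule psum_eqI)
  fix \<phi> assume \<phi>: "\<phi> \<in> dual"
  show "(\<lambda>n. (k * c n + l * d n) * \<phi> ((A ^^ n) x)) sums \<phi> (smul k (pser c A x) + smul l (pser d A x))"
    using sums_add[OF sums_mult[OF pser_sums[OF assms(1,2,4) \<phi>], of k]
        sums_mult[OF pser_sums[OF assms(1,3,4) \<phi>], of l]]
    by (simp add: functional_simps[OF \<phi>] algebra_simps)
qed

lemma pser_F_den: "endo A \<Longrightarrow> x \<in> V \<Longrightarrow> pser F_den A x = A (pser f_den A x)"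
  using pser_shift[of A F_den x] by (simp add: entire_F_den F_den_def f_den_def[abs_def] del: fact_Suc)

lemma pser_F_den_exp:
  assumes "endo A" "x \<in> V" shows "pser F_den A x = pser exp_c A x - x"
  using pser_shift[OF assms(1) entire_exp_c assms(2)] pser_shift[OF assms(1) entire_F_den assms(2)]
  by (simp add: F_den_def exp_c_def del: fact_Suc)

lemma pser_F_num_exp:
  assumes "endo A" "x \<in> V" shows "pser F_num A x = smul (1/2) (pser exp_c A x + x)"
proof -
  \<comment> \<open>\<open>(e^z + 1)/2 = e^z - (e^z - 1)/2\<close>.\<close>
  have "F_num = (\<lambda>n. 1 * exp_c n + (- 1/2) * F_den n)"
    by (rule ext) (simp add: F_num_def exp_c_def F_den_def field_simps)
  then have "pser F_num A x = smul 1 (pser exp_c A x) + smul (- 1/2) (pser F_den A x)"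
    using pser_comb[OF assms(1) entire_exp_c entire_F_den assms(2), of 1 "-1/2"] by simp
  also have "\<dots> = smul 1 (pser exp_c A x) - smul (1/2) (pser exp_c A x) + smul (1/2) x"
    by (simp add: pser_F_den_exp[OF assms] scale_right_diff_distrib)
  also have "smul 1 (pser exp_c A x) - smul (1/2) (pser exp_c A x) = smul (1/2) (pser exp_c A x)"
    unfolding scale_left_diff_distrib[symmetric] by simp
  finally show ?thesis by (simp add: scale_right_distrib)
qed

text \<open>Divided by \<open>F_den = z f_den\<close>, this is \<open>F = f + 1/z\<close> in a form
  that makes sense even if the operator is not invertible.\<close>

lemma pser_F_num:
  assumes "endo A" "x \<in> V" shows "pser F_num A x = A (pser f_num A x) + pser f_den A x"
proof -
  let ?n = "\<lambda>n. F_num (Suc n)" and ?d = "\<lambda>n. f_den (Suc n)"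
  note e = entire_Suc[OF entire_F_num] entire_Suc[OF entire_f_den]
  have "f_num = (\<lambda>n. 1 * ?n n + (- 1) * ?d n)"
    by (auto simp: f_num_def F_num_def f_den_def simp del: fact_Suc)
  then have "pser f_num A x = pser ?n A x - pser ?d A x"
    using pser_comb[OF assms(1) e assms(2), of 1 "-1"] by simp
  moreover have "pser ?n A x \<in> V" "pser ?d A x \<in> V"
    using endo_pser[OF assms(1)] e assms(2) by auto
  ultimately show ?thesis
    using pser_shift[OF assms(1) entire_F_num assms(2)] pser_shift[OF assms(1) entire_f_den assms(2)]
    by (simp add: endo_diff[OF assms(1)] F_num_def f_den_def)
qed

lemma bij_F_den:
  assumes "endo A" "bij_betw A V V" "bij_betw (pser f_den A) V V"
  shows "bij_betw (pser F_den A) V V"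
proof -
  have "bij_betw (A \<circ> pser f_den A) V V" by (rule bij_betw_trans[OF assms(3,2)])
  then show ?thesis
    using bij_betw_cong[of V "pser F_den A" "A \<circ> pser f_den A" V] pser_F_den[OF assms(1)] by simp
qed

text \<open>The identity \<open>F = f + 1/z\<close> for an invertible operator. With
  \<open>y\<close> the preimage of \<open>x\<close> under \<open>F_den\<close>, all three terms are
  series in \<open>A\<close> applied to \<open>y\<close>.\<close>

lemma quo_F_f:
  assumes "endo A" "bij_betw A V V" "bij_betw (pser f_den A) V V" "x \<in> V"
  shows "quo F_num F_den V A x = quo f_num f_den V A x + inv_into V A x"
proof -
  note b = bij_F_den[OF assms(1-3)]
  note l = endo_pser[OF assms(1)]
  define y where "y = inv_into V (pser F_den A) x"
  have y: "y \<in> V" "pser F_den A y = x"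
    using inv_in[OF l[OF entire_F_den] b assms(4)] inv_right[OF l[OF entire_F_den] b assms(4)]
    by (auto simp: y_def)
  have x1: "x = A (pser f_den A y)" using y pser_F_den[OF assms(1)] by simp
  have x2: "x = pser f_den A (A y)"
    using pser_commute[OF assms(1,1,1) _ y(1) entire_f_den] x1 by simp
  have "inv_into V A x = pser f_den A y"
    unfolding x1 by (rule inv_left[OF assms(1,2)]) (simp add: l entire_f_den y)
  moreover have "inv_into V (pser f_den A) x = A y"
    unfolding x2 by (rule inv_left[OF l[OF entire_f_den] assms(3)]) (simp add: assms y)
  moreover have "pser f_num A (A y) = A (pser f_num A y)"
    by (rule pser_commute[OF assms(1,1,1) _ y(1) entire_f_num]) simp
  ultimately show ?thesis
    unfolding quo_def y_def[symmetric] using pser_F_num[OF assms(1) y(1)] by simp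
qed

lemma
  assumes "endo A" "entire c" "entire d" "bij_betw (pser d A) V V"
  shows endo_quo: "endo (quo c d V A)"
    and quo_pser: "u \<in> V \<Longrightarrow> quo c d V A (pser d A u) = pser c A u"
    and pser_quo: "x \<in> V \<Longrightarrow> pser d A (quo c d V A x) = pser c A x"
proof -
  note l = endo_pser[OF assms(1)]
  show "endo (quo c d V A)"
    unfolding quo_def[abs_def] by (rule endo_comp[OF l[OF assms(2)] endo_inv[OF l[OF assms(3)] assms(4)]])
  show "quo c d V A (pser d A u) = pser c A u" if "u \<in> V"
    using that inv_left[OF l[OF assms(3)] assms(4)] by (simp add: quo_def)
  show "pser d A (quo c d V A x) = pser c A x" if "x \<in> V"
    using pser_pser_commute[OF assms(1,3,2) inv_in[OF l[OF assms(3)] assms(4) that]]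
      inv_right[OF l[OF assms(3)] assms(4) that]
    by (simp add: quo_def)
qed

lemma quo_eqI:
  assumes "endo A" "entire c" "entire d" "bij_betw (pser d A) V V"
    and "x \<in> V" "w \<in> V" "pser d A w = pser c A x"
  shows "quo c d V A x = w"
proof -
  have "pser d A (quo c d V A x) = pser d A w"
    using pser_quo[OF assms(1-4)] assms by simp
  then show ?thesis
    using assms(4,6) endo_in[OF endo_quo[OF assms(1-4)] assms(5)] by (metis bij_betw_def inj_on_def)
qed

text \<open>Let \<open>x = Q2 u\<close>. Since \<open>P2\<close> and \<open>Q2\<close> commute,
  applying \<open>Q1\<close> to the right-hand side gives \<open>P1 C Q2 u - Q1 C P2 u = (P1 C - C
  P2) Q2 u - (Q1 C - C Q2) P2 u\<close>. Both brackets are instances of \<open>dser_eq\<close>, and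
  inverting \<open>Q1\<close> gives \<open>dquo\<close>.\<close>

lemma dquo_eq:
  assumes A: "endo A1" "endo A2" "endo C" "\<And>x. x \<in> V \<Longrightarrow> A1 (C x) - C (A2 x) = B x" "x \<in> V"
    and cd: "entire c" "entire d"
    and bij: "bij_betw (pser d A1) V V" "bij_betw (pser d A2) V V"
  shows "dquo c d V A1 B A2 x = quo c d V A1 (C x) - C (quo c d V A2 x)"
proof -
  note l1 = endo_pser[OF A(1)] and l2 = endo_pser[OF A(2)]
  define u where "u = inv_into V (pser d A2) x"
  have u: "u \<in> V" "pser d A2 u = x"
    using inv_in[OF l2[OF cd(2)] bij(2) A(5)] inv_right[OF l2[OF cd(2)] bij(2) A(5)]
    by (auto simp: u_def)
  have q2: "quo c d V A2 x = pser c A2 u" by (simp add: quo_def u_def)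
  have c2: "pser c A2 u \<in> V" using l2[OF cd(1)] u by simp
  note D = dser_eq[OF A(1-4)]
  have "dser c A1 B A2 x - dser d A1 B A2 (pser c A2 u)
      = (pser c A1 (C x) - C (pser c A2 x)) - (pser d A1 (C (pser c A2 u)) - C (pser d A2 (pser c A2 u)))"
    using D cd A(5) c2 by simp
  also have "pser d A2 (pser c A2 u) = pser c A2 x"
    using pser_pser_commute[OF A(2) cd(2,1) u(1)] u(2) by simp
  finally have "dser c A1 B A2 x - dser d A1 B A2 (pser c A2 u)
      = pser c A1 (C x) - pser d A1 (C (pser c A2 u))" by simp
  also have "pser c A1 (C x) = pser d A1 (quo c d V A1 (C x))"
    using pser_quo[OF A(1) cd bij(1)] A by simp
  also have "\<dots> - pser d A1 (C (pser c A2 u)) = pser d A1 (quo c d V A1 (C x) - C (pser c A2 u))"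
    using endo_in[OF endo_quo[OF A(1) cd bij(1)] endo_in[OF A(3,5)]] endo_in[OF A(3) c2]
    by (simp add: endo_diff[OF l1[OF cd(2)]])
  finally have *: "dser c A1 B A2 x - dser d A1 B A2 (pser c A2 u)
     = pser d A1 (quo c d V A1 (C x) - C (pser c A2 u))" .
  have "quo c d V A1 (C x) - C (pser c A2 u) \<in> V"
    using endo_in[OF endo_quo[OF A(1) cd bij(1)] endo_in[OF A(3,5)]] endo_in[OF A(3) c2] by simp
  then show ?thesis
    unfolding dquo_def u_def[symmetric] Let_def u(2) * q2
    by (rule inv_left[OF l1[OF cd(2)] bij(1)])
qed

lemma oplim_quo:
  assumes "oplim At A F" "entire c" "entire d" "bij_betw (pser d A) V V"
  shows "oplim (\<lambda>t. quo c d V (At t)) (quo c d V A) F"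
  unfolding quo_def[abs_def]
  by (rule oplim_comp[OF oplim_pser[OF assms(1,2)] oplim_inv(2)[OF oplim_pser[OF assms(1,3)] assms(4)]])

text \<open>Writes \<open>dquo\<close> as a composition of operators, so that its limit is a
  composition of known limits.\<close>

lemma dquo_alt:
  "dquo c d V A1 B A2 = (\<lambda>x. inv_into V (pser d A1)
     ((\<lambda>u. dser c A1 B A2 (pser d A2 u) - dser d A1 B A2 (pser c A2 u)) (inv_into V (pser d A2) x)))"
  by (simp add: dquo_def[abs_def] Let_def)

lemma oplim_dquo:
  assumes "oplim A1 A1' F" "oplim B B' F" "oplim A2 A2' F" "entire c" "entire d"
    and "bij_betw (pser d A1') V V" "bij_betw (pser d A2') V V"
  shows "oplim (\<lambda>t. dquo c d V (A1 t) (B t) (A2 t)) (dquo c d V A1' B' A2') F"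
  unfolding dquo_alt
  by (rule oplim_comp[OF oplim_inv(2)[OF oplim_pser[OF assms(1,5)] assms(6)]
        oplim_comp[OF oplim_minus[OF oplim_comp[OF oplim_dser[OF assms(1-4)] oplim_pser[OF assms(3,5)]]
            oplim_comp[OF oplim_dser[OF assms(1-3,5)] oplim_pser[OF assms(3,4)]]]
          oplim_inv(2)[OF oplim_pser[OF assms(3,5)] assms(7)]]])

lemma oplim_line:
  assumes "endo A" "endo B" shows "oplim (\<lambda>t x. A x + smul t (B x)) A (at 0)"
proof -
  have "oplim (\<lambda>t x. A x + smul t (B x)) (\<lambda>x. A x + smul 0 (B x)) (at 0)"
    by (rule oplim_plus[OF oplim_const[OF assms(1)] oplim_smul[OF oplim_const[OF assms(2)] tendsto_ident_at]])
  then show ?thesis by simp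
qed

text \<open>The difference quotient is itself a divided difference: multiplication by
  \<open>1/t\<close> plays the part of \<open>C\<close> in \<open>dquo_eq\<close>, since
  \<open>(A + t B)/t - A/t = B\<close>. Continuity of \<open>dquo\<close> then gives the
  derivative.\<close>

lemma quo_deriv:
  assumes A: "endo A" "endo B" and cd: "entire c" "entire d"
    and bij: "bij_betw (pser d A) V V" and x: "x \<in> V"
  shows "weak_lim (\<lambda>t. smul (1 / t) (quo c d V (\<lambda>y. A y + smul t (B y)) x - quo c d V A x))
    (dquo c d V A B A x) (at 0)"
proof -
  let ?A = "\<lambda>t y. A y + smul t (B y)"
  note o = oplim_line[OF A]
  have "\<forall>\<^sub>F t in at 0. bij_betw (pser d (?A t)) V V"
    by (rule oplim_inv(1)[OF oplim_pser[OF o cd(2)] bij])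
  moreover have "\<forall>\<^sub>F t in at (0::complex). t \<noteq> 0" by (rule eventually_neq_at_within)
  ultimately have "\<forall>\<^sub>F t in at 0. dquo c d V (?A t) B A x
      = smul (1 / t) (quo c d V (?A t) x - quo c d V A x)"
    using oplD(1)[OF o]
  proof eventually_elim
    case (elim t)
    note lq = endo_quo[OF elim(3) cd elim(1)]
    have "dquo c d V (?A t) B A x = quo c d V (?A t) (smul (1 / t) x) - smul (1 / t) (quo c d V A x)"
    proof (rule dquo_eq[OF elim(3) A(1) endo_const_smul _ x cd elim(1) bij])
      fix y assume "y \<in> V"
      then show "?A t (smul (1 / t) y) - smul (1 / t) (A y) = B y"
        using elim(2) by (simp add: endo_smul[OF A(1)] endo_smul[OF A(2)])
    qed
    then show ?case by (simp add: endo_smul[OF lq x] scale_right_diff_distrib)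
  qed
  moreover have "weak_lim (\<lambda>t. dquo c d V (?A t) B A x) (dquo c d V A B A x) (at 0)"
    by (rule oplD(3)[OF oplim_dquo[OF o oplim_const[OF A(2)] oplim_const[OF A(1)] cd bij bij] x])
  ultimately show ?thesis by (subst (asm) weak_lim_cong) auto
qed

end

section \<open>Products of exponential series under a bilinear map\<close>

context complex_vector_space begin

text \<open>The recursion for \<open>g\<close> is Leibniz' rule, so the claim is
  \<open>exp(A) (x) exp(A') = exp(A (x) 1 + 1 (x) A')\<close> without tensor products. The family
  \<open>g\<close> is left abstract because two cases are needed: iterates of a derivation on a
  bracket, and zero for \<open>n > 0\<close> if \<open>\<beta>\<close> is invariant.\<close>

lemma exp_bilinear:
  fixes \<beta> :: "'a \<Rightarrow> 'a \<Rightarrow> complex" and g :: "nat \<Rightarrow> 'a \<Rightarrow> 'a \<Rightarrow> complex"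
  assumes V: "fd_space smul V" and W: "fd_space smul W"
    and A: "fd_space.endo smul V A" and A': "fd_space.endo smul W A'"
    and \<beta>1: "\<And>y. (\<lambda>x. \<beta> x y) \<in> dual" and \<beta>2: "\<And>x. \<beta> x \<in> dual"
    and g0: "\<And>x y. x \<in> V \<Longrightarrow> y \<in> W \<Longrightarrow> g 0 x y = \<beta> x y"
    and gS: "\<And>n x y. x \<in> V \<Longrightarrow> y \<in> W \<Longrightarrow> g (Suc n) x y = g n (A x) y + g n x (A' y)"
    and X: "X \<in> V" and Y: "Y \<in> W"
  shows "(\<lambda>n. exp_c n * g n X Y) sums \<beta> (pser exp_c A X) (pser exp_c A' Y)"
proof -
  interpret V: fd_space smul V by fact
  interpret W: fd_space smul W by fact
  \<comment> \<open>The binomial theorem: \<open>A\<close> and \<open>A'\<close> act on different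
    arguments and so commute.\<close>
  have g: "g n x y = (\<Sum>i\<le>n. of_nat (n choose i) * \<beta> ((A ^^ i) x) ((A' ^^ (n - i)) y))"
    if "x \<in> V" "y \<in> W" for n x y
    using that
  proof (induction n arbitrary: x y)
    case (Suc n)
    let ?b = "\<lambda>i j. \<beta> ((A ^^ i) x) ((A' ^^ j) y)"
    have "g (Suc n) x y = (\<Sum>i\<le>n. of_nat (n choose i) * ?b (Suc i) (n - i))
        + (\<Sum>i\<le>n. of_nat (n choose i) * ?b i (Suc n - i))"
      using Suc.prems V.endo_in[OF A] W.endo_in[OF A']
      by (auto simp: gS Suc.IH funpow_swap1 Suc_diff_le intro!: sum.cong)
    also have "(\<Sum>i\<le>n. of_nat (n choose i) * ?b i (Suc n - i))
        = (\<Sum>i\<le>Suc n. of_nat (n choose i) * ?b i (Suc n - i))" by simp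
    also have "\<dots> = ?b 0 (Suc n) + (\<Sum>i\<le>n. of_nat (n choose Suc i) * ?b (Suc i) (n - i))"
      by (subst sum.atMost_Suc_shift) simp
    finally have "g (Suc n) x y = ?b 0 (Suc n) + (\<Sum>i\<le>n. of_nat (Suc n choose Suc i) * ?b (Suc i) (n - i))"
      by (simp add: sum.distrib[symmetric] algebra_simps)
    also have "\<dots> = (\<Sum>i\<le>Suc n. of_nat (Suc n choose i) * ?b i (Suc n - i))"
      by (subst sum.atMost_Suc_shift) simp
    finally show ?case .
  qed (simp add: g0)
  \<comment> \<open>In coordinates the statement becomes finitely many Cauchy products of absolutely
    convergent scalar series.\<close>
  have expand: "\<beta> x y = (\<Sum>b\<in>V.bas. \<Sum>b'\<in>W.bas. V.coord b x * W.coord b' y * \<beta> b b')"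
    if "x \<in> V" "y \<in> W" for x y
  proof -
    have "\<beta> x y = (\<Sum>b\<in>V.bas. V.coord b x * \<beta> b y)"
      by (rule V.functional_expand[OF \<beta>1 that(1)])
    also have "\<dots> = (\<Sum>b\<in>V.bas. V.coord b x * (\<Sum>b'\<in>W.bas. W.coord b' y * \<beta> b b'))"
      by (rule sum.cong[OF refl]) (simp only: W.functional_expand[OF \<beta>2 that(2)])
    finally show ?thesis by (simp add: sum_distrib_left mult.assoc)
  qed
  define p where "p b n = exp_c n * V.coord b ((A ^^ n) X)" for b n
  define q where "q b n = exp_c n * W.coord b ((A' ^^ n) Y)" for b n
  have p: "summable (\<lambda>n. norm (p b n))" "p b sums V.coord b (pser exp_c A X)" for b
    unfolding p_def
    using V.geometric_summable[OF V.geometric_pow[OF A X] entire_exp_c V.coord_functional]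
      V.pser_sums[OF A entire_exp_c X V.coord_functional] by auto
  have q: "summable (\<lambda>n. norm (q b n))" "q b sums W.coord b (pser exp_c A' Y)" for b
    unfolding q_def
    using W.geometric_summable[OF W.geometric_pow[OF A' Y] entire_exp_c W.coord_functional]
      W.pser_sums[OF A' entire_exp_c Y W.coord_functional] by auto
  have "(\<lambda>k. \<Sum>i\<le>k. p b i * q b' (k - i)) sums (V.coord b (pser exp_c A X) * W.coord b' (pser exp_c A' Y))" for b b'
    using Cauchy_product_sums[OF p(1) q(1)] sums_unique[OF p(2)] sums_unique[OF q(2)] by metis
  then have "(\<lambda>k. \<Sum>b\<in>V.bas. \<Sum>b'\<in>W.bas. (\<Sum>i\<le>k. p b i * q b' (k - i)) * \<beta> b b') sums
      (\<Sum>b\<in>V.bas. \<Sum>b'\<in>W.bas. V.coord b (pser exp_c A X) * W.coord b' (pser exp_c A' Y) * \<beta> b b')"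
    by (intro sums_sum sums_mult2) auto
  also have "(\<Sum>b\<in>V.bas. \<Sum>b'\<in>W.bas. V.coord b (pser exp_c A X) * W.coord b' (pser exp_c A' Y) * \<beta> b b')
      = \<beta> (pser exp_c A X) (pser exp_c A' Y)"
    using V.endo_in[OF V.endo_pser[OF A entire_exp_c] X]
      W.endo_in[OF W.endo_pser[OF A' entire_exp_c] Y] by (rule expand[symmetric])
  also have "(\<lambda>k. \<Sum>b\<in>V.bas. \<Sum>b'\<in>W.bas. (\<Sum>i\<le>k. p b i * q b' (k - i)) * \<beta> b b') = (\<lambda>k. exp_c k * g k X Y)"
  proof
    fix k
    have "(\<Sum>b\<in>V.bas. \<Sum>b'\<in>W.bas. (\<Sum>i\<le>k. p b i * q b' (k - i)) * \<beta> b b')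
       = (\<Sum>b\<in>V.bas. \<Sum>i\<le>k. \<Sum>b'\<in>W.bas. p b i * q b' (k - i) * \<beta> b b')"
      by (simp add: sum_distrib_right sum.swap[of _ W.bas])
    also have "\<dots> = (\<Sum>i\<le>k. \<Sum>b\<in>V.bas. \<Sum>b'\<in>W.bas. p b i * q b' (k - i) * \<beta> b b')"
      by (rule sum.swap)
    also have "\<dots> = (\<Sum>i\<le>k. exp_c i * exp_c (k - i) * \<beta> ((A ^^ i) X) ((A' ^^ (k - i)) Y))"
    proof (rule sum.cong[OF refl])
      fix i
      show "(\<Sum>b\<in>V.bas. \<Sum>b'\<in>W.bas. p b i * q b' (k - i) * \<beta> b b')
          = exp_c i * exp_c (k - i) * \<beta> ((A ^^ i) X) ((A' ^^ (k - i)) Y)"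
        unfolding expand[OF V.endo_in[OF V.endo_pow[OF A] X] W.endo_in[OF W.endo_pow[OF A'] Y]]
        by (simp add: p_def q_def sum_distrib_left mult_ac)
    qed
    also have "\<dots> = (\<Sum>i\<le>k. exp_c k * (of_nat (k choose i) * \<beta> ((A ^^ i) X) ((A' ^^ (k - i)) Y)))"
      by (rule sum.cong) (auto simp: exp_c_def binomial_fact field_simps)
    finally show "(\<Sum>b\<in>V.bas. \<Sum>b'\<in>W.bas. (\<Sum>i\<le>k. p b i * q b' (k - i)) * \<beta> b b') = exp_c k * g k X Y"
      by (simp add: g[OF X Y] sum_distrib_left)
  qed
  finally show ?thesis .
qed

end

section \<open>The exponential of a derivation\<close>

text \<open>\<open>F = (e^A + 1)/2\<close> divided by \<open>e^A - 1\<close>: the vector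
  \<open>u\<close> is the preimage of \<open>x\<close> under the denominator, and in terms of
  \<open>u\<close> no inverse is left.\<close>

lemma (in fd_space) F_cayley:
  assumes "endo A" "bij_betw (pser F_den A) V V" "x \<in> V"
  obtains u where "u \<in> V" "x = pser exp_c A u - u"
    "quo F_num F_den V A x = smul (1/2) (pser exp_c A u + u)"
proof
  note l = endo_pser[OF assms(1) entire_F_den]
  let ?u = "inv_into V (pser F_den A) x"
  show u: "?u \<in> V" by (rule inv_in[OF l assms(2,3)])
  show "x = pser exp_c A ?u - ?u"
    using inv_right[OF l assms(2,3)] pser_F_den_exp[OF assms(1) u] by simp
  show "quo F_num F_den V A x = smul (1/2) (pser exp_c A ?u + ?u)"
    unfolding quo_def by (rule pser_F_num_exp[OF assms(1) u])
qed

context complex_vector_space begin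

definition bilin :: "('a \<Rightarrow> 'a \<Rightarrow> 'a) \<Rightarrow> bool" where
  "bilin \<beta> \<longleftrightarrow> (\<forall>x x' y. \<beta> (x + x') y = \<beta> x y + \<beta> x' y) \<and> (\<forall>x y y'. \<beta> x (y + y') = \<beta> x y + \<beta> x y') \<and>
     (\<forall>c x y. \<beta> (smul c x) y = smul c (\<beta> x y)) \<and> (\<forall>c x y. \<beta> x (smul c y) = smul c (\<beta> x y))"

lemma
  assumes "bilin \<beta>"
  shows bilin_add_left: "\<beta> (x + x') y = \<beta> x y + \<beta> x' y"
    and bilin_add_right: "\<beta> x (y + y') = \<beta> x y + \<beta> x y'"
    and bilin_smul_left: "\<beta> (smul c x) y = smul c (\<beta> x y)"
    and bilin_smul_right: "\<beta> x (smul c y) = smul c (\<beta> x y)"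
  using assms by (auto simp: bilin_def)

lemma
  assumes "bilin \<beta>"
  shows bilin_diff_left: "\<beta> (x - x') y = \<beta> x y - \<beta> x' y"
    and bilin_diff_right: "\<beta> x (y - y') = \<beta> x y - \<beta> x y'"
  using bilin_add_left[OF assms, of "x - x'" x' y] bilin_add_right[OF assms, of x "y - y'" y']
  by (auto simp: algebra_simps)

lemma
  assumes "bilin \<beta>"
  shows bilin_zero_left: "\<beta> 0 y = 0" and bilin_zero_right: "\<beta> x 0 = 0"
  using bilin_diff_left[OF assms, of x x y] bilin_diff_right[OF assms, of x y y]
    bilin_diff_left[OF assms, of 0 0 y] bilin_diff_right[OF assms, of x 0 0] by auto

lemmas bilin_simps = bilin_add_left bilin_add_right bilin_smul_left bilin_smul_right
  bilin_diff_left bilin_diff_right bilin_zero_left bilin_zero_right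

text \<open>The exponential of a derivation is an automorphism. Three unrelated operators on three
  spaces are allowed, so that the rule covers graded pieces and operators with different
  shifts.\<close>

lemma exp_hom:
  assumes V: "fd_space smul V" and W: "fd_space smul W" and Z: "fd_space smul Z"
    and A: "fd_space.endo smul V A" and A': "fd_space.endo smul W A'" and A'': "fd_space.endo smul Z A''"
    and \<beta>: "bilin \<beta>" and \<beta>Z: "\<And>x y. x \<in> V \<Longrightarrow> y \<in> W \<Longrightarrow> \<beta> x y \<in> Z"
    and der: "\<And>x y. x \<in> V \<Longrightarrow> y \<in> W \<Longrightarrow> A'' (\<beta> x y) = \<beta> (A x) y + \<beta> x (A' y)"
    and X: "X \<in> V" and Y: "Y \<in> W"
  shows "\<beta> (pser exp_c A X) (pser exp_c A' Y) = pser exp_c A'' (\<beta> X Y)"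
proof -
  interpret V: fd_space smul V by fact
  interpret W: fd_space smul W by fact
  interpret Z: fd_space smul Z by fact
  show ?thesis
  proof (rule functionals_separate)
    fix \<phi> assume \<phi>: "\<phi> \<in> dual"
    have "(\<lambda>n. exp_c n * \<phi> ((A'' ^^ n) (\<beta> X Y))) sums \<phi> (\<beta> (pser exp_c A X) (pser exp_c A' Y))"
    proof (rule exp_bilinear[OF V W A A' _ _ _ _ X Y])
      show "(\<lambda>x. \<phi> (\<beta> x y)) \<in> dual" "(\<lambda>y. \<phi> (\<beta> x y)) \<in> dual" for x y
        by (auto simp: functionals_iff bilin_simps[OF \<beta>] functional_simps[OF \<phi>])
    next
      fix n x y assume xy: "x \<in> V" "y \<in> W"
      have "(A'' ^^ Suc n) (\<beta> x y) = (A'' ^^ n) (\<beta> (A x) y + \<beta> x (A' y))"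
        using der[OF xy] by (simp add: funpow_swap1)
      also have "\<dots> = (A'' ^^ n) (\<beta> (A x) y) + (A'' ^^ n) (\<beta> x (A' y))"
        using V.endo_in[OF A xy(1)] W.endo_in[OF A' xy(2)] xy
        by (intro Z.endo_add[OF Z.endo_pow[OF A'']] \<beta>Z)
      finally show "\<phi> ((A'' ^^ Suc n) (\<beta> x y)) = \<phi> ((A'' ^^ n) (\<beta> (A x) y)) + \<phi> ((A'' ^^ n) (\<beta> x (A' y)))"
        by (simp add: functional_add[OF \<phi>])
    qed simp
    moreover have "(\<lambda>n. exp_c n * \<phi> ((A'' ^^ n) (\<beta> X Y))) sums \<phi> (pser exp_c A'' (\<beta> X Y))"
      by (rule Z.pser_sums[OF A'' entire_exp_c \<beta>Z[OF X Y] \<phi>])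
    ultimately show "\<phi> (\<beta> (pser exp_c A X) (pser exp_c A' Y)) = \<phi> (pser exp_c A'' (\<beta> X Y))"
      by (rule sums_unique2)
  qed
qed

lemma smul_half: "smul (1/2) x + smul (1/2) x = x"
  unfolding scale_left_distrib[symmetric] by simp

text \<open>Write \<open>X = u' - u\<close>, \<open>Y = v' - v\<close> with \<open>u'\<close>,
  \<open>v'\<close> the exponential images. The argument of the outer \<open>F\<close> telescopes to
  \<open>\<beta> u' v' - \<beta> u v\<close>, which is \<open>e^A'' - 1\<close> applied to
  \<open>\<beta> u v\<close>, so \<open>F\<close> turns it into
  \<open>(\<beta> u' v' + \<beta> u v)/2\<close>. Subtracting this from
  \<open>\<beta> (u' + u) (v' + v) / 4\<close> leaves
  \<open>- \<beta> (u' - u) (v' - v) / 4\<close>, the origin of the constant.\<close>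

lemma F_hom:
  assumes V: "fd_space smul V" and W: "fd_space smul W" and Z: "fd_space smul Z"
    and A: "fd_space.endo smul V A" and A': "fd_space.endo smul W A'" and A'': "fd_space.endo smul Z A''"
    and \<beta>: "bilin \<beta>" and \<beta>Z: "\<And>x y. x \<in> V \<Longrightarrow> y \<in> W \<Longrightarrow> \<beta> x y \<in> Z"
    and der: "\<And>x y. x \<in> V \<Longrightarrow> y \<in> W \<Longrightarrow> A'' (\<beta> x y) = \<beta> (A x) y + \<beta> x (A' y)"
    and b: "bij_betw (pser F_den A) V V" "bij_betw (pser F_den A') W W" "bij_betw (pser F_den A'') Z Z"
    and X: "X \<in> V" and Y: "Y \<in> W"
  shows "\<beta> (quo F_num F_den V A X) (quo F_num F_den W A' Y)
      - quo F_num F_den Z A'' (\<beta> X (quo F_num F_den W A' Y) + \<beta> (quo F_num F_den V A X) Y)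
      = smul (- 1/4) (\<beta> X Y)"
proof -
  interpret V: fd_space smul V by fact
  interpret W: fd_space smul W by fact
  interpret Z: fd_space smul Z by fact
  obtain u where u: "u \<in> V" and X': "X = pser exp_c A u - u"
    "quo F_num F_den V A X = smul (1/2) (pser exp_c A u + u)"
    by (rule V.F_cayley[OF A b(1) X])
  obtain v where v: "v \<in> W" and Y': "Y = pser exp_c A' v - v"
    "quo F_num F_den W A' Y = smul (1/2) (pser exp_c A' v + v)"
    by (rule W.F_cayley[OF A' b(2) Y])
  define u' where "u' = pser exp_c A u"
  define v' where "v' = pser exp_c A' v"
  note XX = X'(1)[folded u'_def] Y'(1)[folded v'_def]
  note FX = X'(2)[folded u'_def] Y'(2)[folded v'_def]
  let ?w = "\<beta> u v"
  have w: "?w \<in> Z" using \<beta>Z u v by simp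
  have e: "\<beta> u' v' = pser exp_c A'' ?w"
    unfolding u'_def v'_def by (rule exp_hom[OF V W Z A A' A'' \<beta> \<beta>Z der u v])
  have "\<beta> X (quo F_num F_den W A' Y) + \<beta> (quo F_num F_den V A X) Y
     = (smul (1/2) (\<beta> u' v') + smul (1/2) (\<beta> u' v')) - (smul (1/2) (\<beta> u v) + smul (1/2) (\<beta> u v))"
    unfolding FX unfolding XX
    by (simp add: bilin_simps[OF \<beta>] scale_right_distrib scale_right_diff_distrib algebra_simps)
  also have "\<dots> = pser F_den A'' ?w"
    unfolding smul_half e using Z.pser_F_den_exp[OF A'' w] by simp
  finally have *: "quo F_num F_den Z A'' (\<beta> X (quo F_num F_den W A' Y) + \<beta> (quo F_num F_den V A X) Y)
      = smul (1/2) (\<beta> u' v' + \<beta> u v)"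
    using Z.quo_pser[OF A'' entire_F_num entire_F_den b(3) w] Z.pser_F_num_exp[OF A'' w] e
    by simp
  show ?thesis
  proof (rule functionals_separate)
    fix \<phi> assume \<phi>: "\<phi> \<in> dual"
    show "\<phi> (\<beta> (quo F_num F_den V A X) (quo F_num F_den W A' Y)
      - quo F_num F_den Z A'' (\<beta> X (quo F_num F_den W A' Y) + \<beta> (quo F_num F_den V A X) Y))
      = \<phi> (smul (- 1/4) (\<beta> X Y))"
      unfolding * unfolding FX unfolding XX
      by (simp add: bilin_simps[OF \<beta>] functional_simps[OF \<phi>] algebra_simps)
  qed
qed

text \<open>Skew operators exponentiate to isometries, \<open>\<beta> u' v' = \<beta> u v\<close>,
  and the Cayley transform of an isometry is skew.\<close>

lemma F_skew:
  fixes \<beta> :: "'a \<Rightarrow> 'a \<Rightarrow> complex"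
  assumes V: "fd_space smul V" and W: "fd_space smul W"
    and A: "fd_space.endo smul V A" and A': "fd_space.endo smul W A'"
    and \<beta>1: "\<And>y. (\<lambda>x. \<beta> x y) \<in> dual" and \<beta>2: "\<And>x. \<beta> x \<in> dual"
    and der: "\<And>x y. x \<in> V \<Longrightarrow> y \<in> W \<Longrightarrow> \<beta> (A x) y + \<beta> x (A' y) = 0"
    and b: "bij_betw (pser F_den A) V V" "bij_betw (pser F_den A') W W"
    and X: "X \<in> V" and Y: "Y \<in> W"
  shows "\<beta> (quo F_num F_den V A X) Y = - \<beta> X (quo F_num F_den W A' Y)"
proof -
  interpret V: fd_space smul V by fact
  interpret W: fd_space smul W by fact
  obtain u where u: "u \<in> V" and X': "X = pser exp_c A u - u"
    "quo F_num F_den V A X = smul (1/2) (pser exp_c A u + u)"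
    by (rule V.F_cayley[OF A b(1) X])
  obtain v where v: "v \<in> W" and Y': "Y = pser exp_c A' v - v"
    "quo F_num F_den W A' Y = smul (1/2) (pser exp_c A' v + v)"
    by (rule W.F_cayley[OF A' b(2) Y])
  define u' where "u' = pser exp_c A u"
  define v' where "v' = pser exp_c A' v"
  note XX = X'(1)[folded u'_def] Y'(1)[folded v'_def]
  note FX = X'(2)[folded u'_def] Y'(2)[folded v'_def]
  \<comment> \<open>By \<open>der\<close> all terms of positive order vanish, so the exponential
    series of the pairing reduces to its constant term.\<close>
  have "(\<lambda>n. exp_c n * (if n = 0 then \<beta> u v else 0)) sums \<beta> u' v'"
    unfolding u'_def v'_def
    using der by (intro exp_bilinear[OF V W A A' \<beta>1 \<beta>2 _ _ u v]) auto
  moreover have "(\<lambda>n. exp_c n * (if n = 0 then \<beta> u v else 0)) sums \<beta> u v"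
  proof -
    have "(\<lambda>n. exp_c n * (if n = 0 then \<beta> u v else 0)) = (\<lambda>n. if n = 0 then \<beta> u v else 0)"
      by (auto simp: exp_c_def)
    then show ?thesis using sums_single[of 0 "\<lambda>n. \<beta> u v"] by simp
  qed
  ultimately have e: "\<beta> u' v' = \<beta> u v" by (rule sums_unique2)
  show ?thesis
    unfolding FX unfolding XX using e
    by (simp add: functional_simps[OF \<beta>1] functional_simps[OF \<beta>2] algebra_simps)
qed

end

section \<open>Spectrum and generalised eigenvectors\<close>

definition val :: "(nat \<Rightarrow> complex) \<Rightarrow> complex \<Rightarrow> complex" where
  "val c z = (\<Sum>n. c n * z ^ n)"

lemma entire_iff: "entire c \<longleftrightarrow> (\<forall>x::complex. summable (\<lambda>n. c n * x ^ n))"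
proof
  assume c: "entire c"
  show "\<forall>x. summable (\<lambda>n. c n * x ^ n)"
  proof
    fix x :: complex
    have "summable (\<lambda>n. norm (c n) * norm x ^ n)" using c by (simp add: entire_def)
    then show "summable (\<lambda>n. c n * x ^ n)"
      by (intro summable_norm_cancel[of "\<lambda>n. c n * x ^ n"]) (simp add: norm_mult norm_power)
  qed
next
  assume c: "\<forall>x. summable (\<lambda>n. c n * x ^ n)"
  show "entire c"
    unfolding entire_def
  proof
    fix r :: real
    have "summable (\<lambda>n. norm (c n * complex_of_real r ^ n))"
      \<comment> \<open>Convergence at a point of larger modulus forces absolute convergence at
        \<open>r\<close>; \<open>\<bar>r\<bar> + 1\<close> is such a point.\<close>
      by (rule powser_insidea[of c "complex_of_real (\<bar>r\<bar> + 1)"]) (use c in auto)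
    then have "summable (\<lambda>n. norm (norm (c n) * r ^ n))"
      by (simp add: norm_mult norm_power abs_mult power_abs)
    then show "summable (\<lambda>n. norm (c n) * r ^ n)" by (rule summable_norm_cancel)
  qed
qed

lemma val_sums: "entire c \<Longrightarrow> (\<lambda>n. c n * z ^ n) sums val c z"
  unfolding val_def entire_iff by (rule summable_sums) blast

lemma entire_diffs: "entire c \<Longrightarrow> entire (diffs c)"
  unfolding entire_iff by (blast intro: termdiff_converges_all)

lemma deriv_val: assumes "entire c" shows "deriv (val c) = val (diffs c)"
proof
  fix z
  have "((\<lambda>x. \<Sum>n. c n * x ^ n) has_field_derivative (\<Sum>n. diffs c n * z ^ n)) (at z)"
    using assms unfolding entire_iff by (intro termdiffs_strong_converges_everywhere) auto
  then show "deriv (val c) z = val (diffs c) z"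
    unfolding val_def[abs_def] by (rule DERIV_imp_deriv)
qed

lemma val_holomorphic: assumes "entire c" shows "val c holomorphic_on S"
proof -
  have "(val c has_field_derivative val (diffs c) z) (at z)" for z
    using assms unfolding entire_iff val_def[abs_def]
    by (intro termdiffs_strong_converges_everywhere) auto
  then show ?thesis
    unfolding holomorphic_on_def field_differentiable_def
    using has_field_derivative_at_within by blast
qed

lemma higher_deriv_val:
  "entire c \<Longrightarrow> entire ((diffs ^^ j) c) \<and> (deriv ^^ j) (val c) = val ((diffs ^^ j) c)"
  by (induction j) (auto simp: deriv_val entire_diffs)

lemma diffs_pow: "(diffs ^^ j) c n = c (n + j) * fact (n + j) / (fact n :: complex)"
proof (induction j arbitrary: n)
  case (Suc j)
  have "(diffs ^^ Suc j) c n = of_nat (Suc n) * ((diffs ^^ j) c (Suc n))"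
    by (simp add: diffs_def)
  also have "\<dots> = of_nat (Suc n) * (c (Suc n + j) * fact (Suc n + j) / fact (Suc n))"
    by (simp only: Suc)
  also have "\<dots> = c (n + Suc j) * fact (n + Suc j) / fact n"
    by (simp add: divide_simps del: of_nat_Suc)
  finally show ?case .
qed simp

text \<open>Terms with \<open>n < j\<close> vanish through the binomial coefficient, so the index
  stays unshifted and matches the expansion of \<open>(l + N)^n\<close> in
  \<open>pow_shift_expand\<close>.\<close>

lemma taylor_val:
  assumes "entire c"
  shows "(\<lambda>n. c n * (of_nat (n choose j) * z ^ (n - j))) sums ((deriv ^^ j) (val c) z / fact j)"
proof -
  let ?f = "\<lambda>n. c n * (of_nat (n choose j) * z ^ (n - j))"
  have "(\<lambda>n. (diffs ^^ j) c n * z ^ n / fact j) sums ((deriv ^^ j) (val c) z / fact j)"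
    using val_sums[of "(diffs ^^ j) c" z] higher_deriv_val[OF assms, of j]
    by (intro sums_divide) auto
  also have "(\<lambda>n. (diffs ^^ j) c n * z ^ n / fact j) = (\<lambda>n. ?f (n + j))"
    by (auto simp: diffs_pow binomial_fact field_simps)
  finally have "?f sums ((deriv ^^ j) (val c) z / fact j + (\<Sum>i<j. ?f i))"
    by (subst (asm) sums_iff_shift)
  moreover have "(\<Sum>i<j. ?f i) = 0" by (intro sum.neutral) (auto simp: binomial_eq_0)
  ultimately show ?thesis by simp
qed

section \<open>Annihilating products of linear factors and the generalised eigenspaces\<close>

context fd_space begin

abbreviation shift_op :: "('a \<Rightarrow> 'a) \<Rightarrow> complex \<Rightarrow> 'a \<Rightarrow> 'a" where
  "shift_op A l \<equiv> (\<lambda>y. A y - smul l y)"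

lemma endo_shift: "endo A \<Longrightarrow> endo (shift_op A l)"
  by (rule endo_minus[OF _ endo_const_smul])

lemma shift_commute: "endo A \<Longrightarrow> x \<in> V \<Longrightarrow> A (shift_op A l x) = shift_op A l (A x)"
  by (simp add: endo_diff endo_smul)

lemma spectrum_iff:
  assumes "endo A"
  shows "z \<in> spectrum_on smul V A \<longleftrightarrow> (\<exists>v\<in>V. v \<noteq> 0 \<and> A v = smul z v)"
proof -
  let ?B = "\<lambda>v. smul z v - A v"
  have B: "endo ?B" by (rule endo_minus[OF endo_const_smul assms])
  show ?thesis
  proof
    assume "z \<in> spectrum_on smul V A"
    then have "\<not> bij_betw ?B V V" by (simp add: spectrum_on_def)
    then obtain v where "v \<in> V" "?B v = 0" "v \<noteq> 0" using inj_bij[OF B] by blast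
    then show "\<exists>v\<in>V. v \<noteq> 0 \<and> A v = smul z v" by (metis eq_iff_diff_eq_0)
  next
    assume "\<exists>v\<in>V. v \<noteq> 0 \<and> A v = smul z v"
    then obtain v where v: "v \<in> V" "v \<noteq> 0" "?B v = ?B 0" by (auto simp: endo_zero[OF assms])
    then have "\<not> inj_on ?B V" unfolding inj_on_def using V_zero by blast
    then show "z \<in> spectrum_on smul V A" by (simp add: spectrum_on_def bij_betw_def)
  qed
qed

text \<open>An annihilating polynomial in factored form: the list holds its roots with
  multiplicity.\<close>

definition ann :: "('a \<Rightarrow> 'a) \<Rightarrow> complex list \<Rightarrow> 'a \<Rightarrow> 'a" where
  "ann A ls x = foldr (\<lambda>l. shift_op A l) ls x"

lemma ann_simps: "ann A [] x = x" "ann A (l # ls) x = shift_op A l (ann A ls x)"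
  "ann A (ls @ ms) x = ann A ls (ann A ms x)"
  by (auto simp: ann_def)

lemma endo_ann: "endo A \<Longrightarrow> endo (ann A ls)"
proof (induction ls)
  case Nil
  then show ?case by (simp add: endo_def lin_def ann_simps)
next
  case (Cons l ls)
  have "endo (\<lambda>x. shift_op A l (ann A ls x))"
    by (rule endo_comp[OF endo_shift[OF Cons(2)] Cons(1)[OF Cons(2)]])
  then show ?case by (simp add: endo_def lin_def ann_simps)
qed

lemma ann_commute_gen:
  assumes "endo A" "endo C" "\<And>x. x \<in> V \<Longrightarrow> A (C x) = C (A x)" "x \<in> V"
  shows "ann A ls (C x) = C (ann A ls x)"
proof (induction ls)
  case (Cons l ls)
  have "ann A ls x \<in> V" using endo_in[OF endo_ann[OF assms(1)] assms(4)] .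
  then show ?case
    using assms(1-3) by (simp add: ann_simps Cons endo_diff endo_smul)
qed (simp add: ann_simps)

lemma ann_shift: "endo A \<Longrightarrow> x \<in> V \<Longrightarrow> ann A ls (shift_op A l x) = shift_op A l (ann A ls x)"
  by (rule ann_commute_gen[of A "shift_op A l", OF _ endo_shift shift_commute])

definition poly_op :: "('a \<Rightarrow> 'a) \<Rightarrow> complex poly \<Rightarrow> 'a \<Rightarrow> 'a" where
  "poly_op A p x = (\<Sum>i\<le>degree p. smul (coeff p i) ((A ^^ i) x))"

lemma poly_op_le: "degree p \<le> n \<Longrightarrow> poly_op A p x = (\<Sum>i\<le>n. smul (coeff p i) ((A ^^ i) x))"
  unfolding poly_op_def by (rule sum.mono_neutral_left) (auto simp: coeff_eq_0)

lemma poly_op_root_factor: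
  assumes "endo A" "x \<in> V"
  shows "poly_op A ([:- a, 1:] * q) x = poly_op A q (shift_op A a x)"
proof -
  let ?n = "Suc (degree q)"
  have 1: "[:- a, 1:] * q = pCons 0 q - Polynomial.smult a q" by simp
  have "degree ([:- a, 1:] * q) \<le> ?n"
    using degree_mult_le[of "[:- a, 1:]" q] by simp
  then have "poly_op A ([:- a, 1:] * q) x
    = (\<Sum>i\<le>?n. smul (coeff (pCons 0 q) i) ((A ^^ i) x)) - (\<Sum>i\<le>?n. smul (a * coeff q i) ((A ^^ i) x))"
    by (subst poly_op_le) (simp_all only: 1 coeff_diff coeff_smult scale_left_diff_distrib sum_subtractf)
  also have "(\<Sum>i\<le>?n. smul (coeff (pCons 0 q) i) ((A ^^ i) x)) = (\<Sum>i\<le>degree q. smul (coeff q i) ((A ^^ i) (A x)))"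
    by (subst sum.atMost_Suc_shift) (simp add: funpow_swap1)
  also have "(\<Sum>i\<le>?n. smul (a * coeff q i) ((A ^^ i) x)) = (\<Sum>i\<le>degree q. smul (coeff q i) ((A ^^ i) (smul a x)))"
    using assms by (simp add: coeff_eq_0 endo_smul[OF endo_pow[OF assms(1)]] mult.commute)
  finally show ?thesis
    using assms by (simp add: poly_op_def endo_diff[OF endo_pow[OF assms(1)]] scale_right_diff_distrib sum_subtractf)
qed

text \<open>The fundamental theorem of algebra splits off one root at a time; the nonzero constant
  that remains can be cancelled.\<close>

lemma poly_op_ann:
  assumes "endo A" "p \<noteq> 0" "x \<in> V" "poly_op A p x = 0"
  shows "\<exists>ls. ann A ls x = 0"
  using assms(2-)
proof (induction "degree p" arbitrary: p x rule: less_induct)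
  case less
  show ?case
  proof (cases "degree p = 0")
    case True
    then obtain c where p: "p = [:c:]" using degree_eq_zeroE by blast
    then have "smul c x = 0" "c \<noteq> 0" using less by (auto simp: poly_op_def)
    then have "ann A [] x = 0" by (simp add: ann_simps)
    then show ?thesis by blast
  next
    case False
    then have "\<not> constant (poly p)" by (simp add: constant_degree)
    then obtain a where "poly p a = 0" using fundamental_theorem_of_algebra by blast
    then have "[:- a, 1:] dvd p" unfolding poly_eq_0_iff_dvd .
    then obtain q where q: "p = [:- a, 1:] * q" by (rule dvdE)
    have q0: "q \<noteq> 0" using q less(2) by auto
    then have "degree p = Suc (degree q)" unfolding q by (subst degree_mult_eq) auto
    moreover have "poly_op A q (shift_op A a x) = 0"
      using poly_op_root_factor[OF assms(1) less(3)] less(4) q by simp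
    ultimately obtain ls where "ann A ls (shift_op A a x) = 0"
      using less(1)[of q "shift_op A a x"] q0 endo_in[OF endo_shift[OF assms(1)] less(3)] by auto
    then have "ann A (ls @ [a]) x = 0" by (simp add: ann_simps)
    then show ?thesis by blast
  qed
qed

text \<open>The vectors \<open>x, A x, ..., A^n x\<close> with \<open>n\<close> the dimension are
  linearly dependent; the relation is a nonzero polynomial that kills \<open>x\<close>.\<close>

lemma ann_exists1:
  assumes A: "endo A" and x: "x \<in> V"
  shows "\<exists>ls. ann A ls x = 0"
proof -
  let ?n = "card bas" and ?v = "\<lambda>i. (A ^^ i) x"
  have inV: "?v i \<in> V" for i by (rule endo_in[OF endo_pow[OF A] x])
  have "\<exists>c. (\<exists>i\<le>?n. c i \<noteq> 0) \<and> (\<Sum>i\<le>?n. smul (c i) (?v i)) = 0"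
  \<comment> \<open>Linear dependence is a property of sets, so a repetition among the iterates is
    invisible to it and supplies its own relation, with coefficients \<open>1\<close> and
    \<open>-1\<close>.\<close>
  proof (cases "inj_on ?v {..?n}")
    case False
    then obtain i j where ij: "i \<le> ?n" "j \<le> ?n" "i \<noteq> j" "?v i = ?v j" by (auto simp: inj_on_def)
    let ?c = "\<lambda>k. if k = i then 1 else if k = j then - 1 else 0 :: complex"
    have "(\<Sum>k\<le>?n. smul (?c k) (?v k)) = (\<Sum>k\<in>{i, j}. smul (?c k) (?v k))"
      using ij by (intro sum.mono_neutral_right) auto
    also have "\<dots> = 0" using ij by simp
    finally show ?thesis using ij(1) by (intro exI[of _ ?c]) auto
  next
    case True
    have "\<not> independent (?v ` {..?n})"
    proof
      assume "independent (?v ` {..?n})"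
      moreover have "?v ` {..?n} \<subseteq> span bas" using inV bas(3) by blast
      ultimately have "card (?v ` {..?n}) \<le> card bas"
        by (rule independent_span_bound[OF bas(1), THEN conjunct2])
      then show False using True by (simp add: card_image)
    qed
    then obtain u where u: "\<exists>v\<in>?v ` {..?n}. u v \<noteq> 0" "(\<Sum>v\<in>?v ` {..?n}. smul (u v) v) = 0"
      using dependent_finite[of "?v ` {..?n}"] by auto
    then show ?thesis
      by (intro exI[of _ "\<lambda>i. u (?v i)"]) (auto simp: sum.reindex[OF True])
  qed
  then obtain c k where c: "k \<le> ?n" "c k \<noteq> 0" "(\<Sum>i\<le>?n. smul (c i) (?v i)) = 0" by blast
  define p where "p = (\<Sum>i\<le>?n. monom (c i) i)"
  have cf: "coeff p i = (if i \<le> ?n then c i else 0)" for i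
    by (simp add: p_def coeff_sum)
  have "degree p \<le> ?n" by (rule degree_le) (simp add: cf)
  then have "poly_op A p x = (\<Sum>i\<le>?n. smul (coeff p i) (?v i))" by (rule poly_op_le)
  also have "\<dots> = 0" using c(3) by (simp add: cf)
  finally have "poly_op A p x = 0" .
  moreover have "p \<noteq> 0" using c cf[of k] by auto
  ultimately show ?thesis using poly_op_ann[OF A _ x] by blast
qed

lemma ann_ann_commute: "endo A \<Longrightarrow> x \<in> V \<Longrightarrow> ann A ls (ann A ms x) = ann A ms (ann A ls x)"
  by (rule ann_commute_gen[OF _ endo_ann]) (auto intro!: ann_commute_gen[symmetric])

text \<open>The lists of the basis vectors are concatenated; the factors commute, so each list kills
  its own vector at any position.\<close>

lemma ann_exists:
  assumes A: "endo A"
  obtains ls where "\<And>x. x \<in> V \<Longrightarrow> ann A ls x = 0"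
proof -
  have "\<exists>ls. \<forall>b\<in>S. ann A ls b = 0" if "finite S" "S \<subseteq> V" for S
    using that
  proof (induction S rule: finite_induct)
    case (insert b S)
    then obtain ls where ls: "\<forall>b\<in>S. ann A ls b = 0" by auto
    obtain ms where ms: "ann A ms b = 0" using ann_exists1[OF A, of b] insert by auto
    have "ann A (ms @ ls) b = 0"
      using ann_ann_commute[OF A, of b ms ls] insert ms by (simp add: ann_simps endo_zero[OF endo_ann[OF A]])
    moreover have "ann A (ms @ ls) b' = 0" if "b' \<in> S" for b'
      using that ls by (simp add: ann_simps endo_zero[OF endo_ann[OF A]])
    ultimately show ?case by blast
  qed auto
  then obtain ls where ls: "\<forall>b\<in>bas. ann A ls b = 0" using bas(1) by (metis bas_in subsetI)
  have "ann A ls x = 0" if "x \<in> V" for x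
    using ls endo_expand[OF endo_ann[OF A] that] by simp
  then show ?thesis using that by blast
qed

text \<open>On an eigenvector with eigenvalue \<open>z\<close> the annihilating product acts as the
  scalar product of the \<open>z - l\<close>, so \<open>z\<close> must be one of the roots.\<close>

lemma finite_spectrum:
  assumes A: "endo A" shows "finite (spectrum_on smul V A)"
proof -
  obtain ls where ls: "\<And>x. x \<in> V \<Longrightarrow> ann A ls x = 0" using ann_exists[OF A] by blast
  have "z \<in> set ls" if z: "z \<in> spectrum_on smul V A" for z
  proof (rule ccontr)
    assume n: "z \<notin> set ls"
    obtain v where v: "v \<in> V" "v \<noteq> 0" "A v = smul z v" using z spectrum_iff[OF A] by auto
    have "ann A ms v = smul (\<Prod>l\<leftarrow>ms. z - l) v" for ms
    proof (induction ms)
      case (Cons l ms)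
      show ?case
        by (simp add: ann_simps Cons endo_smul[OF A v(1)] v(3) left_diff_distrib mult_ac
            scale_left_diff_distrib)
    qed (simp add: ann_simps)
    with ls[OF v(1)] have "smul (\<Prod>l\<leftarrow>ls. z - l) v = 0" by metis
    then have "(\<Prod>l\<leftarrow>ls. z - l) = 0" using v(2) by simp
    then show False using n by (auto simp: prod_list_zero_iff)
  qed
  then show ?thesis by (meson List.finite_set finite_subset subsetI)
qed

text \<open>The kernel of \<open>d(A)\<close> is invariant under \<open>A\<close>. Going down an
  annihilating list, a kernel vector reduces to one with \<open>A x = l x\<close>, on which the
  series acts as the nonzero scalar \<open>val d l\<close>.\<close>

lemma bij_pser:
  assumes A: "endo A" and d: "entire d"
    and nz: "\<And>l. l \<in> spectrum_on smul V A \<Longrightarrow> val d l \<noteq> 0"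
  shows "bij_betw (pser d A) V V"
proof (rule inj_bij[OF endo_pser[OF A d]])
  obtain ls where ls: "\<And>x. x \<in> V \<Longrightarrow> ann A ls x = 0" using ann_exists[OF A] by blast
  have "x = 0" if "x \<in> V" "pser d A x = 0" "ann A ms x = 0" for ms x
    using that
  proof (induction ms arbitrary: x)
    case (Cons l ms)
    have N: "shift_op A l x \<in> V" by (rule endo_in[OF endo_shift[OF A] Cons.prems(1)])
    have "pser d A (shift_op A l x) = shift_op A l (pser d A x)"
      by (rule pser_commute[OF A A endo_shift[OF A] shift_commute[OF A] Cons.prems(1) d])
    then have "pser d A (shift_op A l x) = 0" using Cons.prems(2) by (simp add: endo_zero[OF A])
    moreover have "ann A ms (shift_op A l x) = 0"
      using Cons.prems(3) ann_shift[OF A Cons.prems(1)] by (simp add: ann_simps)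
    ultimately have "shift_op A l x = 0" using Cons.IH[OF N] by blast
    then have Ax: "A x = smul l x" by simp
    have pw: "(A ^^ n) x = smul (l ^ n) x" for n
      by (induction n) (auto simp: endo_smul[OF A Cons.prems(1)] Ax mult.commute)
    have "pser d A x = smul (val d l) x"
      unfolding pser_def
    proof (rule psum_eqI)
      fix \<phi> assume \<phi>: "\<phi> \<in> dual"
      show "(\<lambda>n. d n * \<phi> ((A ^^ n) x)) sums \<phi> (smul (val d l) x)"
        using sums_mult2[OF val_sums[OF d, of l], of "\<phi> x"]
        by (simp add: pw functional_smul[OF \<phi>] mult.assoc)
    qed
    then have "val d l = 0 \<or> x = 0" using Cons.prems(2) by simp
    moreover have "x \<noteq> 0 \<Longrightarrow> l \<in> spectrum_on smul V A"
      using spectrum_iff[OF A] Cons.prems(1) Ax by blast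
    ultimately show ?case using nz by blast
  qed (simp add: ann_simps)
  then show "\<And>x. x \<in> V \<Longrightarrow> pser d A x = 0 \<Longrightarrow> x = 0" using ls by blast
qed

text \<open>The union over all \<open>l\<close>, hence in general not a subspace; only its span
  matters.\<close>

definition gen_eigen :: "('a \<Rightarrow> 'a) \<Rightarrow> 'a set" where
  "gen_eigen A = {x\<in>V. \<exists>l k. (shift_op A l ^^ k) x = 0}"

text \<open>Off the eigenvalue \<open>l\<close> the operator \<open>A - l\<close> is onto the
  generalised eigenspace. If \<open>z'\<close> solves the equation for \<open>(A - m) y\<close>,
  which needs one power less, then \<open>(y - z')/(m - l)\<close> solves it for \<open>y\<close>,
  since \<open>(A - l) y - (A - m) y = (m - l) y\<close>.\<close>

lemma gen_eigen_solve:
  assumes A: "endo A" and "m \<noteq> l" "y \<in> V" "(shift_op A m ^^ k) y = 0"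
  shows "\<exists>z\<in>V. (shift_op A m ^^ k) z = 0 \<and> shift_op A l z = y"
  using assms(3,4)
proof (induction k arbitrary: y)
  case 0
  then show ?case by (intro bexI[of _ 0]) (auto simp: endo_zero[OF A])
next
  case (Suc k)
  let ?M = "shift_op A m"
  note M = endo_shift[OF A, of m] and L = endo_shift[OF A, of l]
  have "?M y \<in> V" "(?M ^^ k) (?M y) = 0"
    using endo_in[OF M Suc.prems(1)] Suc.prems(2) by (simp, simp only: funpow_Suc_right comp_def)
  then obtain z' where z': "z' \<in> V" "(?M ^^ k) z' = 0" "shift_op A l z' = ?M y"
    using Suc.IH by blast
  define z where "z = smul (1 / (m - l)) (y - z')"
  have "(?M ^^ Suc k) z = smul (1 / (m - l)) ((?M ^^ Suc k) y - (?M ^^ Suc k) z')"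
    unfolding z_def using Suc.prems z' by (simp only: endo_smul[OF endo_pow[OF M]] endo_diff[OF endo_pow[OF M]] V_diff)
  also have "(?M ^^ Suc k) z' = 0" using z' by (simp add: endo_zero[OF A])
  finally have "(?M ^^ Suc k) z = 0" using Suc.prems by simp
  moreover have "shift_op A l z = smul (1 / (m - l)) (shift_op A l y - ?M y)"
    unfolding z_def using Suc.prems z' by (simp only: endo_smul[OF L] endo_diff[OF L] V_diff)
  then have "shift_op A l z = smul (1 / (m - l)) (smul (m - l) y)"
    by (simp add: scale_left_diff_distrib)
  then have "shift_op A l z = y" using assms(2) by simp
  moreover have "z \<in> V" using Suc.prems z' by (simp add: z_def)
  ultimately show ?case by blast
qed

lemma pow_zero_mono:
  assumes "endo A" "(A ^^ k) x = 0" "k \<le> n" shows "(A ^^ n) x = 0"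
proof -
  have "(A ^^ n) x = (A ^^ (n - k)) ((A ^^ k) x)"
    using assms(3) by (simp flip: funpow_add[THEN fun_cong, unfolded comp_def])
  then show ?thesis using assms by (simp add: endo_zero[OF endo_pow])
qed

text \<open>The primary decomposition, proved by induction along a list of roots instead of through
  coprime polynomials.\<close>

lemma span_gen_eigen:
  assumes A: "endo A" shows "span (gen_eigen A) = V"
proof
  have "gen_eigen A \<subseteq> V" by (auto simp: gen_eigen_def)
  then show "span (gen_eigen A) \<subseteq> V" using span_minimal subspace_V by blast
  let ?S = "span (gen_eigen A)"
  have SV: "y \<in> V" if "y \<in> ?S" for y using that \<open>?S \<subseteq> V\<close> by blast
  \<comment> \<open>Modulo the image of the span under \<open>A - l\<close>, only the generalised
    eigenspace of \<open>l\<close> survives; on all others \<open>A - l\<close> can be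
    solved.\<close>
  have key: "\<exists>u\<in>?S. \<exists>y'\<in>V. (\<exists>k. (shift_op A l ^^ k) y' = 0) \<and> shift_op A l u + y' = y"
    if "y \<in> ?S" for y l
  proof -
    note L = endo_shift[OF A, of l]
    let ?T = "{y. \<exists>u\<in>?S. \<exists>y'\<in>V. (\<exists>k. (shift_op A l ^^ k) y' = 0) \<and> shift_op A l u + y' = y}"
    have "subspace ?T"
    proof (rule subspaceI)
      show "0 \<in> ?T"
        using span_zero V_zero endo_zero[OF L] by (auto intro!: bexI[of _ 0] exI[of _ 0])
    next
      fix x y assume "x \<in> ?T" "y \<in> ?T"
      then obtain u x' k u2 y' k2 where h: "u \<in> ?S" "x' \<in> V" "(shift_op A l ^^ k) x' = 0" "shift_op A l u + x' = x"
        "u2 \<in> ?S" "y' \<in> V" "(shift_op A l ^^ k2) y' = 0" "shift_op A l u2 + y' = y" by blast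
      have "(shift_op A l ^^ (max k k2)) (x' + y') = 0"
        using h pow_zero_mono[OF L h(3), of "max k k2"] pow_zero_mono[OF L h(7), of "max k k2"]
        by (simp only: endo_add[OF endo_pow[OF L]]) simp
      moreover have "shift_op A l (u + u2) + (x' + y') = x + y"
        using h SV by (simp add: endo_add[OF L] algebra_simps flip: h(4,8)) (simp add: endo_add[OF A] SV scale_right_distrib algebra_simps)
      moreover have "u + u2 \<in> ?S" using h by (simp add: span_add)
      moreover have "x' + y' \<in> V" using h by simp
      ultimately show "x + y \<in> ?T" by blast
    next
      fix c x assume "x \<in> ?T"
      then obtain u x' k where h: "u \<in> ?S" "x' \<in> V" "(shift_op A l ^^ k) x' = 0" "shift_op A l u + x' = x" by blast
      have "(shift_op A l ^^ k) (smul c x') = 0"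
        using h by (simp only: endo_smul[OF endo_pow[OF L]]) simp
      moreover have "shift_op A l (smul c u) + smul c x' = smul c x"
      proof -
        have "shift_op A l (smul c u) = smul c (shift_op A l u)" by (rule endo_smul[OF L SV[OF h(1)]])
        then show ?thesis using h(4) by (simp only: scale_right_distrib[symmetric])
      qed
      moreover have "smul c u \<in> ?S" using h by (simp add: span_scale)
      moreover have "smul c x' \<in> V" using h by simp
      ultimately show "smul c x \<in> ?T" by blast
    qed
    moreover have "gen_eigen A \<subseteq> ?T"
    proof
      fix g assume g: "g \<in> gen_eigen A"
      then obtain m k where m: "g \<in> V" "(shift_op A m ^^ k) g = 0" by (auto simp: gen_eigen_def)
      show "g \<in> ?T"
      proof (cases "m = l")
        case True
        have "shift_op A l 0 + g = g" by (simp add: endo_zero[OF A])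
        then show ?thesis using True m span_zero[of "gen_eigen A"] by blast
      next
        case False
        obtain z where z: "z \<in> V" "(shift_op A m ^^ k) z = 0" "shift_op A l z = g"
          using gen_eigen_solve[OF A False m] by blast
        then have "z \<in> ?S" by (auto simp: gen_eigen_def intro!: span_base)
        moreover have "shift_op A l z + 0 = g" using z by simp
        moreover have "(shift_op A l ^^ 0) 0 = 0" by simp
        ultimately show ?thesis using V_zero by blast
      qed
    qed
    ultimately have "?S \<subseteq> ?T" by (intro span_minimal)
    then show ?thesis using that by blast
  qed
  have main: "x \<in> ?S" if "x \<in> V" "ann A ls x = 0" for ls x
    using that
  proof (induction ls arbitrary: x)
    case (Cons l ls)
    note L = endo_shift[OF A, of l]
    have "ann A ls (shift_op A l x) = 0"
      using Cons.prems(2) ann_shift[OF A Cons.prems(1)] by (simp add: ann_simps)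
    then have "shift_op A l x \<in> ?S" using Cons.IH[OF endo_in[OF L Cons.prems(1)]] by blast
    from key[OF this, of l] obtain u y' k where h: "u \<in> ?S" "y' \<in> V" "(shift_op A l ^^ k) y' = 0"
        "shift_op A l u + y' = shift_op A l x" by blast
    \<comment> \<open>Correcting \<open>x\<close> by \<open>u\<close> leaves a vector that one more
      power of \<open>A - l\<close> kills, that is, a generalised eigenvector.\<close>
    have "shift_op A l (x - u) = shift_op A l x - shift_op A l u"
      by (rule endo_diff[OF L Cons.prems(1) SV[OF h(1)]])
    also have "\<dots> = y'" unfolding h(4)[symmetric] by simp
    finally have "(shift_op A l ^^ Suc k) (x - u) = 0"
      using h(3) by (simp only: funpow_Suc_right comp_def)
    then have "x - u \<in> ?S"
      using Cons.prems(1) SV[OF h(1)] V_diff unfolding gen_eigen_def by (intro span_base) blast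
    then have "u + (x - u) \<in> ?S" using h(1) by (intro span_add)
    then show ?case by simp
  qed (simp add: ann_simps span_zero)
  show "V \<subseteq> ?S"
  proof
    fix x assume "x \<in> V"
    then show "x \<in> ?S" using ann_exists1[OF A] main by blast
  qed
qed

end

section \<open>The contour integral calculus\<close>

lemma sum_list_sum_swap:
  "(\<Sum>\<gamma>\<leftarrow>\<Gamma>. \<Sum>p\<in>P. g \<gamma> p) = (\<Sum>p\<in>P. \<Sum>\<gamma>\<leftarrow>\<Gamma>. g \<gamma> p)"
  by (induction \<Gamma>) (simp_all add: sum.distrib)

text \<open>One circle around each point of \<open>S\<close>, with a closed disc inside
  \<open>U\<close> that misses the other points. This makes the choice in
  \<open>holomorphic_calculus\<close> an actual contour.\<close>

lemma encircling_contour_exists: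
  assumes "finite S" "open U" "S \<subseteq> U"
  obtains \<Gamma> where "encircling_contour U S \<Gamma>"
proof -
  have "\<exists>e>0. cball l e \<subseteq> U - (S - {l})" if "l \<in> S" for l
  proof -
    have "open (U - (S - {l}))" using assms by (intro open_Diff finite_imp_closed) auto
    moreover have "l \<in> U - (S - {l})" using assms that by auto
    ultimately show ?thesis unfolding open_contains_cball by blast
  qed
  then obtain e where e: "\<And>l. l \<in> S \<Longrightarrow> e l > 0" "\<And>l. l \<in> S \<Longrightarrow> cball l (e l) \<subseteq> U - (S - {l})"
    by metis
  obtain L where L: "set L = S" "distinct L" using finite_distinct_list[OF assms(1)] by blast
  have out: "winding_number (circlepath l (e l)) z = 0" if "l \<in> S" "z \<notin> cball l (e l)" for l z
    using that e(1)[OF that(1)]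
    by (intro winding_number_zero_outside[of _ "cball l (e l)"]) auto
  define \<Gamma> where "\<Gamma> = map (\<lambda>l. circlepath l (e l)) L"
  have "path_image (circlepath l (e l)) \<subseteq> U - S" if "l \<in> S" for l
  proof -
    have "path_image (circlepath l (e l)) \<subseteq> cball l (e l) - {l}"
      using e(1)[OF that] by (auto simp: sphere_def)
    then show ?thesis using e(2)[OF that] by blast
  qed
  moreover have "(\<Sum>\<gamma>\<leftarrow>\<Gamma>. winding_number \<gamma> z) = 1" if "z \<in> S" for z
  proof -
    have "(\<Sum>\<gamma>\<leftarrow>\<Gamma>. winding_number \<gamma> z) = (\<Sum>l\<in>S. winding_number (circlepath l (e l)) z)"
      unfolding \<Gamma>_def using L by (simp add: comp_def sum_list_distinct_conv_sum_set)
    also have "\<dots> = (\<Sum>l\<in>{z}. winding_number (circlepath l (e l)) z)"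
    proof (intro sum.mono_neutral_right assms ballI out)
      fix l assume "l \<in> S - {z}"
      then show "l \<in> S" "z \<notin> cball l (e l)" using e(2)[of l] that by auto
    qed (use that in auto)
    also have "\<dots> = 1" using e(1)[OF that] by (simp add: winding_number_circlepath_centre)
    finally show ?thesis .
  qed
  moreover have "(\<Sum>\<gamma>\<leftarrow>\<Gamma>. winding_number \<gamma> z) = 0" if "z \<notin> U" for z
  proof -
    have "(\<Sum>\<gamma>\<leftarrow>\<Gamma>. winding_number \<gamma> z) = (\<Sum>l\<in>S. winding_number (circlepath l (e l)) z)"
      unfolding \<Gamma>_def using L by (simp add: comp_def sum_list_distinct_conv_sum_set)
    also have "\<dots> = 0"
    proof (intro sum.neutral ballI out)
      fix l assume "l \<in> S"
      then show "z \<notin> cball l (e l)" using e(2)[of l] that by blast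
    qed
    finally show ?thesis .
  qed
  ultimately have "encircling_contour U S \<Gamma>"
    unfolding encircling_contour_def \<Gamma>_def using L by auto
  then show ?thesis by (rule that)
qed

text \<open>
  Only the sum of the winding numbers over the cycle vanishes outside \<open>U\<close>. So the residue theorem is
  applied to each path in a large ball, with all points outside \<open>U\<close> counted as singularities.
\<close>

lemma cycle_integral_power:
  assumes \<Gamma>: "encircling_contour U S \<Gamma>" and U: "open U" and H: "H holomorphic_on U"
    and discrete: "\<And>r. finite (- U \<inter> ball 0 r)" and l: "l \<in> S" "l \<in> U"
  shows "(\<Sum>\<gamma>\<leftarrow>\<Gamma>. contour_integral \<gamma> (\<lambda>z. H z / (z - l) ^ Suc j))
          = 2 * of_real pi * \<i> * ((deriv ^^ j) H l / fact j)"
    and "\<And>\<gamma>. \<gamma> \<in> set \<Gamma> \<Longrightarrow> (\<lambda>z. H z / (z - l) ^ Suc j) contour_integrable_on \<gamma>"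
proof -
  let ?f = "\<lambda>z. H z / (z - l) ^ Suc j"
  have \<gamma>: "valid_path \<gamma>" "pathfinish \<gamma> = pathstart \<gamma>" "path_image \<gamma> \<subseteq> U - S" if "\<gamma> \<in> set \<Gamma>" for \<gamma>
    using \<Gamma> that by (auto simp: encircling_contour_def)
  have holo: "?f holomorphic_on (U - {l})"
    using H by (intro holomorphic_intros) (auto intro: holomorphic_on_subset)
  show "?f contour_integrable_on \<gamma>" if "\<gamma> \<in> set \<Gamma>" for \<gamma>
    using \<gamma>[OF that] U l by (intro contour_integrable_holomorphic_simple[OF holo]) auto
  have "bounded (insert l (\<Union>\<gamma>\<in>set \<Gamma>. path_image \<gamma>))"
    using \<gamma>(1) by (auto intro!: bounded_Union compact_imp_bounded compact_path_image valid_path_imp_path)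
  then obtain r where r: "insert l (\<Union>\<gamma>\<in>set \<Gamma>. path_image \<gamma>) \<subseteq> ball 0 r"
    by (meson bounded_subset_ballD)
  define P where "P = insert l (- U \<inter> ball 0 r)"
  have P: "finite P" using discrete by (simp add: P_def)
  have ci: "contour_integral \<gamma> ?f = 2 * of_real pi * \<i> * (\<Sum>p\<in>P. winding_number \<gamma> p * residue ?f p)"
    if g: "\<gamma> \<in> set \<Gamma>" for \<gamma>
  proof -
    have 1: "?f holomorphic_on (ball 0 r - P)"
      by (rule holomorphic_on_subset[OF holo]) (auto simp: P_def)
    have 2: "path_image \<gamma> \<subseteq> ball 0 r - P" using \<gamma>(3)[OF g] r g l by (auto simp: P_def)
    have 3: "\<forall>z. z \<notin> ball 0 r \<longrightarrow> winding_number \<gamma> z = 0"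
      using \<gamma>[OF g] r g
      by (intro allI impI winding_number_zero_outside[of _ "ball 0 r"]) (auto intro: valid_path_imp_path)
    show ?thesis
      using Residue_theorem[OF open_ball connected_ball P 1 \<gamma>(1,2)[OF g] 2 3] by simp
  qed
  have "(\<Sum>\<gamma>\<leftarrow>\<Gamma>. contour_integral \<gamma> ?f)
      = (\<Sum>\<gamma>\<leftarrow>\<Gamma>. \<Sum>p\<in>P. 2 * of_real pi * \<i> * (winding_number \<gamma> p * residue ?f p))"
    by (rule arg_cong[of _ _ sum_list], rule map_cong[OF refl]) (simp only: ci sum_distrib_left)
  also have "\<dots> = (\<Sum>p\<in>P. 2 * of_real pi * \<i> * (\<Sum>\<gamma>\<leftarrow>\<Gamma>. winding_number \<gamma> p) * residue ?f p)"
    unfolding sum_list_sum_swap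
    by (intro sum.cong refl) (simp add: sum_list_const_mult sum_list_mult_const mult.assoc)
  also have "\<dots> = (\<Sum>p\<in>{l}. 2 * of_real pi * \<i> * (\<Sum>\<gamma>\<leftarrow>\<Gamma>. winding_number \<gamma> p) * residue ?f p)"
    using \<Gamma> P by (intro sum.mono_neutral_right) (auto simp: P_def encircling_contour_def)
  also have "\<dots> = 2 * of_real pi * \<i> * residue ?f l"
    using \<Gamma> l by (simp add: encircling_contour_def)
  also have "residue ?f l = (deriv ^^ j) H l / fact j"
    by (rule residue_holomorphic_over_power[OF U l(2) H])
  finally show "(\<Sum>\<gamma>\<leftarrow>\<Gamma>. contour_integral \<gamma> ?f) = 2 * of_real pi * \<i> * ((deriv ^^ j) H l / fact j)" .
qed

context fd_space begin

text \<open>The binomial theorem for \<open>A = l + N\<close>, cut off at \<open>k\<close> because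
  \<open>N^k x = 0\<close>.\<close>

lemma pow_shift_expand:
  assumes A: "endo A" and x: "x \<in> V" and k: "(shift_op A l ^^ k) x = 0"
  shows "(A ^^ n) x = (\<Sum>j<k. smul (of_nat (n choose j) * l ^ (n - j)) ((shift_op A l ^^ j) x))"
proof (induction n)
  case 0
  show ?case
  proof (cases k)
    case (Suc k')
    then show ?thesis by (subst lessThan_Suc_atMost[of k', folded Suc], subst sum.atMost_shift) (simp add: binomial_eq_0)
  qed (use k in simp)
next
  case (Suc n)
  let ?N = "shift_op A l" and ?v = "\<lambda>j. (shift_op A l ^^ j) x"
  have vV: "?v j \<in> V" for j by (rule endo_in[OF endo_pow[OF endo_shift[OF A]] x])
  have Av: "A (?v j) = ?v (Suc j) + smul l (?v j)" for j by simp
  let ?c = "\<lambda>n j. of_nat (n choose j) * l ^ (n - j)"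
  have "(A ^^ Suc n) x = A (\<Sum>j<k. smul (?c n j) (?v j))" by (simp only: funpow.simps comp_def Suc)
  also have "\<dots> = (\<Sum>j<k. smul (?c n j) (?v (Suc j))) + (\<Sum>j<k. smul (?c n j * l) (?v j))"
    using vV by (simp only: endo_sum[OF A V_smul[OF vV]] endo_smul[OF A vV] Av scale_right_distrib sum.distrib scale_scale)
  also have "\<dots> = (\<Sum>j<k. smul (?c (Suc n) j) (?v j))"
  proof (cases k)
    case (Suc k')
    have "(\<Sum>j<k. smul (?c n j) (?v (Suc j))) = (\<Sum>j<k'. smul (?c n j) (?v (Suc j)))"
      unfolding Suc using k[unfolded Suc] by simp
    moreover have "(\<Sum>j<k. smul (?c n j * l) (?v j)) = smul (l ^ Suc n) x + (\<Sum>j<k'. smul (?c n (Suc j) * l) (?v (Suc j)))"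
      unfolding Suc by (subst sum.lessThan_Suc_shift) (simp add: mult.commute)
    moreover have "(\<Sum>j<k. smul (?c (Suc n) j) (?v j)) = smul (l ^ Suc n) x + (\<Sum>j<k'. smul (?c (Suc n) (Suc j)) (?v (Suc j)))"
      unfolding Suc by (subst sum.lessThan_Suc_shift) simp
    moreover have "?c (Suc n) (Suc j) = ?c n j + ?c n (Suc j) * l" for j
    proof (cases "Suc j \<le> n")
      case True
      then have "l ^ (n - j) = l ^ (n - Suc j) * l" by (simp add: Suc_diff_Suc power_Suc2[symmetric] del: power_Suc)
      then show ?thesis by (simp add: algebra_simps)
    qed (simp add: binomial_eq_0)
    ultimately show ?thesis
      by (simp only: scale_left_distrib sum.distrib) (simp add: algebra_simps)
  qed simp
  finally show ?case .
qed

text \<open>Summing the binomial expansions over \<open>n\<close> collects, at each power of the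
  nilpotent part, the Taylor coefficient of the series at \<open>l\<close>.\<close>

lemma pser_gen_eigen:
  assumes A: "endo A" and x: "x \<in> V" and k: "(shift_op A l ^^ k) x = 0" and c: "entire c"
  shows "pser c A x = (\<Sum>j<k. smul ((deriv ^^ j) (val c) l / fact j) ((shift_op A l ^^ j) x))"
  unfolding pser_def
proof (rule psum_eqI)
  fix \<phi> assume \<phi>: "\<phi> \<in> dual"
  let ?v = "\<lambda>j. (shift_op A l ^^ j) x"
  have "(\<lambda>n. \<Sum>j<k. c n * (of_nat (n choose j) * l ^ (n - j)) * \<phi> (?v j)) sums
      (\<Sum>j<k. (deriv ^^ j) (val c) l / fact j * \<phi> (?v j))"
    by (intro sums_sum sums_mult2 taylor_val c)
  then show "(\<lambda>n. c n * \<phi> ((A ^^ n) x)) sums \<phi> (\<Sum>j<k. smul ((deriv ^^ j) (val c) l / fact j) (?v j))"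
    unfolding pow_shift_expand[OF A x k]
    by (simp add: functional_sum[OF \<phi>] functional_smul[OF \<phi>] sum_distrib_left mult.assoc)
qed

text \<open>Taylor coefficients at \<open>l\<close> are multiplicative by Leibniz' rule, so
  \<open>H * val d = val c\<close> carries over to the truncated Taylor sums in the nilpotent
  part.\<close>

lemma quo_gen_eigen:
  assumes A: "endo A" and x: "x \<in> V" and k: "(shift_op A l ^^ k) x = 0"
    and cd: "entire c" "entire d" and bij: "bij_betw (pser d A) V V"
    and U: "open U" "l \<in> U" and H: "H holomorphic_on U" "\<And>z. z \<in> U \<Longrightarrow> H z * val d z = val c z"
  shows "quo c d V A x = (\<Sum>j<k. smul ((deriv ^^ j) H l / fact j) ((shift_op A l ^^ j) x))"
proof (rule quo_eqI[OF A cd bij x])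
  let ?v = "\<lambda>j. (shift_op A l ^^ j) x"
  define h where "h j = (deriv ^^ j) H l / fact j" for j
  define q where "q j = (deriv ^^ j) (val d) l / fact j" for j
  have vV: "?v j \<in> V" for j by (rule endo_in[OF endo_pow[OF endo_shift[OF A]] x])
  show wV: "(\<Sum>j<k. smul ((deriv ^^ j) H l / fact j) (?v j)) \<in> V" using vV by (intro V_sum V_smul)
  have vv: "(shift_op A l ^^ i) (?v j) = ?v (i + j)" for i j
    by (simp only: funpow_add comp_def)
  have v0: "?v i = 0" if "k \<le> i" for i by (rule pow_zero_mono[OF endo_shift[OF A] k that])
  have leib: "(deriv ^^ n) (val c) l / fact n = (\<Sum>i\<le>n. q i * h (n - i))" for n
  proof -
    have "(deriv ^^ n) (val c) l = (deriv ^^ n) (\<lambda>z. val d z * H z) l"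
    proof (rule higher_deriv_transform_within_open[OF _ _ U(1,2)])
      show "val c holomorphic_on U" "(\<lambda>z. val d z * H z) holomorphic_on U"
        using val_holomorphic cd H(1) by (auto intro!: holomorphic_intros)
    qed (simp add: H(2)[symmetric] mult.commute)
    also have "\<dots> = (\<Sum>i=0..n. of_nat (n choose i) * (deriv ^^ i) (val d) l * (deriv ^^ (n - i)) H l)"
      by (rule higher_deriv_mult[OF val_holomorphic[OF cd(2)] H(1) U])
    finally have "(deriv ^^ n) (val c) l / fact n
        = (\<Sum>i\<le>n. of_nat (n choose i) * (deriv ^^ i) (val d) l * (deriv ^^ (n - i)) H l / fact n)"
      by (simp only: sum_divide_distrib atLeast0AtMost)
    also have "\<dots> = (\<Sum>i\<le>n. q i * h (n - i))"
      by (rule sum.cong) (simp_all add: q_def h_def binomial_fact field_simps)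
    finally show ?thesis .
  qed
  have "pser d A (\<Sum>j<k. smul (h j) (?v j)) = (\<Sum>j<k. smul (h j) (pser d A (?v j)))"
    using vV by (simp only: endo_sum[OF endo_pser[OF A cd(2)] V_smul[OF vV]] endo_smul[OF endo_pser[OF A cd(2)] vV])
  also have "\<dots> = (\<Sum>j<k. smul (h j) (\<Sum>i<k. smul (q i) (?v (i + j))))"
  proof (rule sum.cong[OF refl])
    fix j
    have "(shift_op A l ^^ k) (?v j) = 0" unfolding vv by (rule v0) simp
    from pser_gen_eigen[OF A vV this cd(2)]
    show "smul (h j) (pser d A (?v j)) = smul (h j) (\<Sum>i<k. smul (q i) (?v (i + j)))"
      unfolding vv q_def by simp
  qed
  finally have 1: "pser d A (\<Sum>j<k. smul (h j) (?v j)) = (\<Sum>j<k. \<Sum>i<k. smul (h j * q i) (?v (i + j)))"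
    by (simp only: scale_sum_right scale_scale)
  have "pser c A x = (\<Sum>n<k. \<Sum>i\<le>n. smul (q i * h (n - i)) (?v n))"
    unfolding pser_gen_eigen[OF A x k cd(1)] leib scale_sum_left ..
  also have "\<dots> = (\<Sum>n<k. \<Sum>i\<le>n. smul (h (n - i) * q i) (?v (i + (n - i))))"
    by (intro sum.cong refl) (simp add: mult.commute)
  also have "\<dots> = (\<Sum>(i, j)\<in>{(i, j). i + j < k}. smul (h j * q i) (?v (i + j)))"
    by (rule sum.triangle_reindex[symmetric])
  \<comment> \<open>The triangle \<open>i + j < k\<close> may be enlarged to the square, since the
    vectors with \<open>i + j \<ge> k\<close> are zero.\<close>
  also have "\<dots> = (\<Sum>(i, j)\<in>{..<k} \<times> {..<k}. smul (h j * q i) (?v (i + j)))"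
  proof (intro sum.mono_neutral_left ballI)
    fix p assume "p \<in> {..<k} \<times> {..<k} - {(i, j). i + j < k}"
    then obtain i j where "p = (i, j)" "k \<le> i + j" by auto
    then show "(case p of (i, j) \<Rightarrow> smul (h j * q i) (?v (i + j))) = 0" by (simp add: v0)
  qed auto
  also have "\<dots> = (\<Sum>i<k. \<Sum>j<k. smul (h j * q i) (?v (i + j)))"
    by (rule sum.cartesian_product[symmetric])
  also have "\<dots> = (\<Sum>j<k. \<Sum>i<k. smul (h j * q i) (?v (i + j)))"
    by (rule sum.swap)
  finally show "pser d A (\<Sum>j<k. smul ((deriv ^^ j) H l / fact j) (?v j)) = pser c A x"
    using 1 by (simp add: h_def)
qed

text \<open>The Neumann series of \<open>(z - l) - N\<close>, finite because \<open>N\<close> is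
  nilpotent on \<open>x\<close>; multiplied out, it telescopes.\<close>

lemma resolvent_gen_eigen:
  assumes A: "endo A" and x: "x \<in> V" and k: "(shift_op A l ^^ k) x = 0"
    and z: "z \<notin> spectrum_on smul V A" "z \<noteq> l"
  shows "resolvent_on smul V A z x = (\<Sum>j<k. smul (1 / (z - l) ^ Suc j) ((shift_op A l ^^ j) x))"
proof -
  let ?B = "\<lambda>v. smul z v - A v" and ?v = "\<lambda>j. (shift_op A l ^^ j) x"
  have B: "endo ?B" by (rule endo_minus[OF endo_const_smul A])
  have bij: "bij_betw ?B V V" using z by (simp add: spectrum_on_def)
  have vV: "?v j \<in> V" for j by (rule endo_in[OF endo_pow[OF endo_shift[OF A]] x])
  let ?w = "\<Sum>j<k. smul (1 / (z - l) ^ Suc j) (?v j)"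
  have Bv: "?B (?v j) = smul (z - l) (?v j) - ?v (Suc j)" for j
    by (simp add: scale_left_diff_distrib)
  have "?B ?w = (\<Sum>j<k. smul (1 / (z - l) ^ Suc j) (smul (z - l) (?v j) - ?v (Suc j)))"
    by (simp only: endo_sum[OF B V_smul[OF vV]] endo_smul[OF B vV] Bv)
  also have "\<dots> = (\<Sum>j<k. smul (1 / (z - l) ^ j) (?v j) - smul (1 / (z - l) ^ Suc j) (?v (Suc j)))"
    using z(2) by (intro sum.cong refl) (simp add: scale_right_diff_distrib)
  also have "\<dots> = smul (1 / (z - l) ^ 0) (?v 0) - smul (1 / (z - l) ^ k) (?v k)"
    by (rule sum_lessThan_telescope')
  also have "\<dots> = x" using k by simp
  finally have x: "?B ?w = x" .
  have "?w \<in> V" using vV by (intro V_sum V_smul)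
  from inv_left[OF B bij this] show ?thesis unfolding resolvent_on_def x .
qed

text \<open>Both sides are linear in \<open>x\<close>, so generalised eigenvectors suffice. There
  the resolvent is a finite sum of powers \<open>1/(z - l)^(j+1)\<close>, and the residue theorem
  returns the Taylor coefficients of \<open>H\<close>, as in \<open>quo_gen_eigen\<close>.\<close>

lemma holomorphic_calculus_quo:
  assumes A: "endo A" and cd: "entire c" "entire d"
    and U: "open U" "\<And>r. finite (- U \<inter> ball 0 r)" and spec: "spectrum_on smul V A \<subseteq> U"
    and H: "H holomorphic_on U" "\<And>z. z \<in> U \<Longrightarrow> H z * val d z = val c z"
    and bij: "bij_betw (pser d A) V V" and x: "x \<in> V"
  shows "holomorphic_calculus smul U H V A x = quo c d V A x"
proof -
  let ?S = "spectrum_on smul V A" and ?r = "resolvent_on smul V A" and ?Q = "quo c d V A"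
  define \<Gamma> where "\<Gamma> = (SOME \<Gamma>. encircling_contour U ?S \<Gamma>)"
  have \<Gamma>: "encircling_contour U ?S \<Gamma>"
    unfolding \<Gamma>_def using encircling_contour_exists[OF finite_spectrum[OF A] U(1) spec] by (metis someI_ex)
  have path: "path_image \<gamma> \<subseteq> U - ?S" if "\<gamma> \<in> set \<Gamma>" for \<gamma>
    using \<Gamma> that by (auto simp: encircling_contour_def)
  let ?i = "\<lambda>y \<gamma> v. \<forall>\<phi>\<in>dual. ((\<lambda>z. \<phi> (smul (H z) (?r z y))) has_contour_integral \<phi> v) \<gamma>"
  \<comment> \<open>The value along each single path is carried along:
    \<open>curve_contour_integral\<close> is a definite description, so the existence of a
    vector-valued integral has to be propagated through sums and multiples as well.\<close>
  define good where "good y Y \<longleftrightarrow> (\<forall>\<gamma>\<in>set \<Gamma>. ?i y \<gamma> (Y \<gamma>)) \<and>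
      (\<Sum>\<gamma>\<leftarrow>\<Gamma>. Y \<gamma>) = smul (2 * of_real pi * \<i>) (?Q y)" for y Y
  have goodI: "good y Y" if "\<And>\<gamma>. \<gamma> \<in> set \<Gamma> \<Longrightarrow> ?i y \<gamma> (Y \<gamma>)"
    "(\<Sum>\<gamma>\<leftarrow>\<Gamma>. Y \<gamma>) = smul (2 * of_real pi * \<i>) (?Q y)" for y Y
    unfolding good_def using that by blast
  have goodD: "?i y \<gamma> (Y \<gamma>)" if "good y Y" "\<gamma> \<in> set \<Gamma>" for y Y \<gamma>
    using that unfolding good_def by blast
  have goodS: "(\<Sum>\<gamma>\<leftarrow>\<Gamma>. Y \<gamma>) = smul (2 * of_real pi * \<i>) (?Q y)" if "good y Y" for y Y
    using that unfolding good_def by blast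
  let ?T = "{y\<in>V. \<exists>Y. good y Y}"
  note lQ = endo_quo[OF A cd bij]
  have lr: "endo (?r z)" if "z \<notin> ?S" for z
    unfolding resolvent_on_def
    by (rule endo_inv[OF endo_minus[OF endo_const_smul A]]) (use that in \<open>simp add: spectrum_on_def\<close>)
  have "subspace ?T"
  proof (rule subspaceI)
    have "good 0 (\<lambda>_. 0)"
    proof (rule goodI)
      fix \<gamma> assume g: "\<gamma> \<in> set \<Gamma>"
      show "?i 0 \<gamma> 0"
      proof
        fix \<phi> assume \<phi>: "\<phi> \<in> dual"
        have "((\<lambda>z. 0) has_contour_integral \<phi> 0) \<gamma>"
          by (simp add: functional_zero[OF \<phi>] has_contour_integral_0)
        then show "((\<lambda>z. \<phi> (smul (H z) (?r z 0))) has_contour_integral \<phi> 0) \<gamma>"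
        proof (rule has_contour_integral_eq)
          fix z assume "z \<in> path_image \<gamma>"
          then have "z \<notin> ?S" using path[OF g] by blast
          then show "0 = \<phi> (smul (H z) (?r z 0))"
            by (simp add: endo_zero[OF lr] functional_zero[OF \<phi>])
        qed
      qed
    qed (simp add: endo_zero[OF lQ])
    then show "0 \<in> ?T" using V_zero by blast
  next
    fix y1 y2 assume "y1 \<in> ?T" "y2 \<in> ?T"
    then obtain Y1 Y2 where y: "y1 \<in> V" "y2 \<in> V" and g: "good y1 Y1" "good y2 Y2" by blast
    note Y1 = goodD[OF g(1)] goodS[OF g(1)] and Y2 = goodD[OF g(2)] goodS[OF g(2)]
    have "?i (y1 + y2) \<gamma> (Y1 \<gamma> + Y2 \<gamma>)" if g: "\<gamma> \<in> set \<Gamma>" for \<gamma>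
    proof
      fix \<phi> assume \<phi>: "\<phi> \<in> dual"
      show "((\<lambda>z. \<phi> (smul (H z) (?r z (y1 + y2)))) has_contour_integral \<phi> (Y1 \<gamma> + Y2 \<gamma>)) \<gamma>"
        unfolding functional_add[OF \<phi>]
      proof (rule has_contour_integral_eq[OF has_contour_integral_add])
        fix z assume "z \<in> path_image \<gamma>"
        then have "z \<notin> ?S" using path[OF g] by blast
        then show "\<phi> (smul (H z) (?r z y1)) + \<phi> (smul (H z) (?r z y2)) = \<phi> (smul (H z) (?r z (y1 + y2)))"
          by (simp add: endo_add[OF lr y] functional_simps[OF \<phi>] distrib_left)
      qed (use Y1(1)[OF g] Y2(1)[OF g] \<phi> in auto)
    qed
    moreover have "(\<Sum>\<gamma>\<leftarrow>\<Gamma>. Y1 \<gamma> + Y2 \<gamma>) = smul (2 * of_real pi * \<i>) (?Q (y1 + y2))"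
      by (simp add: sum_list_addf Y1(2) Y2(2) endo_add[OF lQ y] scale_right_distrib)
    ultimately have "good (y1 + y2) (\<lambda>\<gamma>. Y1 \<gamma> + Y2 \<gamma>)" by (rule goodI)
    then show "y1 + y2 \<in> ?T" using V_add[OF y] by blast
  next
    fix a y1 assume "y1 \<in> ?T"
    then obtain Y1 where y: "y1 \<in> V" and g: "good y1 Y1" by blast
    note Y1 = goodD[OF g] goodS[OF g]
    have "?i (smul a y1) \<gamma> (smul a (Y1 \<gamma>))" if g: "\<gamma> \<in> set \<Gamma>" for \<gamma>
    proof
      fix \<phi> assume \<phi>: "\<phi> \<in> dual"
      show "((\<lambda>z. \<phi> (smul (H z) (?r z (smul a y1)))) has_contour_integral \<phi> (smul a (Y1 \<gamma>))) \<gamma>"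
        unfolding functional_smul[OF \<phi>, of a]
      proof (rule has_contour_integral_eq[OF has_contour_integral_lmul])
        fix z assume "z \<in> path_image \<gamma>"
        then have "z \<notin> ?S" using path[OF g] by blast
        then show "a * \<phi> (smul (H z) (?r z y1)) = \<phi> (smul (H z) (?r z (smul a y1)))"
          by (simp add: endo_smul[OF lr y] functional_simps[OF \<phi>])
      qed (use Y1(1)[OF g] \<phi> in auto)
    qed
    moreover have "(\<Sum>\<gamma>\<leftarrow>\<Gamma>. smul a (Y1 \<gamma>)) = smul (2 * of_real pi * \<i>) (?Q (smul a y1))"
    proof -
      have "(\<Sum>\<gamma>\<leftarrow>G. smul a (Y1 \<gamma>)) = smul a (\<Sum>\<gamma>\<leftarrow>G. Y1 \<gamma>)" for G
        by (induction G) (auto simp: scale_right_distrib)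
      then show ?thesis by (simp add: Y1(2) endo_smul[OF lQ y] mult.commute)
    qed
    ultimately have "good (smul a y1) (\<lambda>\<gamma>. smul a (Y1 \<gamma>))" by (rule goodI)
    then show "smul a y1 \<in> ?T" using V_smul[OF y] by blast
  qed
  moreover have "gen_eigen A \<subseteq> ?T"
  proof
    fix y assume "y \<in> gen_eigen A"
    then obtain l k where y: "y \<in> V" and k: "(shift_op A l ^^ k) y = 0" by (auto simp: gen_eigen_def)
    let ?v = "\<lambda>j. (shift_op A l ^^ j) y"
    show "y \<in> ?T"
    proof (cases "y = 0")
      case True
      then show ?thesis using \<open>subspace ?T\<close> subspace_0 by blast
    next
      case False
      have "l \<in> ?S"
      proof -
        \<comment> \<open>The last nonzero iterate is an eigenvector. So \<open>l\<close> lies in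
          the spectrum, and the cycle winds around it exactly once.\<close>
        define m where "m = (LEAST k. ?v k = 0)"
        have m: "?v m = 0" unfolding m_def by (rule LeastI[of "\<lambda>k. ?v k = 0", OF k])
        then obtain m' where m': "m = Suc m'" using False by (cases m) auto
        have "?v m' \<noteq> 0" using not_less_Least[of m' "\<lambda>k. ?v k = 0"] m' by (simp add: m_def)
        moreover have "A (?v m') = smul l (?v m')" using m m' by simp
        moreover have "?v m' \<in> V" by (rule endo_in[OF endo_pow[OF endo_shift[OF A]] y])
        ultimately show ?thesis using spectrum_iff[OF A] by blast
      qed
      then have l: "l \<in> ?S" "l \<in> U" using spec by auto
      note int = cycle_integral_power[OF \<Gamma> U(1) H(1) U(2) l]
      define Y where "Y \<gamma> = (\<Sum>j<k. smul (contour_integral \<gamma> (\<lambda>z. H z / (z - l) ^ Suc j)) (?v j))" for \<gamma>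
      have "?i y \<gamma> (Y \<gamma>)" if g: "\<gamma> \<in> set \<Gamma>" for \<gamma>
      proof
        fix \<phi> assume \<phi>: "\<phi> \<in> dual"
        have "((\<lambda>z. \<Sum>j<k. H z / (z - l) ^ Suc j * \<phi> (?v j)) has_contour_integral
            (\<Sum>j<k. contour_integral \<gamma> (\<lambda>z. H z / (z - l) ^ Suc j) * \<phi> (?v j))) \<gamma>"
          using int(2)[OF g]
          by (intro has_contour_integral_sum has_contour_integral_rmul has_contour_integral_integral) auto
        moreover have "(\<Sum>j<k. H z / (z - l) ^ Suc j * \<phi> (?v j)) = \<phi> (smul (H z) (?r z y))"
          if "z \<in> path_image \<gamma>" for z
        proof -
          have "z \<notin> ?S" "z \<noteq> l" using path[OF g] that l by auto
          from resolvent_gen_eigen[OF A y k this]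
          show ?thesis by (simp add: functional_simps[OF \<phi>] sum_distrib_left)
        qed
        ultimately show "((\<lambda>z. \<phi> (smul (H z) (?r z y))) has_contour_integral \<phi> (Y \<gamma>)) \<gamma>"
          unfolding Y_def functional_sum[OF \<phi>] functional_smul[OF \<phi>]
          by (rule has_contour_integral_eq)
      qed
      moreover have "(\<Sum>\<gamma>\<leftarrow>\<Gamma>. Y \<gamma>) = smul (2 * of_real pi * \<i>) (?Q y)"
      proof -
        have "(\<Sum>\<gamma>\<leftarrow>G. smul (a \<gamma>) w) = smul (\<Sum>\<gamma>\<leftarrow>G. a \<gamma>) w" for G :: "(real \<Rightarrow> complex) list" and a w
          by (induction G) (auto simp: scale_left_distrib)
        then have "(\<Sum>\<gamma>\<leftarrow>\<Gamma>. Y \<gamma>) = (\<Sum>j<k. smul (2 * of_real pi * \<i> * ((deriv ^^ j) H l / fact j)) (?v j))"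
          unfolding Y_def sum_list_sum_swap by (simp only: int(1))
        also have "\<dots> = smul (2 * of_real pi * \<i>) (?Q y)"
        proof -
          have "?Q y = (\<Sum>j<k. smul ((deriv ^^ j) H l / fact j) (?v j))"
            by (rule quo_gen_eigen[OF A y k cd bij U(1) l(2) H])
          then show ?thesis by (simp only: scale_sum_right scale_scale)
        qed
        finally show ?thesis .
      qed
      ultimately have "good y Y" by (rule goodI)
      then show ?thesis using y by blast
    qed
  qed
  ultimately have "span (gen_eigen A) \<subseteq> ?T" by (intro span_minimal)
  then have "x \<in> ?T" using x span_gen_eigen[OF A] by blast
  then obtain Y where "good x Y" by blast
  note Y = goodD[OF this] goodS[OF this]
  have "curve_contour_integral smul \<gamma> (\<lambda>z. smul (H z) (?r z x)) = Y \<gamma>" if "\<gamma> \<in> set \<Gamma>" for \<gamma>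
    unfolding curve_contour_integral_def
  proof (rule the_equality)
    show "?i x \<gamma> (Y \<gamma>)" by (rule Y(1)[OF that])
    fix y assume y: "?i x \<gamma> y"
    show "y = Y \<gamma>"
      using y Y(1)[OF that] by (intro functionals_separate) (blast intro: has_contour_integral_unique)
  qed
  then have "(\<Sum>\<gamma>\<leftarrow>\<Gamma>. curve_contour_integral smul \<gamma> (\<lambda>z. smul (H z) (?r z x))) = smul (2 * of_real pi * \<i>) (?Q x)"
    using Y(2) by (metis (no_types, lifting) map_cong)
  then show ?thesis
    unfolding holomorphic_calculus_def \<Gamma>_def[symmetric] Let_def by simp
qed

end

section \<open>The functions F and f\<close>

lemma val_Suc:
  assumes "entire c" shows "val c z = c 0 + z * val (\<lambda>n. c (Suc n)) z"
proof -
  have "(\<lambda>n. z * (c (Suc n) * z ^ n)) sums (z * val (\<lambda>n. c (Suc n)) z)"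
    by (intro sums_mult val_sums entire_Suc assms)
  then have "(\<lambda>n. c (Suc n) * z ^ Suc n) sums (z * val (\<lambda>n. c (Suc n)) z)"
    by (simp add: mult_ac)
  from sums_Suc[OF this] have "(\<lambda>n. c n * z ^ n) sums (c 0 + z * val (\<lambda>n. c (Suc n)) z)"
    by (simp add: add.commute)
  then show ?thesis using val_sums[OF assms] by (metis sums_unique2)
qed

lemma val_exp_c: "val exp_c z = exp z"
proof -
  have "(\<lambda>n. exp_c n * z ^ n) = (\<lambda>n. z ^ n /\<^sub>R fact n)"
    by (simp add: exp_c_def scaleR_conv_of_real divide_inverse mult.commute)
  then show ?thesis using exp_converges[of z] val_sums[OF entire_exp_c, of z] by (metis sums_unique2)
qed

lemma val_F_den: "val F_den z = exp z - 1"
  using val_Suc[OF entire_F_den, of z] val_Suc[OF entire_exp_c, of z]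
  by (simp add: F_den_def exp_c_def val_exp_c del: fact_Suc)

lemma val_F_den_f_den: "val F_den z = z * val f_den z"
  using val_Suc[OF entire_F_den, of z] by (simp add: F_den_def f_den_def[abs_def] del: fact_Suc)

lemma val_F_num: "val F_num z = (exp z + 1) / 2"
proof -
  have "(\<lambda>n. 1/2 * (exp_c (Suc n) * z ^ n)) sums (1/2 * val (\<lambda>n. exp_c (Suc n)) z)"
    by (intro sums_mult val_sums entire_Suc entire_exp_c)
  moreover have "(\<lambda>n. 1/2 * (exp_c (Suc n) * z ^ n)) = (\<lambda>n. F_num (Suc n) * z ^ n)"
    by (simp add: F_num_def exp_c_def del: fact_Suc)
  ultimately have "val (\<lambda>n. F_num (Suc n)) z = 1/2 * val (\<lambda>n. exp_c (Suc n)) z"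
    using sums_unique2[OF val_sums[OF entire_Suc[OF entire_F_num], of z]] by simp
  then show ?thesis
    using val_Suc[OF entire_F_num, of z] val_Suc[OF entire_exp_c, of z]
    by (simp add: F_num_def exp_c_def[of 0] val_exp_c field_simps)
qed

lemma val_f_num: "z * val f_num z + val f_den z = val F_num z"
proof -
  have "(\<lambda>n. F_num (Suc n) * z ^ n - f_den (Suc n) * z ^ n) sums
      (val (\<lambda>n. F_num (Suc n)) z - val (\<lambda>n. f_den (Suc n)) z)"
    by (intro sums_diff val_sums entire_Suc entire_F_num entire_f_den)
  moreover have "F_num (Suc n) * z ^ n - f_den (Suc n) * z ^ n = f_num n * z ^ n" for n
    by (simp add: F_num_def f_den_def f_num_def left_diff_distrib del: fact_Suc)
  ultimately have "val f_num z = val (\<lambda>n. F_num (Suc n)) z - val (\<lambda>n. f_den (Suc n)) z"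
    using val_sums[OF entire_f_num, of z] by (simp add: sums_unique2)
  then show ?thesis
    using val_Suc[OF entire_F_num, of z] val_Suc[OF entire_f_den, of z]
    by (simp add: F_num_def[of 0] f_den_def[of 0] right_diff_distrib)
qed

lemma exp_eq_1_two_pi_i: "exp z = 1 \<longleftrightarrow> z \<in> two_pi_i_Ints"
proof
  assume "exp z = 1"
  then obtain n :: int where "Re z = 0" "Im z = of_int (2 * n) * pi" by (auto simp: exp_eq_1)
  then have "z = 2 * of_real pi * \<i> * of_int n" by (simp add: complex_eq_iff)
  then show "z \<in> two_pi_i_Ints" by (auto simp: two_pi_i_Ints_def)
next
  assume "z \<in> two_pi_i_Ints"
  then obtain n :: int where "z = 2 * of_real pi * \<i> * of_int n" by (auto simp: two_pi_i_Ints_def)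
  then show "exp z = 1" by (auto simp: exp_eq_1)
qed

lemma val_F_den_0_iff: "val F_den z = 0 \<longleftrightarrow> z \<in> two_pi_i_Ints"
  by (simp add: val_F_den exp_eq_1_two_pi_i)

text \<open>Dividing \<open>e^z - 1\<close> by \<open>z\<close> removes the zero at the origin,
  where the quotient has the value 1, and no other.\<close>

lemma val_f_den_0_iff: "val f_den z = 0 \<longleftrightarrow> z \<in> two_pi_i_Ints - {0}"
proof (cases "z = 0")
  case True
  then show ?thesis using val_Suc[OF entire_f_den, of z] by (simp add: f_den_def)
next
  case False
  then show ?thesis using val_F_den_f_den[of z] val_F_den_0_iff[of z] by auto
qed

lemma finite_two_pi_i_Ints: "finite (two_pi_i_Ints \<inter> ball 0 r)"
proof -
  have "two_pi_i_Ints \<inter> ball 0 r \<subseteq> (\<lambda>k::int. 2 * of_real pi * \<i> * of_int k) ` {- \<lceil>r\<rceil>..\<lceil>r\<rceil>}"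
  proof
    fix z assume z: "z \<in> two_pi_i_Ints \<inter> ball 0 r"
    then obtain k :: int where k: "z = 2 * of_real pi * \<i> * of_int k" by (auto simp: two_pi_i_Ints_def)
    have "norm z = 2 * pi * \<bar>of_int k\<bar>" by (simp add: k norm_mult)
    then have "2 * pi * \<bar>of_int k\<bar> < r" using z by simp
    moreover have "1 * \<bar>real_of_int k\<bar> \<le> 2 * pi * \<bar>of_int k\<bar>"
      using pi_gt3 by (intro mult_right_mono) auto
    ultimately have "\<bar>real_of_int k\<bar> \<le> r" by simp
    then have "k \<in> {- \<lceil>r\<rceil>..\<lceil>r\<rceil>}" by (simp add: abs_le_iff) linarith
    then show "z \<in> (\<lambda>k::int. 2 * of_real pi * \<i> * of_int k) ` {- \<lceil>r\<rceil>..\<lceil>r\<rceil>}" using k by blast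
  qed
  then show ?thesis by (rule finite_subset) simp
qed

lemma open_val_nz: assumes "entire d" shows "open {z. val d z \<noteq> 0}"
proof -
  have "continuous_on UNIV (val d)"
    by (rule holomorphic_on_imp_continuous_on[OF val_holomorphic[OF assms]])
  then show ?thesis by (intro open_Collect_neq) auto
qed

lemma F_fun_quotient:
  assumes "z \<notin> two_pi_i_Ints" shows "F_fun z * val F_den z = val F_num z"
proof -
  \<comment> \<open>In terms of \<open>w = e^(z/2)\<close>, half of \<open>coth (z/2)\<close> is
    \<open>(w^2 + 1) / (2 (w^2 - 1))\<close>.\<close>
  define w where "w = exp (z / 2)"
  have w: "exp z = w\<^sup>2" "w \<noteq> 0" by (auto simp: w_def exp_double[symmetric] power2_eq_square mult_exp_exp)
  have n: "w\<^sup>2 - 1 \<noteq> 0" using assms exp_eq_1_two_pi_i[of z] w by auto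
  have cs: "cosh (z/2) = (w\<^sup>2 + 1) / (2 * w)" "sinh (z/2) = (w\<^sup>2 - 1) / (2 * w)"
    using w(2) by (auto simp: cosh_field_def sinh_field_def exp_minus w_def[symmetric] field_simps power2_eq_square)
  show ?thesis
    unfolding F_fun_def cs val_F_den val_F_num w(1) using w(2) n by (simp add: field_simps)
qed

lemma f_fun_quotient:
  assumes "z \<notin> two_pi_i_Ints - {0}" shows "f_fun z * val f_den z = val f_num z"
proof (cases "z = 0")
  case True
  then show ?thesis using val_Suc[OF entire_f_num, of z] by (simp add: f_fun_def f_num_def)
next
  case False
  then have "f_fun z = F_fun z - 1 / z" by (simp add: f_fun_def F_fun_def)
  moreover have "F_fun z * (z * val f_den z) = z * val f_num z + val f_den z"
    using F_fun_quotient[of z] assms False val_F_den_f_den[of z] val_f_num[of z] by simp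
  ultimately have "z * (f_fun z * val f_den z) = z * val f_num z"
    using False by (simp add: left_diff_distrib right_diff_distrib mult.left_commute[of z])
  then show ?thesis using False by simp
qed

lemma holomorphic_quotient:
  assumes "entire c" "entire d" "\<And>z. z \<in> U \<Longrightarrow> H z * val d z = val c z"
    "\<And>z. z \<in> U \<Longrightarrow> val d z \<noteq> 0"
  shows "H holomorphic_on U"
proof -
  have "(\<lambda>z. val c z / val d z) holomorphic_on U"
    using assms by (intro holomorphic_intros val_holomorphic) auto
  moreover have "val c z / val d z = H z" if "z \<in> U" for z
    using assms(3,4)[OF that] by (simp add: field_simps)
  ultimately show ?thesis by (subst (asm) holomorphic_cong) auto
qed

text \<open>\<open>L\<close> is the set of poles, which are the zeros of the denominator. It covers
  both cases at once: all of \<open>two_pi_i_Ints\<close> for \<open>F\<close>, and the same set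
  without 0 for \<open>f\<close>.\<close>

lemma (in fd_space) holomorphic_calculus_two_pi_i:
  assumes A: "endo A" and cd: "entire c" "entire d"
    and L: "L \<subseteq> two_pi_i_Ints" "\<And>z. val d z = 0 \<longleftrightarrow> z \<in> L"
    and s: "spectrum_on smul V A \<inter> L = {}" and H: "\<And>z. z \<notin> L \<Longrightarrow> H z * val d z = val c z"
  shows "bij_betw (pser d A) V V"
    and "x \<in> V \<Longrightarrow> holomorphic_calculus smul (- L) H V A x = quo c d V A x"
proof -
  show b: "bij_betw (pser d A) V V"
    using s L(2) by (intro bij_pser[OF A cd(2)]) auto
  have "- L = {z. val d z \<noteq> 0}" using L(2) by auto
  then have "open (- L)" using open_val_nz[OF cd(2)] by simp
  moreover have "H holomorphic_on - L"
    using H L(2) by (intro holomorphic_quotient[OF cd]) auto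
  moreover have "finite (- (- L) \<inter> ball 0 r)" for r
    by (rule finite_subset[OF _ finite_two_pi_i_Ints[of r]]) (use L(1) in auto)
  ultimately show "x \<in> V \<Longrightarrow> holomorphic_calculus smul (- L) H V A x = quo c d V A x"
    using s H by (intro holomorphic_calculus_quo[OF A cd _ _ _ _ _ b]) auto
qed

context complex_vector_space begin

text \<open>Weak limits alone would not pass through a bilinear map; inside finite-dimensional
  \<open>V\<close> and \<open>W\<close> the values are finite sums of products of converging
  coordinates.\<close>

lemma weak_lim_bilin:
  assumes V: "fd_space smul V" and W: "fd_space smul W" and \<beta>: "bilin \<beta>"
    and g: "weak_lim g x F" "\<forall>\<^sub>F t in F. g t \<in> V" "x \<in> V"
    and h: "weak_lim h y F" "\<forall>\<^sub>F t in F. h t \<in> W" "y \<in> W"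
  shows "weak_lim (\<lambda>t. \<beta> (g t) (h t)) (\<beta> x y) F"
  unfolding weak_lim_def
proof
  interpret V: fd_space smul V by fact
  interpret W: fd_space smul W by fact
  fix \<phi> assume \<phi>: "\<phi> \<in> dual"
  have f: "(\<lambda>x. \<phi> (\<beta> x y)) \<in> dual" "(\<lambda>y. \<phi> (\<beta> x y)) \<in> dual" for x y
    by (auto simp: functionals_iff bilin_simps[OF \<beta>] functional_simps[OF \<phi>])
  let ?e = "\<lambda>x y. \<Sum>b\<in>V.bas. \<Sum>b'\<in>W.bas. V.coord b x * (W.coord b' y * \<phi> (\<beta> b b'))"
  have expand: "\<phi> (\<beta> x y) = ?e x y"
    if "x \<in> V" "y \<in> W" for x y
  proof -
    have "\<phi> (\<beta> x y) = (\<Sum>b\<in>V.bas. V.coord b x * \<phi> (\<beta> b y))"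
      by (rule V.functional_expand[OF f(1) that(1)])
    also have "\<dots> = (\<Sum>b\<in>V.bas. V.coord b x * (\<Sum>b'\<in>W.bas. W.coord b' y * \<phi> (\<beta> b b')))"
      by (rule sum.cong[OF refl]) (simp only: W.functional_expand[OF f(2) that(2)])
    finally show ?thesis by (simp only: sum_distrib_left)
  qed
  have "((\<lambda>t. ?e (g t) (h t)) \<longlongrightarrow> ?e x y) F"
    using g(1) h(1) V.coord_functional W.coord_functional unfolding weak_lim_def
    by (intro tendsto_sum tendsto_mult tendsto_const) auto
  moreover have "\<forall>\<^sub>F t in F. ?e (g t) (h t) = \<phi> (\<beta> (g t) (h t))"
    using g(2) h(2) by eventually_elim (rule expand[symmetric])
  ultimately show "((\<lambda>t. \<phi> (\<beta> (g t) (h t))) \<longlongrightarrow> \<phi> (\<beta> x y)) F"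
    unfolding expand[OF g(3) h(3)] by (rule Lim_transform_eventually)
qed

end

section \<open>The shifted equation\<close>

text \<open>The quotient that represents \<open>R\<close> in degree \<open>n\<close>; the case
  distinction is hidden here so that all degrees are treated alike.\<close>

definition r_num :: "'z::zero \<Rightarrow> nat \<Rightarrow> complex" where "r_num n = (if n = 0 then f_num else F_num)"
definition r_den :: "'z::zero \<Rightarrow> nat \<Rightarrow> complex" where "r_den n = (if n = 0 then f_den else F_den)"

lemma entire_r: "entire (r_num n)" "entire (r_den n)"
  by (auto simp: r_num_def r_den_def entire_intros)

context graded_self_dual_lie_algebra begin

sublocale complex_vector_space smul
  by unfold_locales

sublocale G: fd_space smul "gr n" for n
  by unfold_locales (rule gr_finite_dim)

lemma fd_gr: "fd_space smul (gr n)"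
  by unfold_locales

lemma bilin_br: "bilin br"
  using br_linear_left br_linear_right
  unfolding bilin_def Vector_Spaces.linear_iff by blast

lemmas br_simps = bilin_simps[OF bilin_br]

lemma br_sum_left: "br (\<Sum>i\<in>I. g i) y = (\<Sum>i\<in>I. br (g i) y)"
  and br_sum_right: "br y (\<Sum>i\<in>I. g i) = (\<Sum>i\<in>I. br y (g i))"
  by (induction I rule: infinite_finite_induct; simp add: br_simps)+

lemma form_functional: "form x \<in> dual" "(\<lambda>x. form x y) \<in> dual"
  using form_linear_left form_linear_right unfolding functionals_def by auto

lemmas form_simps = functional_simps[OF form_functional(1)] functional_simps[OF form_functional(2)]

lemma br_anti: "br x y = - br y x"
proof -
  have "br (x + y) (x + y) = 0" "br x x = 0" "br y y = 0" by (rule br_alternating)+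
  then have "br x y + br y x = 0" by (simp add: br_simps add.commute)
  then show ?thesis by (simp add: eq_neg_iff_add_eq_0)
qed

lemma br_neg_right: "br x (- y) = - br x y"
  using bilin_diff_right[OF bilin_br, of x 0 y] by (simp add: bilin_zero_right[OF bilin_br])

lemma br_derivation: "br k (br x y) = br (br k x) y + br x (br k y)"
proof -
  have "br x (br y k) = - br x (br k y)"
    unfolding br_anti[of y k] by (rule br_neg_right)
  moreover have "br y (br k x) = - br (br k x) y" by (rule br_anti)
  ultimately have "br k (br x y) - br x (br k y) - br (br k x) y = 0"
    using br_jacobi[of k x y] by simp
  then show ?thesis by (simp add: algebra_simps)
qed

lemma form_br_right: "form (br x y) z = form x (br y z)"
  using form_invariant[of y x z] by (subst br_anti) (simp add: form_simps add_eq_0_iff)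

lemma endo_br: "k \<in> gr 0 \<Longrightarrow> G.endo n (br k)"
  unfolding G.endo_def G.lin_def using gr_br[of k 0 _ n] by (simp add: br_simps)

text \<open>The operator \<open>ad k + s t\<close>. The weight \<open>s\<close> is kept apart from
  the parameter \<open>t\<close> because weights add under the bracket (\<open>ads_br\<close>) and
  must cancel under the form (\<open>ads_form\<close>).\<close>

definition ads :: "'a \<Rightarrow> complex \<Rightarrow> complex \<Rightarrow> 'a \<Rightarrow> 'a" where
  "ads k s t = (\<lambda>y. br k y + smul (s * t) y)"

lemma oplim_ads:
  assumes "k \<in> gr 0" shows "G.oplim n (ads k s) (br k) (at 0)"
proof -
  have "(\<lambda>t x. br k x + smul t (smul s x)) = ads k s"
    by (auto simp: ads_def mult.commute)
  then show ?thesis using G.oplim_line[OF endo_br[OF assms] G.endo_const_smul, of n s] by simp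
qed

lemma endo_ads: assumes "k \<in> gr 0" shows "G.endo n (ads k s t)"
  unfolding ads_def by (rule G.endo_plus[OF endo_br[OF assms] G.endo_const_smul])

lemma ads_br: "ads k (s + s') t (br x y) = br (ads k s t x) y + br x (ads k s' t y)"
  by (simp add: ads_def br_derivation[of k x y] br_simps distrib_right scale_left_distrib add_ac)

lemma ads_form: "form (ads k s t x) y + form x (ads k (- s) t y) = 0"
  using form_invariant[of k x y] by (simp add: ads_def form_simps algebra_simps)

text \<open>Invertibility fails only at \<open>t = - z / s\<close> for the finitely many eigenvalues
  \<open>z\<close>; the eigenvalue 0 gives \<open>t = 0\<close>, which \<open>at 0\<close>
  excludes.\<close>

lemma bij_ads:
  assumes k: "k \<in> gr 0" and s: "s \<noteq> 0"
  shows "\<forall>\<^sub>F t in at 0. bij_betw (ads k s t) (gr n) (gr n)"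
proof -
  let ?S = "(\<lambda>z. - z / s) ` spectrum_on smul (gr n) (br k)"
  have "finite ?S" using G.finite_spectrum[OF endo_br[OF k]] by simp
  then have "\<forall>\<^sub>F t in at 0. t \<notin> ?S"
    using islimpt_finite[of ?S 0] unfolding islimpt_iff_eventually by simp
  then show ?thesis
  proof eventually_elim
    case (elim t)
    show ?case
    proof (rule G.inj_bij[OF endo_ads[OF k]])
      fix x assume x: "x \<in> gr n" "ads k s t x = 0"
      then have "br k x = smul (- (s * t)) x"
        by (simp add: ads_def eq_neg_iff_add_eq_0)
      moreover have "- (s * t) \<notin> spectrum_on smul (gr n) (br k)"
      proof
        assume "- (s * t) \<in> spectrum_on smul (gr n) (br k)"
        then have "- (- (s * t)) / s \<in> ?S" by (rule imageI)
        then show False using elim s by simp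
      qed
      ultimately show "x = 0" using G.spectrum_iff[OF endo_br[OF k]] x(1) by blast
    qed
  qed
qed

abbreviation Rh :: "'z \<Rightarrow> ('a \<Rightarrow> 'a) \<Rightarrow> 'a \<Rightarrow> 'a" where
  "Rh n A \<equiv> quo (r_num n) (r_den n) (gr n) A"

abbreviation dRh :: "'z \<Rightarrow> ('a \<Rightarrow> 'a) \<Rightarrow> ('a \<Rightarrow> 'a) \<Rightarrow> ('a \<Rightarrow> 'a) \<Rightarrow> 'a \<Rightarrow> 'a" where
  "dRh n A1 B A2 \<equiv> dquo (r_num n) (r_den n) (gr n) A1 B A2"

text \<open>The defect \<open>F - R\<close> of an operator in degree \<open>n\<close>: the inverse
  in degree 0, where \<open>R\<close> uses \<open>f\<close>, and nothing in the other
  degrees.\<close>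

definition rho :: "'z \<Rightarrow> ('a \<Rightarrow> 'a) \<Rightarrow> 'a \<Rightarrow> 'a" where
  "rho n A x = (if n = 0 then inv_into (gr n) A x else 0)"

definition regular :: "'z \<Rightarrow> ('a \<Rightarrow> 'a) \<Rightarrow> bool" where
  "regular n A \<longleftrightarrow> G.endo n A \<and> bij_betw (pser (r_den n) A) (gr n) (gr n) \<and> bij_betw (pser F_den A) (gr n) (gr n)
     \<and> (n = 0 \<longrightarrow> bij_betw A (gr n) (gr n))"

lemma regular_ads:
  assumes k: "k \<in> gr 0" and s: "s \<noteq> 0"
    and b: "bij_betw (pser (r_den n) (br k)) (gr n) (gr n)"
  shows "\<forall>\<^sub>F t in at 0. regular n (ads k s t)"
  using bij_ads[OF k s, of n] G.oplim_inv(1)[OF G.oplim_pser[OF oplim_ads[OF k] entire_r(2)] b, of s]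
proof eventually_elim
  case (elim t)
  have "bij_betw (pser F_den (ads k s t)) (gr n) (gr n)"
  proof (cases "n = 0")
    case True
    then show ?thesis using G.bij_F_den[OF endo_ads[OF k] elim(1)] elim(2) by (simp add: r_den_def)
  next
    case False
    then show ?thesis using elim(2) by (simp add: r_den_def)
  qed
  then show ?case unfolding regular_def using elim endo_ads[OF k] by blast
qed

lemma Rh_in:
  assumes "regular n A" "x \<in> gr n" shows "Rh n A x \<in> gr n"
  using G.endo_in[OF G.endo_quo[OF _ entire_r, of n A n] assms(2)] assms(1) by (simp add: regular_def)

lemma endo_Rh: "regular n A \<Longrightarrow> G.endo n (Rh n A)"
  using G.endo_quo[OF _ entire_r, of n A n] by (simp add: regular_def)

lemma endo_rho:
  assumes "regular n A" shows "G.endo n (rho n A)"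
proof (cases "n = 0")
  case True
  then have "rho n A = inv_into (gr n) A" by (auto simp: rho_def)
  then show ?thesis using G.endo_inv[of n A] assms True by (simp add: regular_def)
next
  case False
  then have "rho n A = (\<lambda>x. 0)" by (auto simp: rho_def)
  then show ?thesis by (simp add: G.endo_def G.lin_def)
qed

lemma rho_eq:
  assumes "regular n A" "x \<in> gr n" "n = 0" shows "A (rho n A x) = x"
  using assms G.inv_right[of n A x] by (simp add: regular_def rho_def)

lemma rho_eqI:
  assumes "regular n A" "y \<in> gr n" "n = 0" "x = A y" shows "rho n A x = y"
  using assms G.inv_left[of n A y] by (simp add: regular_def rho_def)

lemma F_split:
  assumes "regular n A" "x \<in> gr n"
  shows "quo F_num F_den (gr n) A x = Rh n A x + rho n A x"
proof (cases "n = 0")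
  case True
  then show ?thesis
    using G.quo_F_f[of n A x] assms by (simp add: regular_def rho_def r_num_def r_den_def)
qed (simp add: rho_def r_num_def r_den_def)

text \<open>\<open>F\<close> is skew by \<open>F_skew\<close>, and so is the inverse when the
  weights are opposite; hence so is their difference.\<close>

lemma Rh_skew:
  assumes r: "regular m (ads k s t)" "regular n (ads k (- s) t)" and mn: "m + n = 0"
    and X: "X \<in> gr m" and Y: "Y \<in> gr n"
  shows "form (Rh m (ads k s t) X) Y = - form X (Rh n (ads k (- s) t) Y)"
proof -
  have 1: "form (quo F_num F_den (gr m) (ads k s t) X) Y = - form X (quo F_num F_den (gr n) (ads k (- s) t) Y)"
    using r X Y by (intro F_skew[OF fd_gr fd_gr _ _ form_functional(2,1)] ads_form) (auto simp: regular_def)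
  have "form (rho m (ads k s t) X) Y = - form X (rho n (ads k (- s) t) Y)"
  proof (cases "m = 0")
    case True
    then have n: "n = 0" using mn by simp
    have "form (ads k s t (rho m (ads k s t) X)) (rho n (ads k (- s) t) Y)
        + form (rho m (ads k s t) X) (ads k (- s) t (rho n (ads k (- s) t) Y)) = 0"
      by (rule ads_form)
    then show ?thesis
      unfolding rho_eq[OF r(1) X True] rho_eq[OF r(2) Y n] by (simp add: eq_neg_iff_add_eq_0 add.commute)
  next
    case False
    then have "n \<noteq> 0" using mn by auto
    then show ?thesis using False by (simp add: rho_def form_simps)
  qed
  then show ?thesis
    using 1 unfolding F_split[OF r(1) X] F_split[OF r(2) Y] by (simp add: form_simps)
qed

text \<open>By the derivation rule \<open>(ad k + s1 t) ad T' - ad T' (ad k + s2 t) = ad T\<close>,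
  so \<open>ad T'\<close> can be taken as the map \<open>C\<close> of
  \<open>dquo_eq\<close>.\<close>

lemma dRh_ads:
  assumes k: "k \<in> gr 0" and T: "T' \<in> gr 0" and T': "T = ads k (s1 - s2) t T'"
    and r: "regular n (ads k s1 t)" "regular n (ads k s2 t)" and x: "x \<in> gr n"
  shows "dRh n (ads k s1 t) (br T) (ads k s2 t) x = Rh n (ads k s1 t) (br T' x) - br T' (Rh n (ads k s2 t) x)"
proof (rule G.dquo_eq[OF endo_ads[OF k] endo_ads[OF k] endo_br[OF T] _ x entire_r])
  show "bij_betw (pser (r_den n) (ads k s1 t)) (gr n) (gr n)" "bij_betw (pser (r_den n) (ads k s2 t)) (gr n) (gr n)"
    using r by (auto simp: regular_def)
  fix y assume "y \<in> gr n"
  have "ads k s1 t (br T' y) = br T y + br T' (ads k s2 t y)"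
    using ads_br[of k "s1 - s2" s2 t T' y] by (simp add: T')
  then show "ads k s1 t (br T' y) - br T' (ads k s2 t y) = br T y" by simp
qed

lemma dual_expand:
  assumes db: "dual_bases smul form (gr 0) d b b'" and u: "u \<in> gr 0"
  shows "u = (\<Sum>i<d. smul (form u (b i)) (b' i))"
proof -
  have bb: "form (b i) (b' j) = (if i = j then 1 else 0)" if "i < d" "j < d" for i j
    using db that by (simp add: dual_bases_def)
  have "inj_on b' {..<d}" "span (b' ` {..<d}) = gr 0"
    using db by (auto simp: dual_bases_def indexed_basis_def)
  then have "u \<in> span (b' ` {..<d})" using u by simp
  then obtain c where c: "u = (\<Sum>v\<in>b' ` {..<d}. smul (c v) v)"
    by (auto simp: span_finite)
  then have u: "u = (\<Sum>i<d. smul (c (b' i)) (b' i))"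
    using sum.reindex[OF \<open>inj_on b' {..<d}\<close>] by simp
  have "form u (b j) = c (b' j)" if j: "j < d" for j
  proof -
    have "form u (b j) = (\<Sum>i<d. c (b' i) * form (b j) (b' i))"
      unfolding u by (simp add: form_simps form_sym[of "b j"])
    also have "\<dots> = (\<Sum>i<d. if i = j then c (b' i) else 0)"
      using j by (intro sum.cong) (auto simp: bb)
    finally show ?thesis using j by simp
  qed
  then show ?thesis by (subst u) simp
qed

text \<open>
  The equation for the shifted operators \<open>ad \<kappa> + t\<close> on both arguments and \<open>ad \<kappa> + 2t\<close> on the
  bracket, with difference quotients in place of derivatives. For generic \<open>t\<close> it follows from the
  identity for \<open>F\<close> alone, since \<open>f = F - 1/z\<close>.
\<close>

lemma shifted_equation:
  assumes k: "k \<in> gr 0" and X: "X \<in> gr m" and Y: "Y \<in> gr n"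
    and db: "dual_bases smul form (gr 0) d b b'"
    and rX: "regular m (ads k 1 t)" and rY: "regular n (ads k 1 t)" "regular n (ads k (- 1) t)"
    and rZ: "regular (m + n) (ads k 2 t)" and r0: "regular 0 (ads k (- 2) t)"
  shows "br (Rh m (ads k 1 t) X) (Rh n (ads k 1 t) Y)
      - Rh (m + n) (ads k 2 t) (br X (Rh n (ads k 1 t) Y) + br (Rh m (ads k 1 t) X) Y)
      + (if m + n = 0 then \<Sum>i<d. smul (form X (dRh n (ads k (- 1) t) (br (b i)) (ads k 1 t) Y)) (b' i) else 0)
      + (if n = 0 then dRh m (ads k 2 t) (br Y) (ads k 1 t) X else 0)
      - (if m = 0 then dRh n (ads k 2 t) (br X) (ads k 1 t) Y else 0)
      = smul (- 1/4) (br X Y)"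
proof -
  define hX where "hX = Rh m (ads k 1 t) X"
  define hY where "hY = Rh n (ads k 1 t) Y"
  define qX where "qX = rho m (ads k 1 t) X"
  define qY where "qY = rho n (ads k 1 t) Y"
  let ?H = "Rh (m + n) (ads k 2 t)" and ?q = "rho (m + n) (ads k 2 t)"
  have mem: "hX \<in> gr m" "hY \<in> gr n" "qX \<in> gr m" "qY \<in> gr n"
    using Rh_in[OF rX X] Rh_in[OF rY(1) Y] G.endo_in[OF endo_rho[OF rX] X] G.endo_in[OF endo_rho[OF rY(1)] Y]
    by (auto simp: hX_def hY_def qX_def qY_def)
  have brm: "br x y \<in> gr (m + n)" if "x \<in> gr m" "y \<in> gr n" for x y using gr_br that .
  have H_add: "?H (x + y) = ?H x + ?H y" and q_add: "?q (x + y) = ?q x + ?q y"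
    if "x \<in> gr (m + n)" "y \<in> gr (m + n)" for x y
    using G.endo_add[OF endo_Rh[OF rZ] that] G.endo_add[OF endo_rho[OF rZ] that] .
  define W where "W = br X hY + br hX Y"
  define W' where "W' = br X qY + br qX Y"
  have WW: "W \<in> gr (m + n)" "W' \<in> gr (m + n)"
    unfolding W_def W'_def using brm X Y mem G.V_add by auto
  have "br (quo F_num F_den (gr m) (ads k 1 t) X) (quo F_num F_den (gr n) (ads k 1 t) Y)
      - quo F_num F_den (gr (m + n)) (ads k 2 t) (br X (quo F_num F_den (gr n) (ads k 1 t) Y) + br (quo F_num F_den (gr m) (ads k 1 t) X) Y)
      = smul (- 1/4) (br X Y)"
  proof (rule F_hom[OF fd_gr fd_gr fd_gr _ _ _ bilin_br gr_br _ _ _ _ X Y])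
    fix x y
    show "ads k 2 t (br x y) = br (ads k 1 t x) y + br x (ads k 1 t y)"
      using ads_br[of k 1 1 t x y] by simp
  qed (use rX rY rZ in \<open>auto simp: regular_def\<close>)
  moreover have "br X (hY + qY) + br (hX + qX) Y = W + W'"
    by (simp add: W_def W'_def br_simps)
  ultimately have star: "br (hX + qX) (hY + qY) - (?H (W + W') + ?q (W + W')) = smul (- 1/4) (br X Y)"
    using F_split[OF rX X] F_split[OF rY(1) Y] F_split[OF rZ] WW G.V_add
    by (simp add: hX_def hY_def qX_def qY_def)
  have HW': "?H W' = ?H (br X qY) + ?H (br qX Y)"
    unfolding W'_def using brm X Y mem by (intro H_add) auto
  \<comment> \<open>For \<open>n = 0\<close>, \<open>qY\<close> serves as \<open>T'\<close> in
    \<open>dRh_ads\<close> with \<open>T = Y\<close>, the weight being \<open>2 - 1 = 1\<close>.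
    Antisymmetry of the bracket puts \<open>qY\<close> on the left.\<close>
  have c1: "br hX qY - ?H (br X qY) = (if n = 0 then dRh m (ads k 2 t) (br Y) (ads k 1 t) X else 0)"
  proof (cases "n = 0")
    case True
    have q: "qY \<in> gr 0" using mem(4) True by simp
    have "dRh m (ads k 2 t) (br Y) (ads k 1 t) X = Rh m (ads k 2 t) (br qY X) - br qY (Rh m (ads k 1 t) X)"
      by (rule dRh_ads[OF k q _ _ rX X])
        (use rZ rho_eq[OF rY(1) Y True] True in \<open>auto simp: qY_def\<close>)
    also have "br qY X = smul (- 1) (br X qY)" by (subst br_anti) simp
    also have "Rh m (ads k 2 t) (smul (- 1) (br X qY)) = smul (- 1) (Rh m (ads k 2 t) (br X qY))"
      using rZ True brm[OF X mem(4)] by (intro G.endo_smul[OF endo_Rh]) auto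
    finally show ?thesis using True br_anti[of qY hX] by (simp add: hX_def)
  next
    case False
    then have "qY = 0" by (simp add: qY_def rho_def)
    then show ?thesis using False G.endo_zero[OF endo_Rh[OF rZ]] by (simp add: br_simps)
  qed
  have c2: "br qX hY - ?H (br qX Y) = - (if m = 0 then dRh n (ads k 2 t) (br X) (ads k 1 t) Y else 0)"
  proof (cases "m = 0")
    case True
    have q: "qX \<in> gr 0" using mem(3) True by simp
    have "dRh n (ads k 2 t) (br X) (ads k 1 t) Y = Rh n (ads k 2 t) (br qX Y) - br qX (Rh n (ads k 1 t) Y)"
      by (rule dRh_ads[OF k q _ _ rY(1) Y])
        (use rZ rho_eq[OF rX X True] True in \<open>auto simp: qX_def\<close>)
    then show ?thesis using True by (simp add: hY_def)
  next
    case False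
    then have "qX = 0" by (simp add: qX_def rho_def)
    then show ?thesis using False G.endo_zero[OF endo_Rh[OF rZ]] by (simp add: br_simps)
  qed
  \<comment> \<open>The terms with two inverses cancel: \<open>ad k + 2t\<close> maps
    \<open>br qX qY\<close> to \<open>br X qY + br qX Y\<close>. If exactly one degree is 0, the
    total degree is not 0 and both sides vanish.\<close>
  have c3: "br qX qY = ?q W'"
  proof (cases "m = 0 \<and> n = 0")
    case True
    have "ads k 2 t (br qX qY) = br (ads k 1 t qX) qY + br qX (ads k 1 t qY)"
      using ads_br[of k 1 1 t qX qY] by simp
    also have "\<dots> = W'"
      using rho_eq[OF rX X] rho_eq[OF rY(1) Y] True by (simp add: qX_def qY_def W'_def)
    finally show ?thesis
      using True brm[OF mem(3,4)] by (intro rho_eqI[OF rZ, symmetric]) auto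
  next
    case False
    then have "qX = 0 \<or> qY = 0" by (auto simp: qX_def qY_def rho_def)
    then have "br qX qY = 0" by (auto simp: br_simps)
    moreover have "?q W' = 0"
    proof (cases "m + n = 0")
      case True
      then have "m \<noteq> 0" "n \<noteq> 0" using False by auto
      then have "W' = 0" by (simp add: W'_def qX_def qY_def rho_def br_simps)
      then show ?thesis using G.endo_zero[OF endo_rho[OF rZ]] by simp
    qed (simp add: rho_def)
    ultimately show ?thesis by simp
  qed
  \<comment> \<open>The inverse on the bracket acts in total degree 0 only, where its value is
    recovered from its pairings with the basis of \<open>gr 0\<close>. This is the origin of the
    gradient.\<close>
  have c4: "- ?q W = (if m + n = 0 then \<Sum>i<d. smul (form X (dRh n (ads k (- 1) t) (br (b i)) (ads k 1 t) Y)) (b' i) else 0)"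
  proof (cases "m + n = 0")
    case True
    have q0: "?q W \<in> gr 0" using G.endo_in[OF endo_rho[OF rZ] WW(1)] True by simp
    \<comment> \<open>Skewness moves the inverse of \<open>ad k + 2t\<close> onto \<open>Z\<close>
      as minus the inverse of \<open>ad k - 2t\<close>. Invariance and \<open>Rh_skew\<close> then
      free \<open>X\<close>, and \<open>-2 = -1 - 1\<close> is the weight difference that
      \<open>dRh_ads\<close> requires.\<close>
    have pair: "form (- ?q W) Z = form X (dRh n (ads k (- 1) t) (br Z) (ads k 1 t) Y)" if Z: "Z \<in> gr 0" for Z
    proof -
      define Z' where "Z' = rho 0 (ads k (- 2) t) Z"
      have Z': "Z' \<in> gr 0" "Z = ads k (- 2) t Z'"
        using G.endo_in[OF endo_rho[OF r0] Z] rho_eq[OF r0 Z] by (auto simp: Z'_def)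
      have zz: "br Z' Y \<in> gr n" "br Y Z' \<in> gr n" using gr_br[OF Z'(1) Y] gr_br[OF Y Z'(1)] by auto
      have "form (ads k 2 t (?q W)) Z' + form (?q W) (ads k (- 2) t Z') = 0" by (rule ads_form)
      then have "form (- ?q W) Z = form W Z'"
        using rho_eq[OF rZ WW(1) True] Z'(2) by (simp add: form_simps add_eq_0_iff)
      also have "\<dots> = form X (br hY Z') + form hX (br Y Z')"
        by (simp add: W_def form_simps form_br_right)
      also have "form hX (br Y Z') = - form X (Rh n (ads k (- 1) t) (br Y Z'))"
        unfolding hX_def by (rule Rh_skew[OF rX rY(2) True X zz(2)])
      also have "br Y Z' = smul (- 1) (br Z' Y)" by (subst br_anti) simp
      also have "Rh n (ads k (- 1) t) (smul (- 1) (br Z' Y)) = smul (- 1) (Rh n (ads k (- 1) t) (br Z' Y))"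
        by (rule G.endo_smul[OF endo_Rh[OF rY(2)] zz(1)])
      also have "br hY Z' = - br Z' hY" by (rule br_anti)
      also have "form X (- br Z' hY) + - form X (smul (- 1) (Rh n (ads k (- 1) t) (br Z' Y)))
          = form X (Rh n (ads k (- 1) t) (br Z' Y) - br Z' (Rh n (ads k 1 t) Y))"
        by (simp add: form_simps hY_def)
      also have "Rh n (ads k (- 1) t) (br Z' Y) - br Z' (Rh n (ads k 1 t) Y)
          = dRh n (ads k (- 1) t) (br Z) (ads k 1 t) Y"
        by (rule dRh_ads[OF k Z'(1) _ rY(2,1) Y, symmetric]) (simp add: Z'(2))
      finally show ?thesis .
    qed
    have bV: "b i \<in> gr 0" if "i < d" for i
      using db that span_base[of "b i" "b ` {..<d}"] by (auto simp: dual_bases_def indexed_basis_def)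
    have "- ?q W = (\<Sum>i<d. smul (form (- ?q W) (b i)) (b' i))"
      using q0 G.V_neg by (intro dual_expand[OF db]) blast
    also have "\<dots> = (\<Sum>i<d. smul (form X (dRh n (ads k (- 1) t) (br (b i)) (ads k 1 t) Y)) (b' i))"
      using bV by (intro sum.cong refl) (simp add: pair)
    finally show ?thesis using True by simp
  qed (simp add: rho_def)
  \<comment> \<open>The identity for \<open>F\<close>, expanded by \<open>F = Rh + rho\<close> and
    grouped so that each bracketed pair is one of the four facts above.\<close>
  have "br hX hY - ?H W + (- ?q W) + (br hX qY - ?H (br X qY)) + (br qX hY - ?H (br qX Y)) + (br qX qY - ?q W')
     = br (hX + qX) (hY + qY) - (?H (W + W') + ?q (W + W'))"
    unfolding H_add[OF WW] q_add[OF WW] HW' by (simp add: br_simps algebra_simps)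
  then have "br hX hY - ?H W + (- ?q W) + (br hX qY - ?H (br X qY)) + (br qX hY - ?H (br qX Y))
     = smul (- 1/4) (br X Y)"
    unfolding star c3 by simp
  then show ?thesis
    unfolding c1 c2 c4 by (simp add: hX_def hY_def W_def)
qed

end

section \<open>The dynamical Yang-Baxter equation\<close>

context complex_vector_space begin

lemma has_curve_derivative_unique:
  assumes "has_curve_derivative smul g D t" "has_curve_derivative smul g D' t"
  shows "D = D'"
  using assms unfolding has_curve_derivative_def
  by (intro functionals_separate) (blast intro: DERIV_unique)

lemma dir_deriv_eqI:
  "has_curve_derivative smul (\<lambda>t. R (\<kappa> + smul t T) x) D 0 \<Longrightarrow> dir_deriv smul R T \<kappa> x = D"
  unfolding dir_deriv_def by (rule the_equality) (auto intro: has_curve_derivative_unique)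

lemma dir_deriv_zero: "dir_deriv smul R 0 \<kappa> x = 0"
  by (rule dir_deriv_eqI) (simp add: has_curve_derivative_def functional_zero)

text \<open>A line is weakly continuous, so it stays in an open set near \<open>t = 0\<close>.
  Derivatives of a map constrained only on that set are therefore determined.\<close>

lemma openin_fd_topology_line:
  assumes "openin (fd_topology smul V) S" and V: "subspace V" and k: "k \<in> S" "T \<in> V"
  shows "\<forall>\<^sub>F t in at 0. k + smul t T \<in> S"
proof -
  let ?I = "dual"
  obtain U where U: "openin (product_topology (\<lambda>_. euclidean) ?I) U"
    and S: "S = (\<lambda>x. \<lambda>\<phi>\<in>?I. \<phi> x) -` U \<inter> V"
    using assms(1) unfolding fd_topology_def openin_pullback_topology by blast
  let ?g = "\<lambda>t. \<lambda>\<phi>\<in>?I. \<phi> (k + smul t T)"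
  have "continuous_map euclidean (product_topology (\<lambda>_. euclidean) ?I) ?g"
    unfolding continuous_map_componentwise
  proof (intro conjI ballI)
    fix \<phi> assume \<phi>: "\<phi> \<in> ?I"
    have "continuous_on UNIV (\<lambda>t. \<phi> k + t * \<phi> T)" by (intro continuous_intros)
    then show "continuous_map euclidean euclidean (\<lambda>t. ?g t \<phi>)"
      using \<phi> by (simp add: functional_simps[OF \<phi>])
  qed auto
  then have "openin euclidean {t \<in> topspace euclidean. ?g t \<in> U}"
    using U by (rule openin_continuous_map_preimage)
  then have "open {t. ?g t \<in> U}" by simp
  moreover have "0 \<in> {t. ?g t \<in> U}" using k S by simp
  ultimately have "\<forall>\<^sub>F t in at 0. ?g t \<in> U"
    unfolding eventually_at_topological by blast
  moreover have "k + smul t T \<in> V" for t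
    using V k S by (auto intro: subspace_add subspace_scale)
  ultimately show ?thesis unfolding S by (auto elim: eventually_mono)
qed

end

context graded_self_dual_lie_algebra begin

lemma homogeneous_part_spec:
  "homogeneous_part gr m x \<in> gr m" "finite {m. homogeneous_part gr m x \<noteq> 0}"
  "(\<Sum>m | homogeneous_part gr m x \<noteq> 0. homogeneous_part gr m x) = x"
  using theI'[OF gr_direct_sum[of x]] unfolding homogeneous_part_def by auto

lemma homogeneous_part_0:
  assumes "x \<in> gr n" shows "homogeneous_part gr 0 x = (if n = 0 then x else 0)"
proof -
  let ?c = "\<lambda>m. if m = n then x else 0"
  have "{m. ?c m \<noteq> 0} = (if x = 0 then {} else {n})" by auto
  then have "(\<forall>m. ?c m \<in> gr m) \<and> finite {m. ?c m \<noteq> 0} \<and> x = (\<Sum>m | ?c m \<noteq> 0. ?c m)"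
    using assms by auto
  then have "(THE c. (\<forall>m. c m \<in> gr m) \<and> finite {m. c m \<noteq> 0} \<and> x = (\<Sum>m | c m \<noteq> 0. c m)) = ?c"
    by (intro the1_equality gr_direct_sum)
  then show ?thesis unfolding homogeneous_part_def by auto
qed

lemma dual_bases_in: "dual_bases smul form (gr 0) d b b' \<Longrightarrow> i < d \<Longrightarrow> b i \<in> gr 0"
  using span_base[of "b i" "b ` {..<d}"] by (auto simp: dual_bases_def indexed_basis_def)

end

section \<open>The map \<open>R\<close>: evaluation, derivatives, symmetry and the equation\<close>

locale dynamical_R = graded_self_dual_lie_algebra smul gr br form
  for smul :: "complex \<Rightarrow> 'a::ab_group_add \<Rightarrow> 'a" and gr :: "'z::ab_group_add \<Rightarrow> 'a set" and br form +
  fixes Kc :: "'a set" and R :: "'a \<Rightarrow> 'a \<Rightarrow> 'a"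
  assumes open_Kc: "openin (fd_topology smul (gr 0)) Kc"
    and spec: "\<And>k n. k \<in> Kc \<Longrightarrow> n \<noteq> 0 \<Longrightarrow> spectrum_on smul (gr n) (br k) \<inter> two_pi_i_Ints = {}"
    and spec_0: "\<And>k. k \<in> Kc \<Longrightarrow> spectrum_on smul (gr 0) (br k) \<inter> (two_pi_i_Ints - {0}) = {}"
    and R_linear: "\<And>k. k \<in> Kc \<Longrightarrow> Vector_Spaces.linear smul smul (R k)"
    and R_0: "\<And>k x. k \<in> Kc \<Longrightarrow> x \<in> gr 0 \<Longrightarrow>
           R k x = holomorphic_calculus smul (- (two_pi_i_Ints - {0})) f_fun (gr 0) (br k) x"
    and R_n: "\<And>k n x. k \<in> Kc \<Longrightarrow> n \<noteq> 0 \<Longrightarrow> x \<in> gr n \<Longrightarrow>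
           R k x = holomorphic_calculus smul (- two_pi_i_Ints) F_fun (gr n) (br k) x"
begin

abbreviation part :: "'z \<Rightarrow> 'a \<Rightarrow> 'a" where "part \<equiv> homogeneous_part gr"

abbreviation nabla :: "'a \<Rightarrow> 'a \<Rightarrow> 'a \<Rightarrow> 'a" where "nabla \<equiv> dir_deriv smul R"

abbreviation grad where "grad d b b' \<equiv> form_gradient smul form d b b' R"

lemma Kc_gr: "k \<in> Kc \<Longrightarrow> k \<in> gr 0"
  using open_Kc unfolding fd_topology_def openin_pullback_topology by blast

lemma R_add: "k \<in> Kc \<Longrightarrow> R k (x + y) = R k x + R k y"
  and R_smul: "k \<in> Kc \<Longrightarrow> R k (smul c x) = smul c (R k x)"
  using R_linear unfolding Vector_Spaces.linear_iff by blast+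

lemma R_zero: "k \<in> Kc \<Longrightarrow> R k 0 = 0"
  using R_smul[of k 0 0] by simp

lemma R_sum: "k \<in> Kc \<Longrightarrow> R k (\<Sum>i\<in>I. g i) = (\<Sum>i\<in>I. R k (g i))"
  by (induction I rule: infinite_finite_induct) (simp_all add: R_zero R_add)

text \<open>The spectral conditions say precisely that the denominators \<open>f_den\<close> and
  \<open>F_den\<close> have no zero on the spectrum; the contour integrals then reduce to quotients
  of power series.\<close>

lemma
  assumes k: "k \<in> Kc"
  shows bij_r_den: "bij_betw (pser (r_den n) (br k)) (gr n) (gr n)"
    and R_eq: "x \<in> gr n \<Longrightarrow> R k x = Rh n (br k) x"
proof -
  note l = endo_br[OF Kc_gr[OF k]]
  note f = G.holomorphic_calculus_two_pi_i[OF l entire_f_num entire_f_den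
      Diff_subset val_f_den_0_iff spec_0[OF k] f_fun_quotient]
  note F = G.holomorphic_calculus_two_pi_i[OF l entire_F_num entire_F_den
      order_refl val_F_den_0_iff spec[OF k] F_fun_quotient]
  show "bij_betw (pser (r_den n) (br k)) (gr n) (gr n)"
    using f(1) F(1) by (simp add: r_den_def)
  show "R k x = Rh n (br k) x" if "x \<in> gr n"
    using f(2) F(2) R_0[OF k] R_n[OF k] that by (cases "n = 0") (simp_all add: r_den_def r_num_def)
qed

lemma oplim_Rh: "k \<in> Kc \<Longrightarrow> G.oplim n (\<lambda>t. Rh n (ads k s t)) (Rh n (br k)) (at 0)"
  by (rule G.oplim_quo[OF oplim_ads[OF Kc_gr] entire_r bij_r_den])

lemma R_in: "k \<in> Kc \<Longrightarrow> x \<in> gr n \<Longrightarrow> R k x \<in> gr n"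
  using G.endo_in[OF G.oplD(2)[OF oplim_Rh]] by (simp add: R_eq)

lemma weak_lim_Rh: "k \<in> Kc \<Longrightarrow> x \<in> gr n \<Longrightarrow> weak_lim (\<lambda>t. Rh n (ads k s t) x) (R k x) (at 0)"
  using G.oplD(3)[OF oplim_Rh] by (simp add: R_eq)

lemma eventually_Rh_in:
  assumes "k \<in> Kc" "x \<in> gr n" shows "\<forall>\<^sub>F t in at 0. Rh n (ads k s t) x \<in> gr n"
  using G.oplD(1)[OF oplim_Rh[OF assms(1)]] by (rule eventually_mono) (rule G.endo_in[OF _ assms(2)])

text \<open>Both shifted operators tend to \<open>ad k\<close> whatever the weights, so all the
  divided differences of the shifted equation share one limit, the derivative.\<close>

lemma oplim_dRh:
  assumes "k \<in> Kc" "T \<in> gr 0"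
  shows "G.oplim n (\<lambda>t. dRh n (ads k s t) (br T) (ads k s' t)) (dRh n (br k) (br T) (br k)) (at 0)"
  by (rule G.oplim_dquo[OF oplim_ads[OF Kc_gr[OF assms(1)]] G.oplim_const[OF endo_br[OF assms(2)]]
      oplim_ads[OF Kc_gr[OF assms(1)]] entire_r bij_r_den[OF assms(1)] bij_r_den[OF assms(1)]])

text \<open>\<open>ad\<close> is linear, so the line \<open>k + t T\<close> becomes a line of
  operators and \<open>quo_deriv\<close> applies; near \<open>t = 0\<close> the line stays in
  \<open>Kc\<close>, where \<open>R\<close> is the quotient.\<close>

lemma deriv_homogeneous:
  assumes k: "k \<in> Kc" and T: "T \<in> gr 0" and x: "x \<in> gr n"
  shows "has_curve_derivative smul (\<lambda>t. R (k + smul t T) x) (dRh n (br k) (br T) (br k) x) 0"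
  unfolding has_curve_derivative_def has_field_derivative_iff
proof
  fix \<phi> assume \<phi>: "\<phi> \<in> dual"
  let ?D = "dRh n (br k) (br T) (br k) x"
  have "weak_lim (\<lambda>t. smul (1 / t) (Rh n (\<lambda>y. br k y + smul t (br T y)) x - Rh n (br k) x)) ?D (at 0)"
    by (rule G.quo_deriv[OF endo_br[OF Kc_gr[OF k]] endo_br[OF T] entire_r bij_r_den[OF k] x])
  then have "((\<lambda>t. \<phi> (smul (1 / t) (Rh n (\<lambda>y. br k y + smul t (br T y)) x - Rh n (br k) x))) \<longlongrightarrow> \<phi> ?D) (at 0)"
    using \<phi> unfolding weak_lim_def by blast
  moreover have "\<forall>\<^sub>F t in at 0. \<phi> (smul (1 / t) (Rh n (\<lambda>y. br k y + smul t (br T y)) x - Rh n (br k) x))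
      = (\<phi> (R (k + smul t T) x) - \<phi> (R (k + smul 0 T) x)) / (t - 0)"
    using openin_fd_topology_line[OF open_Kc G.subspace_V k T]
  proof eventually_elim
    case (elim t)
    have "br (k + smul t T) = (\<lambda>y. br k y + smul t (br T y))" by (auto simp: br_simps)
    then show ?case using R_eq[OF elim x] R_eq[OF k x] by (simp add: functional_simps[OF \<phi>])
  qed
  ultimately show "((\<lambda>t. (\<phi> (R (k + smul t T) x) - \<phi> (R (k + smul 0 T) x)) / (t - 0)) \<longlongrightarrow> \<phi> ?D) (at 0)"
    by (rule Lim_transform_eventually)
qed

lemma dir_deriv_homogeneous:
  "k \<in> Kc \<Longrightarrow> T \<in> gr 0 \<Longrightarrow> x \<in> gr n \<Longrightarrow> nabla T k x = dRh n (br k) (br T) (br k) x"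
  by (rule dir_deriv_eqI[of R k T x, OF deriv_homogeneous])

lemma deriv_sum:
  assumes k: "k \<in> Kc" and T: "T \<in> gr 0"
    and D: "\<And>i. i \<in> I \<Longrightarrow> has_curve_derivative smul (\<lambda>t. R (k + smul t T) (g i)) (D i) 0"
  shows "has_curve_derivative smul (\<lambda>t. R (k + smul t T) (\<Sum>i\<in>I. g i)) (\<Sum>i\<in>I. D i) 0"
  unfolding has_curve_derivative_def
proof
  fix \<phi> assume \<phi>: "\<phi> \<in> dual"
  have 1: "((\<lambda>t. \<Sum>i\<in>I. \<phi> (R (k + smul t T) (g i))) has_field_derivative (\<Sum>i\<in>I. \<phi> (D i))) (at 0)"
    using D \<phi> unfolding has_curve_derivative_def by (intro DERIV_sum) blast
  \<comment> \<open>Additivity of \<open>R\<close> is available on \<open>Kc\<close> only, so the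
    two functions are compared near 0, and at 0 itself.\<close>
  have 2: "\<forall>\<^sub>F t in nhds 0. (\<Sum>i\<in>I. \<phi> (R (k + smul t T) (g i))) = \<phi> (R (k + smul t T) (\<Sum>i\<in>I. g i))"
    unfolding eventually_nhds_conv_at
  proof
    show "\<forall>\<^sub>F t in at 0. (\<Sum>i\<in>I. \<phi> (R (k + smul t T) (g i))) = \<phi> (R (k + smul t T) (\<Sum>i\<in>I. g i))"
      using openin_fd_topology_line[OF open_Kc G.subspace_V k T]
      by eventually_elim (simp add: R_sum functional_sum[OF \<phi>])
  qed (simp add: R_sum[OF k] functional_sum[OF \<phi>])
  show "((\<lambda>t. \<phi> (R (k + smul t T) (\<Sum>i\<in>I. g i))) has_field_derivative \<phi> (\<Sum>i\<in>I. D i)) (at 0)"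
    unfolding functional_sum[OF \<phi>, of D] using 1 unfolding DERIV_cong_ev[OF refl 2 refl] .
qed

lemma deriv_exists:
  assumes "k \<in> Kc" "T \<in> gr 0"
  shows "has_curve_derivative smul (\<lambda>t. R (k + smul t T) X) (nabla T k X) 0"
proof -
  let ?p = "\<lambda>m. part m X"
  have "has_curve_derivative smul (\<lambda>t. R (k + smul t T) (\<Sum>m | ?p m \<noteq> 0. ?p m))
      (\<Sum>m | ?p m \<noteq> 0. dRh m (br k) (br T) (br k) (?p m)) 0"
    by (rule deriv_sum[OF assms deriv_homogeneous[OF assms homogeneous_part_spec(1)]])
  then have *: "has_curve_derivative smul (\<lambda>t. R (k + smul t T) X)
      (\<Sum>m | ?p m \<noteq> 0. dRh m (br k) (br T) (br k) (?p m)) 0"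
    unfolding homogeneous_part_spec(3) .
  show ?thesis unfolding dir_deriv_eqI[of R k T X, OF *] by (rule *)
qed

lemma dir_deriv_sum:
  assumes "k \<in> Kc" "T \<in> gr 0"
  shows "nabla T k (\<Sum>i\<in>I. g i) = (\<Sum>i\<in>I. nabla T k (g i))"
  by (rule dir_deriv_eqI[of R k T "\<Sum>i\<in>I. g i", OF deriv_sum[OF assms deriv_exists[OF assms]]])

text \<open>Additivity in the direction is not at stake: for \<open>m \<noteq> 0\<close> the
  direction is 0 and the summand vanishes.\<close>

lemma dir_deriv_hp0:
  "nabla (part 0 X) k Z
     = (\<Sum>m | part m X \<noteq> 0. nabla (part 0 (part m X)) k Z)"
proof -
  let ?p = "\<lambda>m. part m X"
  have "(\<Sum>m | ?p m \<noteq> 0. nabla (part 0 (?p m)) k Z)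
      = (\<Sum>m | ?p m \<noteq> 0. if m = 0 then nabla (?p 0) k Z else 0)"
    by (intro sum.cong refl) (auto simp: homogeneous_part_0[OF homogeneous_part_spec(1)] dir_deriv_zero)
  also have "\<dots> = nabla (?p 0) k Z"
    using homogeneous_part_spec(2)[of X] by (auto simp: sum.delta dir_deriv_zero)
  finally show ?thesis by simp
qed

text \<open>In opposite degrees this is the limit of \<open>Rh_skew\<close>; in all others both
  sides vanish because \<open>R\<close> preserves degrees and the form pairs only opposite
  ones.\<close>

lemma R_skew:
  assumes k: "k \<in> Kc"
  shows "form (R k X) Y = - form X (R k Y)"
proof -
  have hom: "form (R k x) y = - form x (R k y)" if x: "x \<in> gr m" and y: "y \<in> gr n" for x y m n
  proof (cases "m + n = 0")
    case True
    have "\<forall>\<^sub>F t in at 0. regular m (ads k 1 t)" "\<forall>\<^sub>F t in at 0. regular n (ads k (- 1) t)"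
      using regular_ads[OF Kc_gr[OF k] _ bij_r_den[OF k]] by auto
    then have e: "\<forall>\<^sub>F t in at 0. form (Rh m (ads k 1 t) x) y = - form x (Rh n (ads k (- 1) t) y)"
      by eventually_elim (rule Rh_skew[OF _ _ True x y])
    have "((\<lambda>t. form (Rh m (ads k 1 t) x) y) \<longlongrightarrow> form (R k x) y) (at 0)"
      by (rule bspec[OF weak_lim_Rh[OF k x, unfolded weak_lim_def] form_functional(2)])
    moreover have "((\<lambda>t. - form x (Rh n (ads k (- 1) t) y)) \<longlongrightarrow> - form x (R k y)) (at 0)"
      by (rule tendsto_minus[OF bspec[OF weak_lim_Rh[OF k y, unfolded weak_lim_def] form_functional(1)]])
    ultimately show ?thesis
      unfolding tendsto_cong[OF e] by (rule tendsto_unique[OF at_neq_bot])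
  next
    case False
    then show ?thesis using form_gr[OF False R_in[OF k x] y] form_gr[OF False x R_in[OF k y]] by simp
  qed
  let ?X = "\<lambda>m. part m X" and ?Y = "\<lambda>m. part m Y"
  have "form (R k (\<Sum>m | ?X m \<noteq> 0. ?X m)) (\<Sum>n | ?Y n \<noteq> 0. ?Y n)
      = - form (\<Sum>m | ?X m \<noteq> 0. ?X m) (R k (\<Sum>n | ?Y n \<noteq> 0. ?Y n))"
    by (simp add: R_sum[OF k] functional_sum[OF form_functional(1)] functional_sum[OF form_functional(2)]
        hom[OF homogeneous_part_spec(1) homogeneous_part_spec(1)] sum_negf)
  then show ?thesis unfolding homogeneous_part_spec(3) .
qed

text \<open>An exact case of \<open>dquo_eq\<close> without a limit: for \<open>C = - ad T\<close>
  Jacobi gives \<open>ad k C - C ad k = ad [T, k]\<close>.\<close>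

lemma R_equivariant:
  assumes k: "k \<in> Kc" and T: "T \<in> gr 0"
  shows "nabla (br T k) k X = br T (R k X) - R k (br T X)"
proof -
  have Tk: "br T k \<in> gr 0" using gr_br[OF T Kc_gr[OF k]] by simp
  have hom: "nabla (br T k) k x = br T (R k x) - R k (br T x)" if x: "x \<in> gr n" for x n
  proof -
    let ?C = "\<lambda>y. smul (- 1) (br T y)"
    have "dRh n (br k) (br (br T k)) (br k) x = Rh n (br k) (?C x) - ?C (Rh n (br k) x)"
    proof (rule G.dquo_eq[OF endo_br endo_br G.endo_times[OF endo_br[OF T]] _ x entire_r bij_r_den bij_r_den])
      fix y
      show "br k (?C y) - ?C (br k y) = br (br T k) y"
        using br_derivation[of T k y] by (simp add: br_neg_right)
    qed (use k Kc_gr in auto)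
    moreover have "br T x \<in> gr n" using gr_br[OF T x] by simp
    moreover have "?C x \<in> gr n" using gr_br[OF T x] G.V_smul by simp
    ultimately show ?thesis
      using dir_deriv_homogeneous[OF k Tk x] R_eq[OF k \<open>?C x \<in> gr n\<close>] R_eq[OF k x] R_smul[OF k, of "- 1" "br T x"]
      by simp
  qed
  let ?X = "\<lambda>m. part m X"
  have "nabla (br T k) k (\<Sum>m | ?X m \<noteq> 0. ?X m)
      = br T (R k (\<Sum>m | ?X m \<noteq> 0. ?X m)) - R k (br T (\<Sum>m | ?X m \<noteq> 0. ?X m))"
    by (simp add: dir_deriv_sum[OF k Tk] R_sum[OF k] br_sum_right
        hom[OF homogeneous_part_spec(1)] sum_subtractf)
  then show ?thesis unfolding homogeneous_part_spec(3) .
qed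

definition dybe :: "nat \<Rightarrow> (nat \<Rightarrow> 'a) \<Rightarrow> (nat \<Rightarrow> 'a) \<Rightarrow> 'a \<Rightarrow> 'a \<Rightarrow> 'a \<Rightarrow> 'a" where
  "dybe d b b' k X Y = br (R k X) (R k Y) - R k (br X (R k Y) + br (R k X) Y)
     + grad d b b' k X Y
     + nabla (part 0 Y) k X
     - nabla (part 0 X) k Y"

text \<open>The left-hand side of the shifted equation is constant for small
  \<open>t \<noteq> 0\<close> and converges term by term to the unshifted one; weak limits are
  unique.\<close>

lemma dybe_homogeneous:
  assumes k: "k \<in> Kc" and X: "X \<in> gr m" and Y: "Y \<in> gr n"
    and db: "dual_bases smul form (gr 0) d b b'"
  shows "dybe d b b' k X Y = smul (- 1/4) (br X Y)"
proof -
  note kg = Kc_gr[OF k]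
  note bi = dual_bases_in[OF db]
  let ?G = "\<lambda>t. if m + n = 0 then \<Sum>i<d. smul (form X (dRh n (ads k (- 1) t) (br (b i)) (ads k 1 t) Y)) (b' i) else 0"
  let ?DY = "\<lambda>t. if n = 0 then dRh m (ads k 2 t) (br Y) (ads k 1 t) X else 0"
  let ?DX = "\<lambda>t. if m = 0 then dRh n (ads k 2 t) (br X) (ads k 1 t) Y else 0"
  let ?hX = "\<lambda>t. Rh m (ads k 1 t) X" and ?hY = "\<lambda>t. Rh n (ads k 1 t) Y"
  let ?E = "\<lambda>t. br (?hX t) (?hY t) - Rh (m + n) (ads k 2 t) (br X (?hY t) + br (?hX t) Y) + ?G t + ?DY t - ?DX t"
  have "\<forall>\<^sub>F t in at 0. regular m (ads k 1 t) \<and> regular n (ads k 1 t) \<and> regular n (ads k (- 1) t)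
      \<and> regular (m + n) (ads k 2 t) \<and> regular 0 (ads k (- 2) t)"
    using regular_ads[OF kg _ bij_r_den[OF k]] by (intro eventually_conj) auto
  then have "\<forall>\<^sub>F t in at 0. ?E t = smul (- 1/4) (br X Y)"
  proof eventually_elim
    case (elim t)
    then show ?case by (intro shifted_equation[OF kg X Y db]) auto
  qed
  then have const: "weak_lim ?E (smul (- 1/4) (br X Y)) (at 0)"
    using weak_lim_const by (subst weak_lim_cong) auto
  note hX = weak_lim_Rh[OF k X, of 1] eventually_Rh_in[OF k X, of 1] R_in[OF k X]
  note hY = weak_lim_Rh[OF k Y, of 1] eventually_Rh_in[OF k Y, of 1] R_in[OF k Y]
  have cX: "\<forall>\<^sub>F t in at 0. X \<in> gr m" and cY: "\<forall>\<^sub>F t in at 0. Y \<in> gr n" using X Y by auto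
  have 1: "weak_lim (\<lambda>t. br (?hX t) (?hY t)) (br (R k X) (R k Y)) (at 0)"
    by (rule weak_lim_bilin[OF fd_gr fd_gr bilin_br hX hY])
  have w: "weak_lim (\<lambda>t. br X (?hY t) + br (?hX t) Y) (br X (R k Y) + br (R k X) Y) (at 0)"
    by (rule weak_lim_add[OF weak_lim_bilin[OF fd_gr fd_gr bilin_br weak_lim_const cX X hY]
          weak_lim_bilin[OF fd_gr fd_gr bilin_br hX weak_lim_const cY Y]])
  have W: "br X (R k Y) + br (R k X) Y \<in> gr (m + n)"
    by (rule G.V_add[OF gr_br[OF X hY(3)] gr_br[OF hX(3) Y]])
  have "\<forall>\<^sub>F t in at 0. br X (?hY t) + br (?hX t) Y \<in> gr (m + n)"
    using hX(2) hY(2) by eventually_elim (rule G.V_add[OF gr_br[OF X] gr_br[OF _ Y]])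
  then have 2: "weak_lim (\<lambda>t. Rh (m + n) (ads k 2 t) (br X (?hY t) + br (?hX t) Y))
      (R k (br X (R k Y) + br (R k X) Y)) (at 0)"
    unfolding R_eq[OF k W] by (rule G.oplim_app[OF oplim_Rh[OF k] w _ W])
  have dlim: "weak_lim (\<lambda>t. dRh j (ads k s t) (br T) (ads k s' t) Z) (nabla T k Z) (at 0)"
    if "T \<in> gr 0" "Z \<in> gr j" for T Z j s s'
    unfolding dir_deriv_homogeneous[OF k that] by (rule G.oplD(3)[OF oplim_dRh[OF k that(1)] that(2)])
  have 3: "weak_lim ?G (grad d b b' k X Y) (at 0)"
  proof (cases "m + n = 0")
    case True
    have "weak_lim (\<lambda>t. \<Sum>i<d. smul (form X (dRh n (ads k (- 1) t) (br (b i)) (ads k 1 t) Y)) (b' i))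
        (grad d b b' k X Y) (at 0)"
      unfolding form_gradient_def
    proof (intro weak_lim_sum weak_lim_smul weak_lim_const)
      fix i assume "i \<in> {..<d}"
      then show "((\<lambda>t. form X (dRh n (ads k (- 1) t) (br (b i)) (ads k 1 t) Y)) \<longlongrightarrow>
          form X (nabla (b i) k Y)) (at 0)"
        using dlim[OF bi Y] form_functional(1) unfolding weak_lim_def by blast
    qed
    then show ?thesis using True by simp
  next
    case False
    \<comment> \<open>The derivative of \<open>R\<close> preserves degrees too, so outside total
      degree 0 the gradient vanishes by orthogonality.\<close>
    have "form X (nabla (b i) k Y) = 0" if "i < d" for i
      unfolding dir_deriv_homogeneous[OF k bi[OF that] Y]
      by (rule form_gr[OF False X G.endo_in[OF G.oplD(2)[OF oplim_dRh[OF k bi[OF that]]] Y]])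
    then have "grad d b b' k X Y = 0"
      by (simp add: form_gradient_def)
    then show ?thesis using False by (simp add: weak_lim_const)
  qed
  have 4: "weak_lim ?DY (nabla (part 0 Y) k X) (at 0)"
  proof (cases "n = 0")
    case True
    then have "Y \<in> gr 0" using Y by simp
    then show ?thesis using dlim[OF _ X] True by (simp add: homogeneous_part_0[OF Y])
  qed (simp add: homogeneous_part_0[OF Y] dir_deriv_zero weak_lim_const)
  have 5: "weak_lim ?DX (nabla (part 0 X) k Y) (at 0)"
  proof (cases "m = 0")
    case True
    then have "X \<in> gr 0" using X by simp
    then show ?thesis using dlim[OF _ Y] True by (simp add: homogeneous_part_0[OF X])
  qed (simp add: homogeneous_part_0[OF X] dir_deriv_zero weak_lim_const)
  have "weak_lim ?E (dybe d b b' k X Y) (at 0)"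
    unfolding dybe_def by (rule weak_lim_diff[OF weak_lim_add[OF weak_lim_add[OF weak_lim_diff[OF 1 2] 3] 4] 5])
  then show ?thesis using const at_neq_bot by (rule weak_lim_unique)
qed

lemma dybe_sum_right:
  assumes k: "k \<in> Kc" and db: "dual_bases smul form (gr 0) d b b'"
  shows "dybe d b b' k X Y = (\<Sum>n | part n Y \<noteq> 0. dybe d b b' k X (part n Y))"
proof -
  let ?I = "{n. part n Y \<noteq> 0}" and ?p = "\<lambda>n. part n Y"
  have Y: "(\<Sum>n\<in>?I. ?p n) = Y" by (rule homogeneous_part_spec(3))
  have RY: "R k Y = (\<Sum>n\<in>?I. R k (?p n))" using R_sum[OF k, of ?p ?I] unfolding Y .
  have 1: "br (R k X) (R k Y) = (\<Sum>n\<in>?I. br (R k X) (R k (?p n)))"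
    unfolding RY by (rule br_sum_right)
  have "br X (R k Y) + br (R k X) Y = (\<Sum>n\<in>?I. br X (R k (?p n)) + br (R k X) (?p n))"
    using br_sum_right[of "R k X" ?p ?I] unfolding RY Y by (simp add: br_sum_right sum.distrib)
  then have 2: "R k (br X (R k Y) + br (R k X) Y) = (\<Sum>n\<in>?I. R k (br X (R k (?p n)) + br (R k X) (?p n)))"
    by (simp only: R_sum[OF k])
  have dd: "nabla T k Y = (\<Sum>n\<in>?I. nabla T k (?p n))" if "T \<in> gr 0" for T
    using dir_deriv_sum[OF k that, of ?p ?I] unfolding Y .
  have "grad d b b' k X Y
      = (\<Sum>i<d. \<Sum>n\<in>?I. smul (form X (nabla (b i) k (?p n))) (b' i))"
    unfolding form_gradient_def
    by (intro sum.cong refl)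
      (simp only: dd[OF dual_bases_in[OF db]] lessThan_iff functional_sum[OF form_functional(1)] scale_sum_left)
  also have "\<dots> = (\<Sum>n\<in>?I. grad d b b' k X (?p n))"
    unfolding form_gradient_def by (rule sum.swap)
  finally have 3: "grad d b b' k X Y = (\<Sum>n\<in>?I. grad d b b' k X (?p n))" .
  show ?thesis
    unfolding dybe_def sum_subtractf sum.distrib 1 2 3 dd[OF homogeneous_part_spec(1)]
      dir_deriv_hp0[of Y k X] ..
qed

lemma dybe_sum_left:
  assumes k: "k \<in> Kc"
  shows "dybe d b b' k X Y = (\<Sum>n | part n X \<noteq> 0. dybe d b b' k (part n X) Y)"
proof -
  let ?I = "{n. part n X \<noteq> 0}" and ?p = "\<lambda>n. part n X"
  have X: "(\<Sum>n\<in>?I. ?p n) = X" by (rule homogeneous_part_spec(3))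
  have RX: "R k X = (\<Sum>n\<in>?I. R k (?p n))" using R_sum[OF k, of ?p ?I] unfolding X .
  have 1: "br (R k X) (R k Y) = (\<Sum>n\<in>?I. br (R k (?p n)) (R k Y))"
    unfolding RX by (rule br_sum_left)
  have "br X (R k Y) + br (R k X) Y = (\<Sum>n\<in>?I. br (?p n) (R k Y) + br (R k (?p n)) Y)"
    using br_sum_left[of ?p ?I "R k Y"] unfolding RX X by (simp add: br_sum_left sum.distrib)
  then have 2: "R k (br X (R k Y) + br (R k X) Y) = (\<Sum>n\<in>?I. R k (br (?p n) (R k Y) + br (R k (?p n)) Y))"
    by (simp only: R_sum[OF k])
  have dd: "nabla T k X = (\<Sum>n\<in>?I. nabla T k (?p n))" if "T \<in> gr 0" for T
    using dir_deriv_sum[OF k that, of ?p ?I] unfolding X .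
  have "form X z = (\<Sum>n\<in>?I. form (?p n) z)" for z
    using functional_sum[OF form_functional(2), of ?p ?I] unfolding X .
  then have "grad d b b' k X Y
      = (\<Sum>i<d. \<Sum>n\<in>?I. smul (form (?p n) (nabla (b i) k Y)) (b' i))"
    unfolding form_gradient_def by (intro sum.cong refl) (simp only: scale_sum_left)
  also have "\<dots> = (\<Sum>n\<in>?I. grad d b b' k (?p n) Y)"
    unfolding form_gradient_def by (rule sum.swap)
  finally have 3: "grad d b b' k X Y = (\<Sum>n\<in>?I. grad d b b' k (?p n) Y)" .
  show ?thesis
    unfolding dybe_def sum_subtractf sum.distrib 1 2 3 dd[OF homogeneous_part_spec(1)]
      dir_deriv_hp0[of X k Y] ..
qed

lemma dybe:
  assumes k: "k \<in> Kc" and db: "dual_bases smul form (gr 0) d b b'"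
  shows "dybe d b b' k X Y = smul (- 1/4) (br X Y)"
proof -
  let ?X = "\<lambda>m. part m X" and ?Y = "\<lambda>m. part m Y"
  have "dybe d b b' k X Y = (\<Sum>m | ?X m \<noteq> 0. \<Sum>n | ?Y n \<noteq> 0. dybe d b b' k (?X m) (?Y n))"
    by (subst dybe_sum_left[OF k], intro sum.cong refl) (rule dybe_sum_right[OF k db])
  also have "\<dots> = (\<Sum>m | ?X m \<noteq> 0. \<Sum>n | ?Y n \<noteq> 0. smul (- 1/4) (br (?X m) (?Y n)))"
    by (simp only: dybe_homogeneous[OF k homogeneous_part_spec(1) homogeneous_part_spec(1) db])
  also have "\<dots> = smul (- 1/4) (br (\<Sum>m | ?X m \<noteq> 0. ?X m) (\<Sum>n | ?Y n \<noteq> 0. ?Y n))"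
    unfolding br_sum_left by (simp only: br_sum_right scale_sum_right)
  finally show ?thesis unfolding homogeneous_part_spec(3) .
qed

end

theorem theorem1:
  fixes smul :: "complex \<Rightarrow> 'a::ab_group_add \<Rightarrow> 'a"
    and gr :: "'z::ab_group_add \<Rightarrow> 'a set"
    and br :: "'a \<Rightarrow> 'a \<Rightarrow> 'a"
    and form :: "'a \<Rightarrow> 'a \<Rightarrow> complex"
    and Kc :: "'a set"
    and R :: "'a \<Rightarrow> 'a \<Rightarrow> 'a"
  assumes "graded_self_dual_lie_algebra smul gr br form"
    and "openin (fd_topology smul (gr 0)) Kc" and "Kc \<noteq> {}"
    and "\<And>\<kappa> n. \<kappa> \<in> Kc \<Longrightarrow> n \<noteq> 0 \<Longrightarrow> spectrum_on smul (gr n) (br \<kappa>) \<inter> two_pi_i_Ints = {}"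
    and "\<And>\<kappa>. \<kappa> \<in> Kc \<Longrightarrow> spectrum_on smul (gr 0) (br \<kappa>) \<inter> (two_pi_i_Ints - {0}) = {}"
    and "\<And>\<kappa>. \<kappa> \<in> Kc \<Longrightarrow> Vector_Spaces.linear smul smul (R \<kappa>)"
    and "\<And>\<kappa> n. \<kappa> \<in> Kc \<Longrightarrow> R \<kappa> ` gr n \<subseteq> gr n"
    and "\<And>\<kappa> x. \<kappa> \<in> Kc \<Longrightarrow> x \<in> gr 0 \<Longrightarrow>
           R \<kappa> x = holomorphic_calculus smul (- (two_pi_i_Ints - {0})) f_fun (gr 0) (br \<kappa>) x"
    and "\<And>\<kappa> n x. \<kappa> \<in> Kc \<Longrightarrow> n \<noteq> 0 \<Longrightarrow> x \<in> gr n \<Longrightarrow>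
           R \<kappa> x = holomorphic_calculus smul (- two_pi_i_Ints) F_fun (gr n) (br \<kappa>) x"
  shows "(\<forall>\<kappa>\<in>Kc. \<forall>T\<in>gr 0. \<forall>X.
            \<exists>D. has_curve_derivative smul (\<lambda>t. R (\<kappa> + smul t T) X) D 0) \<and>
         (\<forall>d b b'. dual_bases smul form (gr 0) d b b' \<longrightarrow>
            (\<forall>\<kappa>\<in>Kc. \<forall>X Y.
               br (R \<kappa> X) (R \<kappa> Y) - R \<kappa> (br X (R \<kappa> Y) + br (R \<kappa> X) Y)
                 + form_gradient smul form d b b' R \<kappa> X Y
                 + dir_deriv smul R (homogeneous_part gr 0 Y) \<kappa> X
                 - dir_deriv smul R (homogeneous_part gr 0 X) \<kappa> Y
               = smul (- 1/4) (br X Y))) \<and>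
         (\<forall>\<kappa>\<in>Kc. \<forall>X Y. form (R \<kappa> X) Y = - form X (R \<kappa> Y)) \<and>
         (\<forall>\<kappa>\<in>Kc. \<forall>T\<in>gr 0. \<forall>X.
            dir_deriv smul R (br T \<kappa>) \<kappa> X = br T (R \<kappa> X) - R \<kappa> (br T X))"
proof -
  interpret dynamical_R smul gr br form Kc R
    using assms by (intro dynamical_R.intro dynamical_R_axioms.intro) auto
  show ?thesis
    using deriv_exists dybe[unfolded dybe_def] R_skew R_equivariant by blast
qed

end
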